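(* Let $p,q$ be primes with $p>2$ and $q\equiv 1\pmod{p^2}$. For groups $X,Y$ of order $p^2q$ let $N(X,Y)$ be the number of isomorphism classes of skew braces $(B,+,\circ)$ with $(B,+)\cong X$ and $(B,\circ)\cong Y$. Then: (1) For $X=\mathbb{Z}_q\rtimes_{h^p}\mathbb{Z}_{p^2}$: $N(X,\mathbb{Z}_{p^2q})=2p$, $N(X,\mathbb{Z}_q\rtimes_{h^p}\mathbb{Z}_{p^2})=2p(p-1)$, $N(X,\mathbb{Z}_q\rtimes_h\mathbb{Z}_{p^2})=2p(p-1)$, $N(X,\mathbb{Z}_p^2\times\mathbb{Z}_q)=0$, $N(X,\mathbb{Z}_p\times(\mathbb{Z}_q\rtimes_{h^p}\mathbb{Z}_p))=0$. (2) For $X=\mathbb{Z}_q\rtimes_h\mathbb{Z}_{p^2}$: $N(X,\mathbb{Z}_{p^2q})=2$, $N(X,\mathbb{Z}_q\rtimes_{h^p}\mathbb{Z}_{p^2})=2(p-1)$, $N(X,\mathbb{Z}_q\rtimes_h\mathbb{Z}_{p^2})=2p(p-1)$, $N(X,\mathbb{Z}_p^2\times\mathbb{Z}_q)=0$, $N(X,\mathbb{Z}_p\times(\mathbb{Z}_q\rtimes_{h^p}\mathbb{Z}_p))=0$. (3) For $X=\mathbb{Z}_p\times(\mathbb{Z}_q\rtimes_{h^p}\mathbb{Z}_p)$: $N(X,\mathbb{Z}_{p^2q})=0$, $N(X,\mathbb{Z}_q\rtimes_{h^p}\mathbb{Z}_{p^2})=0$, $N(X,\mathbb{Z}_q\rtimes_h\mathbb{Z}_{p^2})=0$,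 $N(X,\mathbb{Z}_p^2\times\mathbb{Z}_q)=4$, $N(X,\mathbb{Z}_p\times(\mathbb{Z}_q\rtimes_{h^p}\mathbb{Z}_p))=6p-4$.
   Context: A skew (left) brace is a triple $(B,+,\circ)$ where $(B,+)$ and $(B,\circ)$ are groups (not necessarily abelian) such that $a\circ(b+c)=a\circ b-a+a\circ c$ for all $a,b,c\in B$; isomorphisms are bijections preserving both operations. Fix an element $h$ of order $p^2$ in $\mathbb{Z}_q^\times$. For $u\in\{h,h^p\}$, $\mathbb{Z}_q\rtimes_u\mathbb{Z}_{p^2}=\langle\sigma,\tau\mid\tau^q=\sigma^{p^2}=1,\ \sigma\tau\sigma^{-1}=\tau^u\rangle$, and $\mathbb{Z}_p\times(\mathbb{Z}_q\rtimes_{h^p}\mathbb{Z}_p)=\langle\sigma,\tau,\epsilon\mid\sigma^p=\tau^p=\epsilon^q=1,\ [\epsilon,\tau]=[\tau,\sigma]=1,\ \sigma\epsilon\sigma^{-1}=\epsilon^{h^p}\rangle$. *)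

theory Defs
  imports "HOL-Algebra.Algebra" "HOL-Number_Theory.Number_Theory"
begin

text \<open>
  A skew brace is given by two group records on a common carrier: \<^term>\<open>A\<close> is the
  additive group (not necessarily abelian, although written additively in the literature) and
  \<^term>\<open>M\<close> is the multiplicative group. The axiom is \<open>a \<circ> (b + c) = a \<circ> b - a + a \<circ> c\<close>.
\<close>

locale skew_brace = add: group A + mult: group M
  for A :: "('a, 'm) monoid_scheme" and M :: "('a, 'n) monoid_scheme" +
  assumes carrier_eq: "carrier M = carrier A"
    and brace_distrib:
      "\<lbrakk>a \<in> carrier A; b \<in> carrier A; c \<in> carrier A\<rbrakk> \<Longrightarrow>
        a \<otimes>\<^bsub>M\<^esub> (b \<otimes>\<^bsub>A\<^esub> c) = (a \<otimes>\<^bsub>M\<^esub> b) \<otimes>\<^bsub>A\<^esub> inv\<^bsub>A\<^esub> a \<otimes>\<^bsub>A\<^esub> (a \<otimes>\<^bsub>M\<^esub> c)"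

definition brace_isos ::
  "'a monoid \<times> 'a monoid \<Rightarrow> 'b monoid \<times> 'b monoid \<Rightarrow> ('a \<Rightarrow> 'b) set" where
  "brace_isos B C = iso (fst B) (fst C) \<inter> iso (snd B) (snd C)"

text \<open>
  Isomorphism classes of skew braces with prescribed additive and multiplicative group are taken
  inside the type \<^typ>\<open>nat\<close> of possible elements. By \<open>skew_brace_nat_copy\<close> below every
  finite skew brace, over any type, has an isomorphic copy there. The records may differ outside
  their carriers, but the isomorphism relation does not see this.
\<close>

definition skew_braces ::
  "('a, 'm) monoid_scheme \<Rightarrow> ('b, 'n) monoid_scheme \<Rightarrow> (nat monoid \<times> nat monoid) set" where
  "skew_braces G H = {(A, M). skew_brace A M \<and> A \<cong> G \<and> M \<cong> H}"

definition brace_iso_rel ::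
  "('a, 'm) monoid_scheme \<Rightarrow> ('b, 'n) monoid_scheme \<Rightarrow>
    ((nat monoid \<times> nat monoid) \<times> (nat monoid \<times> nat monoid)) set" where
  "brace_iso_rel G H =
    {(B, C). B \<in> skew_braces G H \<and> C \<in> skew_braces G H \<and> brace_isos B C \<noteq> {}}"

definition num_skew_braces ::
  "('a, 'm) monoid_scheme \<Rightarrow> ('b, 'n) monoid_scheme \<Rightarrow> nat" where
  "num_skew_braces G H = card (skew_braces G H // brace_iso_rel G H)"

definition semidirect_product ::
  "('a, 'm) monoid_scheme \<Rightarrow> ('b, 'n) monoid_scheme \<Rightarrow> ('b \<Rightarrow> 'a \<Rightarrow> 'a) \<Rightarrow> ('a \<times> 'b) monoid" where
  "semidirect_product N H \<phi> =
    \<lparr>carrier = carrier N \<times> carrier H,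
     monoid.mult = (\<lambda>(a, s) (b, t). (a \<otimes>\<^bsub>N\<^esub> \<phi> s b, s \<otimes>\<^bsub>H\<^esub> t)),
     one = (\<one>\<^bsub>N\<^esub>, \<one>\<^bsub>H\<^esub>)\<rparr>"

text \<open>
  \<open>cyclic_semidirect q u m\<close> is $\mathbb{Z}_q \rtimes_u \mathbb{Z}_m$, where the generator of
  $\mathbb{Z}_m$ acts on $\mathbb{Z}_q$ as multiplication by \<open>u\<close>. It is only meaningful when
  \<open>u ^ m\<close> is 1 modulo \<open>q\<close>. The exponent \<open>nat s\<close> is the representative of \<open>s\<close> in \<open>{0..<m}\<close>.
\<close>

definition cyclic_semidirect :: "nat \<Rightarrow> nat \<Rightarrow> nat \<Rightarrow> (int \<times> int) monoid" where
  "cyclic_semidirect q u m =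
    semidirect_product (integer_mod_group q) (integer_mod_group m)
      (\<lambda>s a. (int u ^ nat s * a) mod int q)"

lemma cyclic_semidirect_group:
  assumes "q > 0" "m > 0" "[u ^ m = 1] (mod q)"
  shows "group (cyclic_semidirect q u m)"
proof -
  have um: "[int u ^ m = 1] (mod int q)"
    using assms(3) by (metis cong_int_iff of_nat_1 of_nat_power)
  have pw: "[int u ^ nat ((s + t) mod int m) = int u ^ nat s * int u ^ nat t] (mod int q)"
    if "0 \<le> s" "0 \<le> t" for s t
  proof -
    define k where "k = nat s + nat t"
    have k: "nat ((s + t) mod int m) = k mod m"
      using that by (simp add: k_def nat_mod_distrib nat_add_distrib)
    have "int u ^ k = int u ^ (k mod m) * (int u ^ m) ^ (k div m)"
      by (metis mod_mult_div_eq power_add power_mult)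
    moreover have "[\<dots> = int u ^ (k mod m) * 1 ^ (k div m)] (mod int q)"
      by (intro cong_mult cong_pow um cong_refl)
    ultimately show ?thesis by (simp add: k k_def power_add cong_sym)
  qed
  show ?thesis
  proof (rule groupI)
    fix x y assume "x \<in> carrier (cyclic_semidirect q u m)" "y \<in> carrier (cyclic_semidirect q u m)"
    then show "x \<otimes>\<^bsub>cyclic_semidirect q u m\<^esub> y \<in> carrier (cyclic_semidirect q u m)"
      using assms by (auto simp: cyclic_semidirect_def semidirect_product_def
          carrier_integer_mod_group split: prod.splits)
  next
    show "\<one>\<^bsub>cyclic_semidirect q u m\<^esub> \<in> carrier (cyclic_semidirect q u m)"
      by (auto simp: cyclic_semidirect_def semidirect_product_def)
  next
    fix x y z assume *: "x \<in> carrier (cyclic_semidirect q u m)"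
      "y \<in> carrier (cyclic_semidirect q u m)" "z \<in> carrier (cyclic_semidirect q u m)"
    obtain a s b t c r where xyz: "x = (a, s)" "y = (b, t)" "z = (c, r)"
      by (metis surj_pair)
    have st: "0 \<le> s" "0 \<le> t"
      using * assms by (auto simp: xyz cyclic_semidirect_def semidirect_product_def
          carrier_integer_mod_group)
    have "[int u ^ nat ((s + t) mod int m) * c = (int u ^ nat s * int u ^ nat t) * c] (mod int q)"
      by (intro cong_mult pw st cong_refl)
    then have "[(a + int u ^ nat s * b) + int u ^ nat ((s + t) mod int m) * c
        = (a + int u ^ nat s * b) + (int u ^ nat s * int u ^ nat t) * c] (mod int q)"
      by (intro cong_add cong_refl)
    then have e: "((a + int u ^ nat s * b) + int u ^ nat ((s + t) mod int m) * c) mod int q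
       = (a + int u ^ nat s * (b + int u ^ nat t * c)) mod int q"
      by (simp add: cong_def algebra_simps)
    have e2: "(a + int u ^ nat s * ((b + int u ^ nat t * c) mod int q)) mod int q
       = (a + int u ^ nat s * (b + int u ^ nat t * c)) mod int q"
      by (metis mod_add_right_eq mod_mult_right_eq)
    show "x \<otimes>\<^bsub>cyclic_semidirect q u m\<^esub> y \<otimes>\<^bsub>cyclic_semidirect q u m\<^esub> z =
        x \<otimes>\<^bsub>cyclic_semidirect q u m\<^esub> (y \<otimes>\<^bsub>cyclic_semidirect q u m\<^esub> z)"
      unfolding xyz cyclic_semidirect_def semidirect_product_def
      by (simp only: monoid.simps mult_integer_mod_group prod.case mod_add_left_eq mod_add_right_eq
          e e2 add.assoc[of s t r])
  next
    fix x assume "x \<in> carrier (cyclic_semidirect q u m)"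
    then show "\<one>\<^bsub>cyclic_semidirect q u m\<^esub> \<otimes>\<^bsub>cyclic_semidirect q u m\<^esub> x = x"
      using assms by (auto simp: cyclic_semidirect_def semidirect_product_def
          carrier_integer_mod_group)
  next
    fix x assume x: "x \<in> carrier (cyclic_semidirect q u m)"
    obtain a s where as: "x = (a, s)" by (cases x)
    define t where "t = (- s) mod int m"
    define y where "y = ((- (int u ^ nat t * a)) mod int q, t)"
    have "y \<in> carrier (cyclic_semidirect q u m)"
      using assms by (auto simp: y_def t_def cyclic_semidirect_def semidirect_product_def
          carrier_integer_mod_group)
    moreover have "y \<otimes>\<^bsub>cyclic_semidirect q u m\<^esub> x = \<one>\<^bsub>cyclic_semidirect q u m\<^esub>"
      by (simp add: y_def t_def as cyclic_semidirect_def semidirect_product_def mod_simps)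
    ultimately show "\<exists>y\<in>carrier (cyclic_semidirect q u m).
        y \<otimes>\<^bsub>cyclic_semidirect q u m\<^esub> x = \<one>\<^bsub>cyclic_semidirect q u m\<^esub>" by blast
  qed
qed

lemma cyclic_semidirect_conj:
  assumes "q > 1" "m > 1" "[u ^ m = 1] (mod q)"
  defines "G \<equiv> cyclic_semidirect q u m"
  defines "\<sigma> \<equiv> (0, 1)" and "\<tau> \<equiv> (1, 0)"
  shows "\<sigma> \<otimes>\<^bsub>G\<^esub> \<tau> \<otimes>\<^bsub>G\<^esub> inv\<^bsub>G\<^esub> \<sigma> = \<tau> [^]\<^bsub>G\<^esub> u"
proof -
  interpret group G unfolding G_def using assms by (intro cyclic_semidirect_group) auto
  have c: "\<sigma> \<in> carrier G" "\<tau> \<in> carrier G"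
    using assms by (auto simp: cyclic_semidirect_def semidirect_product_def
        carrier_integer_mod_group)
  have "\<tau> [^]\<^bsub>G\<^esub> k = (int k mod int q, 0)" for k :: nat
    by (induction k) (simp_all add: G_def \<tau>_def cyclic_semidirect_def semidirect_product_def
        mod_simps add.commute)
  then have "\<sigma> \<otimes>\<^bsub>G\<^esub> \<tau> = \<tau> [^]\<^bsub>G\<^esub> u \<otimes>\<^bsub>G\<^esub> \<sigma>"
    using assms(1,2) by (simp add: G_def \<sigma>_def \<tau>_def cyclic_semidirect_def semidirect_product_def)
  then show ?thesis using c by (simp add: m_assoc)
qed

text \<open>The isomorphism relation is an equivalence, and it has finitely many classes when the
  prescribed additive group is finite, so that the cardinality above is the true one.\<close>

lemma brace_isos_id: "id \<in> brace_isos B B"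
  by (auto simp: brace_isos_def iso_def hom_def)

lemma brace_isos_trans:
  "f \<in> brace_isos B C \<Longrightarrow> g \<in> brace_isos C D \<Longrightarrow>
    g \<circ> f \<in> brace_isos B D"
  by (auto simp: brace_isos_def intro: iso_set_trans)

lemma brace_isos_sym:
  assumes "skew_brace A M" "skew_brace A' M'" "f \<in> brace_isos (A, M) (A', M')"
  shows "inv_into (carrier A) f \<in> brace_isos (A', M') (A, M)"
proof -
  interpret skew_brace A M by fact
  show ?thesis
    using assms(3) add.iso_set_sym[of f A'] mult.iso_set_sym[of f M']
    by (auto simp: brace_isos_def carrier_eq)
qed

lemma equiv_brace_iso_rel: "equiv (skew_braces G H) (brace_iso_rel G H)"
proof (rule equivI)
  show "brace_iso_rel G H \<subseteq> skew_braces G H \<times> skew_braces G H"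
    by (auto simp: brace_iso_rel_def)
  show "refl_on (skew_braces G H) (brace_iso_rel G H)"
    using brace_isos_id by (fastforce simp: refl_on_def brace_iso_rel_def)
  show "sym (brace_iso_rel G H)"
    by (rule symI) (auto simp: brace_iso_rel_def skew_braces_def dest: brace_isos_sym)
  show "trans (brace_iso_rel G H)"
    by (rule transI) (auto simp: brace_iso_rel_def dest: brace_isos_trans)
qed

lemma finite_brace_classes:
  assumes "finite (carrier G)"
  shows "finite (skew_braces G H // brace_iso_rel G H)"
proof -
  define S where "S = skew_braces G H"
  define R where "R = brace_iso_rel G H"
  define n where "n = card (carrier G)"
  define g where "g B = (SOME g. bij_betw g (carrier (fst B)) {..<n})"
    for B :: "nat monoid \<times> nat monoid"
  have g: "bij_betw (g B) (carrier (fst B)) {..<n}" if "B \<in> S" for B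
  proof -
    have "fst B \<cong> G" using that by (auto simp: S_def skew_braces_def)
    then obtain f where f: "bij_betw f (carrier (fst B)) (carrier G)"
      by (auto simp: is_iso_def Group.iso_def)
    obtain k where k: "bij_betw k (carrier G) {..<n}"
      using ex_bij_betw_finite_nat[OF assms] by (auto simp: n_def atLeast0LessThan)
    show ?thesis unfolding g_def using someI[of "\<lambda>g. bij_betw g (carrier (fst B)) {..<n}", OF bij_betw_trans[OF f k]] .
  qed
  define tab where "tab h T = {(h a, h b, h (a \<otimes>\<^bsub>T\<^esub> b)) | a b. a \<in> carrier T \<and> b \<in> carrier T}"
    for h :: "nat \<Rightarrow> nat" and T :: "nat monoid"
  define c where "c B = (tab (g B) (fst B), tab (g B) (snd B))" for B
  define D where "D = {..<n} \<times> {..<n} \<times> {..<n}"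
  have cl: "skew_brace (fst B) (snd B)" "carrier (snd B) = carrier (fst B)" if "B \<in> S" for B
    using that by (auto simp: S_def skew_braces_def skew_brace.carrier_eq)
  have tab_sub: "tab (g B) T \<subseteq> D" if "B \<in> S" "T = fst B \<or> T = snd B" for B T
  proof -
    have gr: "group T" and cG: "carrier T = carrier (fst B)"
      using that cl[of B] by (auto simp: skew_brace_def)
    show ?thesis
      using bij_betwE[OF g[OF that(1)]] gr
      by (auto simp: tab_def D_def cG[symmetric] group.is_monoid monoid.m_closed)
  qed
  have fin: "finite (c ` S)"
  proof (rule finite_subset)
    show "c ` S \<subseteq> Pow D \<times> Pow D" using tab_sub by (auto simp: c_def)
    show "finite (Pow D \<times> Pow D)" by (simp add: D_def)
  qed
  have iso: "inv_into (carrier T') h' \<circ> h \<in> iso T T'"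
    if "group T" "group T'" "bij_betw h (carrier T) {..<n}" "bij_betw h' (carrier T') {..<n}"
      "tab h T = tab h' T'" for h h' T T'
  proof -
    interpret T: group T by fact
    interpret T': group T' by fact
    let ?f = "inv_into (carrier T') h' \<circ> h"
    have bij: "bij_betw ?f (carrier T) (carrier T')"
      using bij_betw_trans[OF that(3) bij_betw_inv_into[OF that(4)]] .
    have "?f (a \<otimes>\<^bsub>T\<^esub> b) = ?f a \<otimes>\<^bsub>T'\<^esub> ?f b" if ab: "a \<in> carrier T" "b \<in> carrier T" for a b
    proof -
      have "(h a, h b, h (a \<otimes>\<^bsub>T\<^esub> b)) \<in> tab h' T'"
        unfolding \<open>tab h T = tab h' T'\<close>[symmetric] using ab by (auto simp: tab_def)
      then obtain a' b' where *: "a' \<in> carrier T'" "b' \<in> carrier T'" "h a = h' a'" "h b = h' b'"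
        "h (a \<otimes>\<^bsub>T\<^esub> b) = h' (a' \<otimes>\<^bsub>T'\<^esub> b')"
        by (auto simp: tab_def)
      have "inj_on h' (carrier T')" using \<open>bij_betw h' _ _\<close> by (simp add: bij_betw_def)
      then show ?thesis using * by simp
    qed
    then show ?thesis using bij bij_betwE[OF bij] by (auto simp: Group.iso_def hom_def)
  qed
  have R: "(B, C) \<in> R" if BC: "B \<in> S" "C \<in> S" "c B = c C" for B C
  proof -
    have "inv_into (carrier (fst C)) (g C) \<circ> g B \<in> brace_isos B C"
      using iso[of "fst B" "fst C" "g B" "g C"] iso[of "snd B" "snd C" "g B" "g C"]
        BC cl[of B] cl[of C] g[of B] g[of C]
      by (auto simp: brace_isos_def c_def skew_brace_def)
    then show ?thesis using BC by (auto simp: R_def brace_iso_rel_def S_def)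
  qed
  have "S // R \<subseteq> (\<lambda>v. R `` {SOME B. B \<in> S \<and> c B = v}) ` (c ` S)"
  proof
    fix Q assume "Q \<in> S // R"
    then obtain B where B: "B \<in> S" "Q = R `` {B}" by (auto elim: quotientE)
    define C where "C = (SOME C. C \<in> S \<and> c C = c B)"
    have "C \<in> S \<and> c C = c B" unfolding C_def by (rule someI[of _ B]) (use B in auto)
    then have "(B, C) \<in> R" using R B by auto
    then have "Q = R `` {C}"
      using B equiv_class_eq[OF equiv_brace_iso_rel] unfolding R_def by metis
    then show "Q \<in> (\<lambda>v. R `` {SOME B. B \<in> S \<and> c B = v}) ` (c ` S)"
      using B(1) unfolding C_def by blast
  qed
  then show ?thesis using fin finite_surj unfolding S_def R_def by blast
qed

lemma skew_brace_nat_copy: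
  fixes A M :: "'a monoid"
  assumes "skew_brace A M" "finite (carrier A)"
  shows "\<exists>A' M' :: nat monoid. skew_brace A' M' \<and> brace_isos (A, M) (A', M') \<noteq> {}"
proof -
  interpret skew_brace A M by fact
  obtain f :: "'a \<Rightarrow> nat" where f: "inj_on f (carrier A)"
    using assms(2) finite_imp_inj_to_nat_seg by blast
  let ?A = "image_group f A" and ?M = "image_group f M"
  have fi: "f \<in> iso A ?A" "f \<in> iso M ?M"
    using inj_imp_image_group_iso[of f A] inj_imp_image_group_iso[of f M] f carrier_eq by auto
  have gr: "group ?A" "group ?M"
    using add.inj_imp_image_group_is_group f mult.inj_imp_image_group_is_group carrier_eq by auto
  have hom: "f \<in> hom A ?A" "f \<in> hom M ?M"
    using fi by (simp_all add: Group.iso_def)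
  have c: "carrier ?A = f ` carrier A" "carrier ?M = f ` carrier A"
    by (simp_all add: image_group_def carrier_eq)
  have M: "f a \<otimes>\<^bsub>?M\<^esub> f b = f (a \<otimes>\<^bsub>M\<^esub> b)" "a \<otimes>\<^bsub>M\<^esub> b \<in> carrier A"
    if "a \<in> carrier A" "b \<in> carrier A" for a b
    using that hom_mult[OF hom(2)] mult.m_closed by (simp_all add: carrier_eq)
  have A: "f a \<otimes>\<^bsub>?A\<^esub> f b = f (a \<otimes>\<^bsub>A\<^esub> b)" if "a \<in> carrier A" "b \<in> carrier A" for a b
    using that hom_mult[OF hom(1)] by simp
  have I: "inv\<^bsub>?A\<^esub> f a = f (inv\<^bsub>A\<^esub> a)" if "a \<in> carrier A" for a
  proof -
    have "group_hom A ?A f"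
      using gr(1) hom(1) add.is_group by (simp add: group_hom_def group_hom_axioms_def)
    then show ?thesis using group_hom.hom_inv that by metis
  qed
  have "skew_brace ?A ?M"
  proof (intro skew_brace.intro gr skew_brace_axioms.intro)
    show "carrier ?M = carrier ?A" using c by simp
    fix a b d assume "a \<in> carrier ?A" "b \<in> carrier ?A" "d \<in> carrier ?A"
    then obtain x y z where *: "x \<in> carrier A" "y \<in> carrier A" "z \<in> carrier A"
      "a = f x" "b = f y" "d = f z" by (auto simp: c)
    have "a \<otimes>\<^bsub>?M\<^esub> (b \<otimes>\<^bsub>?A\<^esub> d) = f (x \<otimes>\<^bsub>M\<^esub> (y \<otimes>\<^bsub>A\<^esub> z))"
      using * by (simp add: A M)
    also have "\<dots> = f ((x \<otimes>\<^bsub>M\<^esub> y) \<otimes>\<^bsub>A\<^esub> inv\<^bsub>A\<^esub> x \<otimes>\<^bsub>A\<^esub> (x \<otimes>\<^bsub>M\<^esub> z))"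
      using * by (simp add: brace_distrib)
    also have "\<dots> = (a \<otimes>\<^bsub>?M\<^esub> b) \<otimes>\<^bsub>?A\<^esub> inv\<^bsub>?A\<^esub> a \<otimes>\<^bsub>?A\<^esub> (a \<otimes>\<^bsub>?M\<^esub> d)"
      using * by (simp add: A M I)
    finally show "a \<otimes>\<^bsub>?M\<^esub> (b \<otimes>\<^bsub>?A\<^esub> d) = (a \<otimes>\<^bsub>?M\<^esub> b) \<otimes>\<^bsub>?A\<^esub> inv\<^bsub>?A\<^esub> a \<otimes>\<^bsub>?A\<^esub> (a \<otimes>\<^bsub>?M\<^esub> d)" .
  qed
  then show ?thesis using fi by (auto simp: brace_isos_def)
qed

end

theory Submission
  imports Defs
begin

text \<open>
  All three additive groups have the form \<open>\<int>\<^sub>q \<rtimes>\<^sub>\<chi> P\<close> with \<open>P\<close> abelian of order \<open>p\<^sup>2\<close> and a nontrivial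
  character \<open>\<chi>\<close>. Let \<open>\<lambda>\<close> be the action of the multiplicative on the additive group. An automorphism of
  \<open>\<int>\<^sub>q \<rtimes>\<^sub>\<chi> P\<close> is \<open>(b, t) \<mapsto> (ib + j(1 - \<chi> t), g t)\<close> with \<open>\<chi> \<circ> g = \<chi>\<close>. Since \<open>q > p\<^sup>2\<close>, the elements of \<open>\<int>\<^sub>q\<close>
  act as inner automorphisms, and comparing conjugations shows that \<open>\<int>\<^sub>q\<close> acts trivially either for
  the brace or for its opposite. If it acts trivially, then averaging \<open>j\<close> over \<open>P\<close> yields an invariant
  complement of \<open>\<int>\<^sub>q\<close>, so that the multiplicative group is \<open>\<int>\<^sub>q \<rtimes>\<^sub>\<psi> Q\<close> for a brace \<open>(P, Q)\<close> for which \<open>\<chi>\<close> is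
  a character of \<open>Q\<close> as well. Hence the number of braces is twice the number of pairs \<open>(Q, \<psi>)\<close> modulo the
  automorphisms of \<open>P\<close> that preserve \<open>\<chi>\<close>.

  For \<open>P\<close> cyclic, \<open>Q\<close> is \<open>s \<circ> t = s + t + pmst\<close>; for \<open>P\<close> elementary abelian it is
  \<open>(x, y) \<circ> (x', y') = (x + x', y + y' + mxx')\<close>. In both cases \<open>Q \<cong> P\<close>, since \<open>p\<close> is odd, so that the
  characters \<open>\<psi>\<close> are explicit and the orbits can be listed.
\<close>

text \<open>The bound p^2 < q makes Z_q the q-torsion of the additive group. It also leaves an
  element of order q no room to permute P or to scale Z_q nontrivially, so that its action is
  reduced to one scalar. The nontriviality of \<chi> enters twice. It rigidifies the automorphisms:
  a cocycle on the abelian group P is a coboundary as soon as one value 1 - \<chi> s is invertible.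
  And it makes Z_q noncentral, so that a brace of the normal form is never isomorphic to the
  opposite of one; hence the factor 2. The multiplicative group that is asked for plays no part in
  the reduction: the braces on a given additive group are listed once, and commutativity, exponent
  and centre sort the list afterwards. Both shapes of Q come from one argument. An action compatible
  with \<chi> is governed by a function g that is additive up to a twist, and the twist dies because
  its coefficient squares to zero modulo p. The binomial coefficient s(s - 1)/2 then linearizes Q,
  and its periodicity modulo p is what requires p to be odd.\<close>

subsection \<open>Skew braces\<close>

text \<open>The lambda map -x + x \<circ> y of the brace.\<close>

definition brace_act :: "('a, 'm) monoid_scheme \<Rightarrow> ('a, 'n) monoid_scheme \<Rightarrow> 'a \<Rightarrow> 'a \<Rightarrow> 'a" where
  "brace_act A M x y = inv\<^bsub>A\<^esub> x \<otimes>\<^bsub>A\<^esub> (x \<otimes>\<^bsub>M\<^esub> y)"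

context skew_brace
begin

lemma mult_closed: "x \<in> carrier A \<Longrightarrow> y \<in> carrier A \<Longrightarrow> x \<otimes>\<^bsub>M\<^esub> y \<in> carrier A"
  using mult.m_closed carrier_eq by simp

lemma one_eq: "\<one>\<^bsub>M\<^esub> = \<one>\<^bsub>A\<^esub>"
proof -
  have c: "\<one>\<^bsub>M\<^esub> \<in> carrier A" using mult.one_closed carrier_eq by simp
  have "\<one>\<^bsub>M\<^esub> \<otimes>\<^bsub>M\<^esub> (\<one>\<^bsub>A\<^esub> \<otimes>\<^bsub>A\<^esub> \<one>\<^bsub>A\<^esub>)
      = (\<one>\<^bsub>M\<^esub> \<otimes>\<^bsub>M\<^esub> \<one>\<^bsub>A\<^esub>) \<otimes>\<^bsub>A\<^esub> inv\<^bsub>A\<^esub> \<one>\<^bsub>M\<^esub> \<otimes>\<^bsub>A\<^esub> (\<one>\<^bsub>M\<^esub> \<otimes>\<^bsub>M\<^esub> \<one>\<^bsub>A\<^esub>)"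
    using c by (intro brace_distrib) auto
  then have "inv\<^bsub>A\<^esub> \<one>\<^bsub>M\<^esub> = \<one>\<^bsub>A\<^esub>" using c carrier_eq by simp
  then show ?thesis using c by (metis add.inv_inv add.inv_one)
qed

lemma brace_act_closed: "x \<in> carrier A \<Longrightarrow> y \<in> carrier A \<Longrightarrow> brace_act A M x y \<in> carrier A"
  by (simp add: brace_act_def mult_closed)

lemma mult_eq_act:
  "x \<in> carrier A \<Longrightarrow> y \<in> carrier A \<Longrightarrow> x \<otimes>\<^bsub>M\<^esub> y = x \<otimes>\<^bsub>A\<^esub> brace_act A M x y"
  by (simp add: brace_act_def mult_closed add.inv_solve_left' flip: add.m_assoc)

lemma brace_act_add:
  "x \<in> carrier A \<Longrightarrow> y \<in> carrier A \<Longrightarrow> z \<in> carrier A \<Longrightarrow>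
    brace_act A M x (y \<otimes>\<^bsub>A\<^esub> z) = brace_act A M x y \<otimes>\<^bsub>A\<^esub> brace_act A M x z"
  by (simp add: brace_act_def mult_closed brace_distrib add.m_assoc)

text \<open>Expand x \<circ> (y \<circ> z) in two ways and cancel x \<circ> y. Together with
  \<open>brace_act_iso\<close>: the multiplicative group acts on the additive one by
  automorphisms.\<close>

lemma brace_act_mult:
  assumes "x \<in> carrier A" "y \<in> carrier A" "z \<in> carrier A"
  shows "brace_act A M (x \<otimes>\<^bsub>M\<^esub> y) z = brace_act A M x (brace_act A M y z)"
proof -
  note c = assms mult_closed brace_act_closed
  have "(x \<otimes>\<^bsub>M\<^esub> y) \<otimes>\<^bsub>A\<^esub> brace_act A M (x \<otimes>\<^bsub>M\<^esub> y) z = x \<otimes>\<^bsub>M\<^esub> (y \<otimes>\<^bsub>M\<^esub> z)"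
    using c mult.m_assoc carrier_eq by (simp add: mult_eq_act[symmetric])
  also have "\<dots> = x \<otimes>\<^bsub>A\<^esub> brace_act A M x (y \<otimes>\<^bsub>A\<^esub> brace_act A M y z)"
    using c by (simp add: mult_eq_act[symmetric])
  also have "\<dots> = (x \<otimes>\<^bsub>M\<^esub> y) \<otimes>\<^bsub>A\<^esub> brace_act A M x (brace_act A M y z)"
    using c by (simp add: brace_act_add add.m_assoc mult_eq_act[of x y])
  finally show ?thesis using c by simp
qed

lemma brace_act_iso:
  assumes x: "x \<in> carrier A" shows "brace_act A M x \<in> iso A A"
proof (rule isoI)
  show "brace_act A M x \<in> hom A A"
    using x by (auto simp: hom_def brace_act_closed brace_act_add)
  have "inj_on (brace_act A M x) (carrier A)"
  proof (rule inj_onI)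
    fix y z assume yz: "y \<in> carrier A" "z \<in> carrier A" "brace_act A M x y = brace_act A M x z"
    then have "x \<otimes>\<^bsub>M\<^esub> y = x \<otimes>\<^bsub>M\<^esub> z" using x by (simp add: mult_eq_act)
    then show "y = z" using x yz carrier_eq by simp
  qed
  moreover have "y \<in> brace_act A M x ` carrier A" if y: "y \<in> carrier A" for y
  proof -
    define z where "z = inv\<^bsub>M\<^esub> x \<otimes>\<^bsub>M\<^esub> (x \<otimes>\<^bsub>A\<^esub> y)"
    have i: "inv\<^bsub>M\<^esub> x \<in> carrier A" using x mult.inv_closed carrier_eq by simp
    have z: "z \<in> carrier A" using x y i by (simp add: z_def mult_closed)
    have "x \<otimes>\<^bsub>M\<^esub> z = x \<otimes>\<^bsub>A\<^esub> y"
      using x y i carrier_eq by (simp add: z_def mult.m_assoc[symmetric])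
    then have "brace_act A M x z = y"
      using x y by (simp add: brace_act_def add.m_assoc[symmetric])
    then show ?thesis using z by blast
  qed
  ultimately show "bij_betw (brace_act A M x) (carrier A) (carrier A)"
    using x brace_act_closed by (auto simp: bij_betw_def)
qed

end

text \<open>Converse of \<open>mult_eq_act\<close> and \<open>brace_act_add\<close>. That f is an
  action is contained in the associativity of \<open>M\<close>.\<close>

lemma skew_brace_of_act:
  assumes "group A" "group M" "carrier M = carrier A"
    and "\<And>x. x \<in> carrier A \<Longrightarrow> f x \<in> hom A A"
    and "\<And>x y. x \<in> carrier A \<Longrightarrow> y \<in> carrier A \<Longrightarrow> x \<otimes>\<^bsub>M\<^esub> y = x \<otimes>\<^bsub>A\<^esub> f x y"
  shows "skew_brace A M"
proof -
  interpret A: group A by fact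
  have f: "f x y \<in> carrier A" "f x (y \<otimes>\<^bsub>A\<^esub> z) = f x y \<otimes>\<^bsub>A\<^esub> f x z"
    if "x \<in> carrier A" "y \<in> carrier A" "z \<in> carrier A" for x y z
    using assms(4) that by (auto simp: hom_def)
  have "inv\<^bsub>A\<^esub> x \<otimes>\<^bsub>A\<^esub> (x \<otimes>\<^bsub>A\<^esub> f x z) = f x z" if "x \<in> carrier A" "z \<in> carrier A" for x z
    using that by (simp add: f A.m_assoc[symmetric])
  then show ?thesis
    using assms by (auto intro!: skew_brace.intro skew_brace_axioms.intro simp: f A.m_assoc)
qed

text \<open>Transport of structure: associativity in \<open>circle\<close>, in
  \<open>twisted\<close> and in pulled back braces comes from an explicit bijection instead of a
  computation.\<close>

lemma group_of_bij_hom: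
  assumes "group M" "bij_betw f (carrier G) (carrier M)"
    and hom: "\<And>x y. x \<in> carrier G \<Longrightarrow> y \<in> carrier G \<Longrightarrow>
      x \<otimes>\<^bsub>G\<^esub> y \<in> carrier G \<and> f (x \<otimes>\<^bsub>G\<^esub> y) = f x \<otimes>\<^bsub>M\<^esub> f y"
    and one: "\<one>\<^bsub>G\<^esub> \<in> carrier G" "f \<one>\<^bsub>G\<^esub> = \<one>\<^bsub>M\<^esub>"
  shows "group G"
proof -
  interpret M: group M by fact
  have inj: "inj_on f (carrier G)" and cl: "\<And>x. x \<in> carrier G \<Longrightarrow> f x \<in> carrier M"
    using assms(2) by (auto simp: bij_betw_def)
  show ?thesis
  proof (rule groupI)
    fix x y z assume "x \<in> carrier G" "y \<in> carrier G" "z \<in> carrier G"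
    then show "x \<otimes>\<^bsub>G\<^esub> y \<otimes>\<^bsub>G\<^esub> z = x \<otimes>\<^bsub>G\<^esub> (y \<otimes>\<^bsub>G\<^esub> z)"
      by (intro inj_onD[OF inj]) (auto simp: hom cl M.m_assoc)
  next
    fix x assume x: "x \<in> carrier G"
    then show "\<one>\<^bsub>G\<^esub> \<otimes>\<^bsub>G\<^esub> x = x"
      by (intro inj_onD[OF inj]) (auto simp: hom cl one)
    obtain y where y: "y \<in> carrier G" "f y = inv\<^bsub>M\<^esub> f x"
      using assms(2) M.inv_closed[OF cl[OF x]] by (metis bij_betw_imp_surj_on imageE)
    then have "y \<otimes>\<^bsub>G\<^esub> x = \<one>\<^bsub>G\<^esub>"
      using x by (intro inj_onD[OF inj]) (auto simp: hom cl one)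
    then show "\<exists>y\<in>carrier G. y \<otimes>\<^bsub>G\<^esub> x = \<one>\<^bsub>G\<^esub>" using y by blast
  qed (auto simp: hom one)
qed

text \<open>Allows a brace whose additive group is merely isomorphic to \<open>E\<close> to be
  studied on \<open>E\<close> itself.\<close>

lemma skew_brace_pullback:
  fixes E :: "'a monoid" and A M :: "'b monoid"
  assumes "skew_brace A M" "f \<in> iso E A" "group E"
  obtains M' :: "'a monoid" where "skew_brace E M'" "f \<in> brace_isos (E, M') (A, M)"
proof -
  interpret skew_brace A M by fact
  interpret E: group E by fact
  have bij: "bij_betw f (carrier E) (carrier A)" and
    cl: "\<And>x. x \<in> carrier E \<Longrightarrow> f x \<in> carrier A" and
    hom: "\<And>x y. x \<in> carrier E \<Longrightarrow> y \<in> carrier E \<Longrightarrow> f (x \<otimes>\<^bsub>E\<^esub> y) = f x \<otimes>\<^bsub>A\<^esub> f y"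
    using assms(2) by (auto simp: Group.iso_def hom_def bij_betw_def)
  interpret f: group_hom E A f
    using assms by (simp add: group_hom_def group_hom_axioms_def iso_imp_homomorphism add.is_group)
  define M' where "M' = \<lparr>carrier = carrier E,
    monoid.mult = (\<lambda>x y. inv_into (carrier E) f (f x \<otimes>\<^bsub>M\<^esub> f y)), one = \<one>\<^bsub>E\<^esub>\<rparr>"
  have inj: "inj_on f (carrier E)" using bij by (simp add: bij_betw_def)
  have M': "x \<otimes>\<^bsub>M'\<^esub> y \<in> carrier E" "f (x \<otimes>\<^bsub>M'\<^esub> y) = f x \<otimes>\<^bsub>M\<^esub> f y"
    if "x \<in> carrier E" "y \<in> carrier E" for x y
    using bij mult_closed[OF cl cl, OF that]
    by (auto simp: M'_def bij_betw_def inv_into_into f_inv_into_f)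
  have gr: "group M'"
  proof (rule group_of_bij_hom[OF mult.is_group, of f])
    show "bij_betw f (carrier M') (carrier M)" using bij carrier_eq by (simp add: M'_def)
  next
    show "\<one>\<^bsub>M'\<^esub> \<in> carrier M'" "f \<one>\<^bsub>M'\<^esub> = \<one>\<^bsub>M\<^esub>"
      using one_eq by (auto simp: M'_def)
  next
    fix x y assume "x \<in> carrier M'" "y \<in> carrier M'"
    then show "x \<otimes>\<^bsub>M'\<^esub> y \<in> carrier M' \<and> f (x \<otimes>\<^bsub>M'\<^esub> y) = f x \<otimes>\<^bsub>M\<^esub> f y"
      using M'[of x y] by (simp add: M'_def)
  qed
  have "skew_brace E M'"
  proof (intro skew_brace.intro skew_brace_axioms.intro gr E.is_group)
    show "carrier M' = carrier E" by (simp add: M'_def)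
    fix a b c assume "a \<in> carrier E" "b \<in> carrier E" "c \<in> carrier E"
    then show "a \<otimes>\<^bsub>M'\<^esub> (b \<otimes>\<^bsub>E\<^esub> c) = (a \<otimes>\<^bsub>M'\<^esub> b) \<otimes>\<^bsub>E\<^esub> inv\<^bsub>E\<^esub> a \<otimes>\<^bsub>E\<^esub> (a \<otimes>\<^bsub>M'\<^esub> c)"
      by (intro inj_onD[OF inj]) (auto simp: M' hom cl brace_distrib)
  qed
  moreover have "f \<in> brace_isos (E, M') (A, M)"
    using assms(2) M' bij cl carrier_eq by (auto simp: brace_isos_def Group.iso_def hom_def M'_def)
  ultimately show ?thesis using that by blast
qed

section \<open>Opposite skew braces\<close>

definition opposite :: "'a monoid \<Rightarrow> 'a monoid" where
  "opposite G = \<lparr>carrier = carrier G, monoid.mult = (\<lambda>x y. y \<otimes>\<^bsub>G\<^esub> x), one = \<one>\<^bsub>G\<^esub>\<rparr>"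

lemma opposite_simps [simp]:
  "carrier (opposite G) = carrier G" "x \<otimes>\<^bsub>opposite G\<^esub> y = y \<otimes>\<^bsub>G\<^esub> x"
  "\<one>\<^bsub>opposite G\<^esub> = \<one>\<^bsub>G\<^esub>" "opposite (opposite G) = G"
  by (auto simp: opposite_def)

lemma group_opposite: "group G \<Longrightarrow> group (opposite G)"
  by (rule groupI) (auto simp: group.is_monoid monoid.m_closed monoid.m_assoc group.r_inv_ex)

lemma inv_opposite: "group G \<Longrightarrow> x \<in> carrier G \<Longrightarrow> inv\<^bsub>opposite G\<^esub> x = inv\<^bsub>G\<^esub> x"
  by (rule group.inv_equality[OF group_opposite]) (auto simp: group.r_inv)

lemma nat_pow_opposite:
  assumes "group G" "x \<in> carrier G"
  shows "x [^]\<^bsub>opposite G\<^esub> (n::nat) = x [^]\<^bsub>G\<^esub> n"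
proof -
  interpret group G by fact
  show ?thesis by (induction n) (use assms in \<open>auto simp: nat_pow_comm[of x 1, simplified]\<close>)
qed

lemma iso_opposite: "f \<in> iso (opposite G) (opposite H) \<longleftrightarrow> f \<in> iso G H"
  by (auto simp: Group.iso_def hom_def)

lemma brace_isos_opposite:
  "f \<in> brace_isos (opposite A, M) (opposite A', M') \<longleftrightarrow> f \<in> brace_isos (A, M) (A', M')"
  by (simp add: brace_isos_def iso_opposite)

lemma opposite_is_iso: "group G \<Longrightarrow> opposite G \<cong> G"
proof -
  assume "group G"
  then interpret group G .
  have "x \<in> m_inv G ` carrier G" if "x \<in> carrier G" for x
    using that by (metis imageI inv_closed inv_inv)
  then have "m_inv G \<in> iso (opposite G) G"
    unfolding Group.iso_def hom_def bij_betw_def by (auto simp: inv_mult_group inj_on_def)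
  then show ?thesis by (rule is_isoI)
qed

text \<open>Only addition is reversed; the axiom for the opposite is the original one with b and c
  exchanged.\<close>

lemma skew_brace_opposite: "skew_brace A M \<Longrightarrow> skew_brace (opposite A) M"
proof -
  assume "skew_brace A M"
  then interpret skew_brace A M .
  show ?thesis
    by (intro skew_brace.intro skew_brace_axioms.intro group_opposite)
      (auto simp: add.is_group mult.is_group carrier_eq inv_opposite brace_distrib mult_closed
        add.m_assoc)
qed

text \<open>The list of models depends only on the additive group and may live over any type;
  \<open>H\<close> is merely a filter on it. The copies \<open>C d\<close> carry the models to the
  natural numbers, where the classes are taken.\<close>

lemma num_skew_braces_eq_card_models:
  fixes model :: "'d \<Rightarrow> 'b monoid \<times> 'b monoid"
  assumes fin: "finite (carrier G)"
    and model: "\<And>d. d \<in> D \<Longrightarrow> skew_brace (fst (model d)) (snd (model d)) \<and> fst (model d) \<cong> G"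
    and complete: "\<And>A M :: nat monoid. skew_brace A M \<Longrightarrow> A \<cong> G \<Longrightarrow>
      \<exists>d\<in>D. brace_isos (model d) (A, M) \<noteq> {}"
    and distinct: "\<And>d d'. d \<in> D \<Longrightarrow> d' \<in> D \<Longrightarrow> brace_isos (model d) (model d') \<noteq> {} \<Longrightarrow> d = d'"
  shows "num_skew_braces G H = card {d \<in> D. snd (model d) \<cong> H}"
proof -
  let ?S = "skew_braces G H" and ?R = "brace_iso_rel G H" and ?D = "{d \<in> D. snd (model d) \<cong> H}"
  have "\<exists>C :: nat monoid \<times> nat monoid. skew_brace (fst C) (snd C) \<and> brace_isos (model d) C \<noteq> {}"
    if d: "d \<in> D" for d
  proof -
    have "finite (carrier (fst (model d)))" using model[OF d] fin iso_finite by blast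
    then show ?thesis
      using skew_brace_nat_copy[of "fst (model d)" "snd (model d)"] model[OF d] by auto
  qed
  then obtain C :: "'d \<Rightarrow> nat monoid \<times> nat monoid"
    where C: "\<And>d. d \<in> D \<Longrightarrow> skew_brace (fst (C d)) (snd (C d)) \<and> brace_isos (model d) (C d) \<noteq> {}"
    by metis
  have sym: "brace_isos C B \<noteq> {}" if "skew_brace (fst B) (snd B)" "skew_brace (fst C) (snd C)"
    "brace_isos B C \<noteq> {}" for B :: "'x monoid \<times> 'x monoid" and C :: "'y monoid \<times> 'y monoid"
    using brace_isos_sym[of "fst B" "snd B" "fst C" "snd C"] that by auto
  have tr: "brace_isos B E \<noteq> {}" if "brace_isos B C \<noteq> {}" "brace_isos C E \<noteq> {}"
    for B :: "'x monoid \<times> 'x monoid" and C :: "'y monoid \<times> 'y monoid" and E :: "'z monoid \<times> 'z monoid"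
    using that brace_isos_trans by (metis ex_in_conv)
  have isoc: "fst B \<cong> fst C" "snd B \<cong> snd C" if "brace_isos B C \<noteq> {}"
    for B :: "'x monoid \<times> 'x monoid" and C :: "'y monoid \<times> 'y monoid"
    using that by (auto simp: brace_isos_def is_iso_def)
  have symG: "snd B \<cong> snd C \<Longrightarrow> snd C \<cong> snd B" "fst B \<cong> fst C \<Longrightarrow> fst C \<cong> fst B"
    if "skew_brace (fst B) (snd B)"
    for B :: "'x monoid \<times> 'x monoid" and C :: "'y monoid \<times> 'y monoid"
    using that by (auto simp: skew_brace_def group.iso_sym)
  have inS: "C d \<in> ?S" if "d \<in> ?D" for d
  proof -
    have d: "d \<in> D" "snd (model d) \<cong> H" using that by auto
    have "brace_isos (C d) (model d) \<noteq> {}" using sym C[OF d(1)] model[OF d(1)] by blast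
    then have "fst (C d) \<cong> fst (model d)" "snd (C d) \<cong> snd (model d)" using isoc by blast+
    then have "fst (C d) \<cong> G" "snd (C d) \<cong> H"
      using model[OF d(1)] d(2) iso_trans by blast+
    then show ?thesis using C[OF d(1)] by (auto simp: skew_braces_def case_prod_beta)
  qed
  have "bij_betw (\<lambda>d. ?R `` {C d}) ?D (?S // ?R)"
    unfolding bij_betw_def
  proof (intro conjI inj_onI equalityI subsetI)
    fix d d' assume d: "d \<in> ?D" "d' \<in> ?D" "?R `` {C d} = ?R `` {C d'}"
    then have "(C d, C d') \<in> ?R"
      using eq_equiv_class_iff[OF equiv_brace_iso_rel inS inS] by blast
    then have "brace_isos (C d) (C d') \<noteq> {}" by (simp add: brace_iso_rel_def)
    moreover have "brace_isos (model d) (C d) \<noteq> {}" "brace_isos (C d') (model d') \<noteq> {}"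
      using d C[of d] C[of d'] model[of d'] sym[of "model d'" "C d'"] by auto
    ultimately have "brace_isos (model d) (model d') \<noteq> {}"
      using tr[of "model d" "C d" "C d'"] tr[of "model d" "C d'" "model d'"] by simp
    then show "d = d'" using distinct d by simp
  next
    fix c assume "c \<in> (\<lambda>d. ?R `` {C d}) ` ?D"
    then show "c \<in> ?S // ?R" using inS by (auto intro: quotientI)
  next
    fix c assume "c \<in> ?S // ?R"
    then obtain B where B: "B \<in> ?S" "c = ?R `` {B}" by (auto elim: quotientE)
    then have sb: "skew_brace (fst B) (snd B)" "fst B \<cong> G" "snd B \<cong> H"
      by (auto simp: skew_braces_def)
    obtain d where d: "d \<in> D" "brace_isos (model d) B \<noteq> {}"
      using complete[OF sb(1,2)] by auto
    have "snd (model d) \<cong> H" using isoc[OF d(2)] sb(3) iso_trans by blast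
    then have dD: "d \<in> ?D" using d by simp
    have "brace_isos (C d) (model d) \<noteq> {}"
      using sym[of "model d" "C d"] C[OF d(1)] model[OF d(1)] by blast
    then have "brace_isos (C d) B \<noteq> {}" using tr d by blast
    then have "(C d, B) \<in> ?R" using inS[OF dD] B by (simp add: brace_iso_rel_def)
    then have "?R `` {C d} = c" using equiv_class_eq[OF equiv_brace_iso_rel] B by metis
    then show "c \<in> (\<lambda>d. ?R `` {C d}) ` ?D" using dD by blast
  qed
  from bij_betw_same_card[OF this] show ?thesis unfolding num_skew_braces_def by simp
qed

section \<open>Auxiliary facts on residues, finite groups and orbits\<close>

lemma mod_add_mult_mod:
  fixes a u b m :: int
  shows "(a + u * (b mod m)) mod m = (a + u * b) mod m"
    "(u * (b mod m) + a) mod m = (u * b + a) mod m"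
    "(a + (b mod m) * u) mod m = (a + b * u) mod m"
    "((b mod m) * u + a) mod m = (b * u + a) mod m"
proof -
  have "[a + u * (b mod m) = a + u * b] (mod m)"
    by (intro cong_add cong_mult cong_refl) (simp add: cong_def)
  then show "(a + u * (b mod m)) mod m = (a + u * b) mod m" by (simp add: cong_def)
  then show "(u * (b mod m) + a) mod m = (u * b + a) mod m"
    "(a + (b mod m) * u) mod m = (a + b * u) mod m"
    "((b mod m) * u + a) mod m = (b * u + a) mod m"
    by (simp_all add: ac_simps)
qed

text \<open>Left multiplication by x is an injective, hence surjective, self-map of the finite set
  H; preimages of x and of \<one> supply the unit and the inverse.\<close>

lemma (in group) subgroup_of_finite_closed:
  assumes "finite H" "H \<subseteq> carrier G" "H \<noteq> {}" "\<And>x y. x \<in> H \<Longrightarrow> y \<in> H \<Longrightarrow> x \<otimes> y \<in> H"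
  shows "subgroup H G"
proof (rule subgroupI)
  fix x assume x: "x \<in> H"
  have "inj_on ((\<otimes>) x) H" using x assms(2) by (intro inj_onI) (metis l_cancel subsetD)
  then have surj: "(\<otimes>) x ` H = H"
    using assms(1,4) x by (intro endo_inj_surj) auto
  obtain y where y: "y \<in> H" "x = x \<otimes> y" using surj x by (metis imageE)
  then have "\<one> \<in> H" using x assms(2) by (metis l_cancel_one' subsetD)
  then obtain z where z: "z \<in> H" "x \<otimes> z = \<one>" using surj by (metis imageE)
  then show "inv x \<in> H" using x assms(2) by (metis inv_equality inv_inv subsetD inv_comm)
qed (use assms in auto)

lemma (in group) pow_card_closed_eq_one:
  assumes "finite H" "H \<subseteq> carrier G" "\<And>x y. x \<in> H \<Longrightarrow> y \<in> H \<Longrightarrow> x \<otimes> y \<in> H" "x \<in> H"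
  shows "x [^] card H = \<one>"
proof -
  have s: "subgroup H G" using assms by (intro subgroup_of_finite_closed) auto
  interpret H: group "G\<lparr>carrier := H\<rparr>" using subgroup.subgroup_is_group[OF s] is_group by blast
  have "x [^]\<^bsub>G\<lparr>carrier := H\<rparr>\<^esub> card H = \<one>"
    using H.pow_order_eq_1[of x] assms(4) by (simp add: order_def)
  then show ?thesis using nat_pow_consistent by metis
qed

text \<open>The period of s divides the prime q, and an orbit of q points does not fit into
  S.\<close>

lemma prime_funpow_fixpoint:
  assumes "Factorial_Ring.prime (q::nat)" "finite S" "card S < q" "h ` S \<subseteq> S" "s \<in> S" "(h ^^ q) s = s"
  shows "h s = s"
proof (rule ccontr)
  assume ne: "h s \<noteq> s"
  have mult: "(h ^^ (k * n)) s = s" if "(h ^^ n) s = s" for k n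
    by (induction k) (use that in \<open>simp_all add: funpow_add\<close>)
  have no: False if n: "0 < n" "n < q" "(h ^^ n) s = s" for n
  proof -
    have "coprime n q"
      using assms(1) n by (metis coprime_commute nat_dvd_not_less prime_imp_coprime)
    \<comment> \<open>The orbit is back at s after n x steps and has reached h s after q y + 1
      steps, which is the same number.\<close>
    then obtain x y where xy: "n * x = q * y + 1"
      using bezout_nat[of n q] n(1) by (metis coprime_imp_gcd_eq_1 gr_implies_not0)
    have "(h ^^ (x * n)) s = s" "(h ^^ (y * q)) s = s" using mult n assms(6) by blast+
    moreover have "(h ^^ (x * n)) s = h ((h ^^ (y * q)) s)"
      using xy by (simp add: mult.commute)
    ultimately show False using ne by simp
  qed
  have "inj_on (\<lambda>k. (h ^^ k) s) {..<q}"
  proof (rule linorder_inj_onI)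
    fix a b assume ab: "a < b" "a \<in> {..<q}" "b \<in> {..<q}"
    show "(h ^^ a) s \<noteq> (h ^^ b) s"
    proof
      assume "(h ^^ a) s = (h ^^ b) s"
      \<comment> \<open>Applying the iterate q - a returns the left side to s and exhibits the
        period b - a < q.\<close>
      then have "(h ^^ (q - a + a)) s = (h ^^ (q - a + b)) s" by (simp add: funpow_add)
      also have "q - a + a = q" using ab by simp
      also have "q - a + b = (b - a) + q" using ab by auto
      finally have "(h ^^ (b - a)) s = s" using assms(6) by (simp add: funpow_add)
      then show False using no[of "b - a"] ab by (auto simp: less_imp_diff_less)
    qed
  qed auto
  moreover have "(h ^^ k) s \<in> S" for k by (induction k) (use assms in auto)
  ultimately have "q \<le> card S"
    using card_inj_on_le[of "\<lambda>k. (h ^^ k) s" "{..<q}" S] assms(2) by auto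
  then show False using assms(3) by simp
qed

subsection \<open>Semidirect products with a group of prime order\<close>

text \<open>Values are integers that matter only modulo q, so that powers of a root of unity need
  not be reduced. The value at the identity excludes the zero function.\<close>

definition mod_char :: "nat \<Rightarrow> 'b monoid \<Rightarrow> ('b \<Rightarrow> int) \<Rightarrow> bool" where
  "mod_char q G \<chi> \<longleftrightarrow> [\<chi> \<one>\<^bsub>G\<^esub> = 1] (mod int q) \<and>
    (\<forall>s\<in>carrier G. \<forall>t\<in>carrier G. [\<chi> (s \<otimes>\<^bsub>G\<^esub> t) = \<chi> s * \<chi> t] (mod int q))"

definition char_product :: "nat \<Rightarrow> 'b monoid \<Rightarrow> ('b \<Rightarrow> int) \<Rightarrow> (int \<times> 'b) monoid" where
  "char_product q P \<chi> =
    semidirect_product (integer_mod_group q) P (\<lambda>s a. (\<chi> s * a) mod int q)"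

lemma carrier_char_product: "q > 0 \<Longrightarrow> carrier (char_product q P \<chi>) = {0..<int q} \<times> carrier P"
  by (simp add: char_product_def semidirect_product_def carrier_integer_mod_group)

lemma mult_char_product [simp]:
  "(a, s) \<otimes>\<^bsub>char_product q P \<chi>\<^esub> (b, t) = ((a + \<chi> s * b) mod int q, s \<otimes>\<^bsub>P\<^esub> t)"
  by (simp add: char_product_def semidirect_product_def mod_simps)

lemma one_char_product [simp]: "\<one>\<^bsub>char_product q P \<chi>\<^esub> = (0, \<one>\<^bsub>P\<^esub>)"
  by (simp add: char_product_def semidirect_product_def)

lemma group_char_product:
  assumes "group P" "mod_char q P \<chi>" "q > 0"
  shows "group (char_product q P \<chi>)"
proof -
  interpret P: group P by fact
  have one: "(\<chi> \<one>\<^bsub>P\<^esub> * a) mod int q = a mod int q" for a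
    using assms(2) cong_scalar_right[of "\<chi> \<one>\<^bsub>P\<^esub>" 1 "int q" a] by (simp add: mod_char_def cong_def)
  have hom: "(b + \<chi> (s \<otimes>\<^bsub>P\<^esub> t) * a) mod int q = (b + \<chi> s * \<chi> t * a) mod int q"
    if "s \<in> carrier P" "t \<in> carrier P" for s t a b
  proof -
    have "[b + \<chi> (s \<otimes>\<^bsub>P\<^esub> t) * a = b + \<chi> s * \<chi> t * a] (mod int q)"
      using assms(2) that by (intro cong_add cong_scalar_right) (auto simp: mod_char_def)
    then show ?thesis by (simp add: cong_def)
  qed
  show ?thesis
  proof (rule groupI; (simp only: carrier_char_product[OF assms(3)])?)
    fix x y z assume "x \<in> {0..<int q} \<times> carrier P" "y \<in> {0..<int q} \<times> carrier P"
      "z \<in> {0..<int q} \<times> carrier P"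
    moreover obtain a s b t c r where "x = (a, s)" "y = (b, t)" "z = (c, r)" by (metis surj_pair)
    moreover have "((a + \<chi> s * b) mod int q + \<chi> s * \<chi> t * c) mod int q
      = (a + \<chi> s * ((b + \<chi> t * c) mod int q)) mod int q"
      by (simp add: mod_simps mod_add_mult_mod algebra_simps)
    ultimately show "x \<otimes>\<^bsub>char_product q P \<chi>\<^esub> y \<otimes>\<^bsub>char_product q P \<chi>\<^esub> z =
        x \<otimes>\<^bsub>char_product q P \<chi>\<^esub> (y \<otimes>\<^bsub>char_product q P \<chi>\<^esub> z)"
      by (simp add: hom P.m_assoc del: mod_add_left_eq)
  next
    fix x assume x: "x \<in> {0..<int q} \<times> carrier P"
    then obtain a s where as: "x = (a, s)" "0 \<le> a" "a < int q" "s \<in> carrier P" by auto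
    show "\<one>\<^bsub>char_product q P \<chi>\<^esub> \<otimes>\<^bsub>char_product q P \<chi>\<^esub> x = x"
      using as by (simp add: one)
    let ?t = "inv\<^bsub>P\<^esub> s"
    have "((- \<chi> ?t * a) mod int q, ?t) \<otimes>\<^bsub>char_product q P \<chi>\<^esub> x = \<one>\<^bsub>char_product q P \<chi>\<^esub>"
      using as by (simp add: mod_simps)
    then show "\<exists>y\<in>{0..<int q} \<times> carrier P. y \<otimes>\<^bsub>char_product q P \<chi>\<^esub> x = \<one>\<^bsub>char_product q P \<chi>\<^esub>"
      using as assms(3) by (intro bexI[of _ "((- \<chi> ?t * a) mod int q, ?t)"]) auto
  qed (use assms(3) in auto)
qed

text \<open>The element \<open>s0\<close> witnesses that \<chi> is nontrivial modulo q; 1 - \<chi>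
  s0 is the invertible element by which later arguments divide.\<close>

locale prime_char =
  fixes P :: "'b monoid" and q :: nat and \<chi> :: "'b \<Rightarrow> int" and s0 :: 'b
  assumes comm_P: "comm_group P" and fin_P: "finite (carrier P)" and prime_q: "Factorial_Ring.prime q"
    and card_P: "card (carrier P) < q" and char: "mod_char q P \<chi>"
    and s0: "s0 \<in> carrier P" and chi_s0: "\<not> [\<chi> s0 = 1] (mod int q)"
begin

sublocale P: comm_group P by (rule comm_P)

abbreviation S where "S \<equiv> char_product q P \<chi>"

lemma q_gt_1: "1 < q" using prime_q by (rule prime_gt_1_nat)

sublocale S: group S
  using group_char_product[OF P.is_group char] q_gt_1 by simp

lemma carrier_S: "carrier S = {0..<int q} \<times> carrier P"
  using q_gt_1 by (simp add: carrier_char_product)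

lemma fin_S: "finite (carrier S)"
  using fin_P by (simp add: carrier_S)

lemma chi_one: "[\<chi> \<one>\<^bsub>P\<^esub> = 1] (mod int q)" and
  chi_mult: "s \<in> carrier P \<Longrightarrow> t \<in> carrier P \<Longrightarrow> [\<chi> (s \<otimes>\<^bsub>P\<^esub> t) = \<chi> s * \<chi> t] (mod int q)"
  using char by (auto simp: mod_char_def)

lemma coprime_q: "\<not> [u = 0] (mod int q) \<Longrightarrow> coprime u (int q)"
  using prime_q by (metis cong_0_iff coprime_commute prime_imp_coprime prime_nat_int_transfer)

lemma mult_cancel_q: "\<not> [u = 0] (mod int q) \<Longrightarrow> [u * a = u * b] (mod int q) \<Longrightarrow> [a = b] (mod int q)"
  using coprime_q cong_mult_lcancel by blast

lemma inverse_mod_q: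
  assumes "\<not> [u = 0] (mod int q)" obtains v where "[u * v = 1] (mod int q)"
  using cong_solve_coprime_int[OF coprime_q[OF assms]] by blast

lemma one_minus_chi_s0: "\<not> [1 - \<chi> s0 = 0] (mod int q)"
  using chi_s0 by (auto simp: cong_iff_dvd_diff dvd_diff_commute)

lemma P_no_q_torsion:
  assumes "s \<in> carrier P" "s [^]\<^bsub>P\<^esub> q = \<one>\<^bsub>P\<^esub>" shows "s = \<one>\<^bsub>P\<^esub>"
proof -
  have "P.ord s dvd q" "P.ord s dvd card (carrier P)"
    using assms P.pow_eq_id P.ord_dvd_group_order by (auto simp: order_def)
  moreover have "card (carrier P) > 0"
    using fin_P s0 card_gt_0_iff by blast
  ultimately have "P.ord s = 1"
    using prime_q card_P by (metis One_nat_def dvd_imp_le not_less prime_nat_iff)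
  then show ?thesis using P.ord_eq_1 assms by simp
qed

lemma pow_snd: "snd (x [^]\<^bsub>S\<^esub> (n::nat)) = snd x [^]\<^bsub>P\<^esub> n"
proof (induction n)
  case (Suc n)
  then show ?case by (cases x; cases "x [^]\<^bsub>S\<^esub> n") simp
qed simp

lemma pow_N: "(a mod int q, \<one>\<^bsub>P\<^esub>) [^]\<^bsub>S\<^esub> (n::nat) = (int n * a mod int q, \<one>\<^bsub>P\<^esub>)"
proof (induction n)
  case (Suc n)
  have "[int n * a + \<chi> \<one>\<^bsub>P\<^esub> * a = int n * a + 1 * a] (mod int q)"
    by (intro cong_add cong_scalar_right chi_one) simp
  then show ?case using Suc by (simp add: mod_simps mod_add_mult_mod cong_def algebra_simps)
qed simp

text \<open>Describes Z_q without reference to coordinates, so that all automorphisms preserve it.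
  Elements of P have order at most |P| < q, hence contribute no q-torsion.\<close>

lemma q_torsion: "x \<in> carrier S \<Longrightarrow> x [^]\<^bsub>S\<^esub> q = \<one>\<^bsub>S\<^esub> \<longleftrightarrow> snd x = \<one>\<^bsub>P\<^esub>"
proof
  assume x: "x \<in> carrier S" "x [^]\<^bsub>S\<^esub> q = \<one>\<^bsub>S\<^esub>"
  then have "snd x [^]\<^bsub>P\<^esub> q = \<one>\<^bsub>P\<^esub>" using pow_snd[of x q] by simp
  then show "snd x = \<one>\<^bsub>P\<^esub>" using x P_no_q_torsion by (auto simp: carrier_S)
next
  assume "x \<in> carrier S" "snd x = \<one>\<^bsub>P\<^esub>"
  then show "x [^]\<^bsub>S\<^esub> q = \<one>\<^bsub>S\<^esub>"
    using pow_N[of "fst x" q] by (cases x) (simp add: carrier_S)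
qed

section \<open>Automorphisms of the additive group\<close>

definition aut_form :: "(int \<times> 'b \<Rightarrow> int \<times> 'b) \<Rightarrow> int \<Rightarrow> int \<Rightarrow> ('b \<Rightarrow> 'b) \<Rightarrow> bool" where
  "aut_form F i j g \<longleftrightarrow> g \<in> iso P P \<and> \<not> [i = 0] (mod int q) \<and>
    (\<forall>t\<in>carrier P. [\<chi> (g t) = \<chi> t] (mod int q)) \<and>
    (\<forall>a\<in>{0..<int q}. \<forall>t\<in>carrier P. F (a, t) = ((i * a + j * (1 - \<chi> t)) mod int q, g t))"

text \<open>The q-torsion Z_q is preserved and scaled by some i. Write (e t, g t) for the image of
  (0, t): moving (1, \<one>) past (0, t) gives \<chi> (g t) = \<chi> t, which makes e a cocycle for
  \<chi>. The resulting term j (1 - \<chi> t) is conjugation by (j, \<one>).\<close>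

lemma automorphism_form:
  assumes F: "F \<in> iso S S"
  obtains i j g where "aut_form F i j g"
proof -
  interpret F: group_hom S S F
    using F by (simp add: group_hom_def group_hom_axioms_def iso_imp_homomorphism S.is_group)
  have bij: "bij_betw F (carrier S) (carrier S)" using F by (simp add: Group.iso_def)
  let ?N = "\<lambda>a. (a, \<one>\<^bsub>P\<^esub>)"
  define i where "i = fst (F (?N 1))"
  define e where "e t = fst (F (0, t))" for t
  define g where "g t = snd (F (0, t))" for t
  have c1: "?N 1 \<in> carrier S" using q_gt_1 by (auto simp: carrier_S)
  have c0: "(0, t) \<in> carrier S" if "t \<in> carrier P" for t using that q_gt_1 by (auto simp: carrier_S)
  have F0: "F (0, t) = (e t, g t)" for t by (simp add: e_def g_def)
  have cl: "0 \<le> e t" "e t < int q" "g t \<in> carrier P" if "t \<in> carrier P" for t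
    using F.hom_closed[OF c0[OF that]] F0[of t] by (auto simp: carrier_S)
  have "F (?N 1) [^]\<^bsub>S\<^esub> q = F (?N 1 [^]\<^bsub>S\<^esub> q)" using c1 F.hom_nat_pow by simp
  also have "?N 1 [^]\<^bsub>S\<^esub> q = \<one>\<^bsub>S\<^esub>" using q_torsion[OF c1] by simp
  finally have "snd (F (?N 1)) = \<one>\<^bsub>P\<^esub>"
    using q_torsion[OF F.hom_closed[OF c1]] by (simp only: F.hom_one)
  then have F1: "F (?N 1) = ?N i" by (simp add: i_def prod_eq_iff)
  have i_range: "0 \<le> i" "i < int q" using F.hom_closed[OF c1] by (auto simp: F1 carrier_S)
  have FN: "F (?N (int n mod int q)) = ?N (i * int n mod int q)" for n
  proof -
    have "?N (int n mod int q) = ?N 1 [^]\<^bsub>S\<^esub> n" using pow_N[of 1 n] q_gt_1 by simp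
    then have "F (?N (int n mod int q)) = ?N i [^]\<^bsub>S\<^esub> n"
      using c1 F1 F.hom_nat_pow by metis
    then show ?thesis using pow_N[of i n] i_range by (simp add: mult.commute)
  qed
  have FN': "F (?N (a mod int q)) = ?N (i * a mod int q)" for a
    using FN[of "nat (a mod int q)"] q_gt_1 by (simp add: mod_simps)
  have F_eq: "F (a, t) = ((i * a + e t) mod int q, g t)" if "a \<in> {0..<int q}" "t \<in> carrier P" for a t
  proof -
    have 1: "(a, t) = ?N a \<otimes>\<^bsub>S\<^esub> (0, t)" using that by simp
    have "F (a, t) = F (?N a) \<otimes>\<^bsub>S\<^esub> F (0, t)"
      unfolding 1 using that c0 q_gt_1 by (intro F.hom_mult) (auto simp: carrier_S)
    moreover have "F (?N a) = ?N (i * a mod int q)" using FN'[of a] that by simp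
    moreover have "[i * a + \<chi> \<one>\<^bsub>P\<^esub> * e t = i * a + 1 * e t] (mod int q)"
      by (intro cong_add cong_scalar_right chi_one) simp
    ultimately show ?thesis using that by (simp add: F0 cl mod_simps cong_def)
  qed
  have i0: "\<not> [i = 0] (mod int q)"
  proof
    assume "[i = 0] (mod int q)"
    then have "F (?N 1) = F \<one>\<^bsub>S\<^esub>" using F1 i_range F.hom_one by (simp add: cong_def)
    then have "?N 1 = \<one>\<^bsub>S\<^esub>" using bij c1 S.one_closed by (meson bij_betw_imp_inj_on inj_onD)
    then show False by simp
  qed
  have chi_g: "[\<chi> (g t) = \<chi> t] (mod int q)" if t: "t \<in> carrier P" for t
  proof -
    have "F ((0, t) \<otimes>\<^bsub>S\<^esub> ?N 1) = F (0, t) \<otimes>\<^bsub>S\<^esub> F (?N 1)"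
      using c0[OF t] c1 by (rule F.hom_mult)
    moreover have "F ((0, t) \<otimes>\<^bsub>S\<^esub> ?N 1) = ((i * (\<chi> t mod int q) + e t) mod int q, g t)"
      using t q_gt_1 by (simp add: F_eq)
    ultimately have "[i * \<chi> t + e t = e t + \<chi> (g t) * i] (mod int q)"
      by (simp add: F0 F1 cong_def mod_simps mod_add_mult_mod)
    then have "[i * \<chi> (g t) = i * \<chi> t] (mod int q)"
      by (simp add: cong_iff_dvd_diff dvd_diff_commute algebra_simps)
    then show ?thesis using mult_cancel_q i0 by blast
  qed
  have mult0: "e (s \<otimes>\<^bsub>P\<^esub> t) = (e s + \<chi> (g s) * e t) mod int q \<and> g (s \<otimes>\<^bsub>P\<^esub> t) = g s \<otimes>\<^bsub>P\<^esub> g t"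
    if "s \<in> carrier P" "t \<in> carrier P" for s t
    using F.hom_mult[OF c0 c0, OF that] by (simp add: F0)
  have e_mult: "[e (s \<otimes>\<^bsub>P\<^esub> t) = e s + \<chi> s * e t] (mod int q)"
    if "s \<in> carrier P" "t \<in> carrier P" for s t
  proof -
    have "[e s + \<chi> (g s) * e t = e s + \<chi> s * e t] (mod int q)"
      using that by (intro cong_add cong_scalar_right chi_g) simp_all
    then show ?thesis using mult0[OF that] by (simp add: cong_def)
  qed
  obtain v where v: "[(1 - \<chi> s0) * v = 1] (mod int q)"
    using inverse_mod_q one_minus_chi_s0 by blast
  define j where "j = e s0 * v"
  have e_j: "[e t = j * (1 - \<chi> t)] (mod int q)" if t: "t \<in> carrier P" for t
  proof -
    \<comment> \<open>As P is abelian, the cocycle rule for t and s0 in both orders expresses e t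
      through e s0, after division by 1 - \<chi> s0.\<close>
    have "[e t + \<chi> t * e s0 = e s0 + \<chi> s0 * e t] (mod int q)"
      using e_mult[OF t s0] e_mult[OF s0 t] P.m_comm[OF s0 t] by (simp add: cong_def)
    then have 1: "[(1 - \<chi> s0) * e t = e s0 * (1 - \<chi> t)] (mod int q)"
      by (simp add: cong_iff_dvd_diff algebra_simps)
    have "[((1 - \<chi> s0) * v) * (e s0 * (1 - \<chi> t)) = 1 * (e s0 * (1 - \<chi> t))] (mod int q)"
      by (intro cong_mult v cong_refl)
    then have "[(1 - \<chi> s0) * (j * (1 - \<chi> t)) = (1 - \<chi> s0) * e t] (mod int q)"
      using cong_trans[OF _ cong_sym[OF 1]] by (simp add: j_def algebra_simps)
    then show ?thesis using mult_cancel_q[OF one_minus_chi_s0] cong_sym by blast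
  qed
  have F_form: "F (a, t) = ((i * a + j * (1 - \<chi> t)) mod int q, g t)"
    if "a \<in> {0..<int q}" "t \<in> carrier P" for a t
    using cong_add[OF cong_refl e_j[OF that(2)], of "i * a"] F_eq[OF that] by (simp add: cong_def)
  have surj: "g ` carrier P = carrier P"
  proof
    show "g ` carrier P \<subseteq> carrier P" using cl by auto
    show "carrier P \<subseteq> g ` carrier P"
    proof
      fix t assume "t \<in> carrier P"
      then obtain a s where "(a, s) \<in> carrier S" "F (a, s) = (0, t)"
        using bij c0 by (metis bij_betw_imp_surj_on imageE surj_pair)
      then show "t \<in> g ` carrier P" using F_eq by (auto simp: carrier_S)
    qed
  qed
  then have "g \<in> iso P P"
    using mult0 cl eq_card_imp_inj_on[of "carrier P" g] fin_P
    by (auto simp: Group.iso_def hom_def bij_betw_def)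
  then have "aut_form F i j g"
    unfolding aut_form_def using i0 chi_g F_form by blast
  then show ?thesis by (rule that)
qed

end

lemma cong_via: "[a = b] (mod m) \<Longrightarrow> [a = c] (mod m) \<Longrightarrow> [b = c] (mod (m::int))"
  by (simp add: cong_def)

lemma fermat_int:
  assumes "Factorial_Ring.prime q" "\<not> [a = 0] (mod int q)"
  shows "[a ^ (q - 1) = 1] (mod int q)"
proof -
  define m where "m = nat (a mod int q)"
  have m: "[int m = a] (mod int q)"
    using prime_gt_0_nat[OF assms(1)] by (simp add: m_def cong_def)
  then have "\<not> q dvd m"
    using assms(2) by (metis cong_0_iff cong_sym cong_trans int_dvd_int_iff)
  then have "[int m ^ (q - 1) = 1] (mod int q)"
    using fermat_theorem[OF assms(1)] by (metis cong_int_iff of_nat_1 of_nat_power)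
  then show ?thesis using cong_pow[OF m] by (metis cong_sym cong_trans)
qed

context prime_char
begin

lemma aut_form_id: "aut_form (\<lambda>x. x) 1 0 (\<lambda>t. t)"
  using q_gt_1 by (auto simp: aut_form_def iso_set_refl cong_iff_dvd_diff)

lemma aut_formD:
  assumes "aut_form F i j g"
  shows "g \<in> iso P P" "\<not> [i = 0] (mod int q)"
    "t \<in> carrier P \<Longrightarrow> [\<chi> (g t) = \<chi> t] (mod int q)"
    "a \<in> {0..<int q} \<Longrightarrow> t \<in> carrier P \<Longrightarrow> F (a, t) = ((i * a + j * (1 - \<chi> t)) mod int q, g t)"
    "t \<in> carrier P \<Longrightarrow> g t \<in> carrier P"
    "s \<in> carrier P \<Longrightarrow> t \<in> carrier P \<Longrightarrow> g (s \<otimes>\<^bsub>P\<^esub> t) = g s \<otimes>\<^bsub>P\<^esub> g t"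
    "g \<one>\<^bsub>P\<^esub> = \<one>\<^bsub>P\<^esub>"
proof -
  show "g \<in> iso P P" using assms by (simp add: aut_form_def)
  then show "t \<in> carrier P \<Longrightarrow> g t \<in> carrier P"
    "s \<in> carrier P \<Longrightarrow> t \<in> carrier P \<Longrightarrow> g (s \<otimes>\<^bsub>P\<^esub> t) = g s \<otimes>\<^bsub>P\<^esub> g t"
    by (auto simp: Group.iso_def hom_def)
  show "g \<one>\<^bsub>P\<^esub> = \<one>\<^bsub>P\<^esub>"
    using \<open>g \<in> iso P P\<close> hom_one[OF _ P.is_group P.is_group] by (auto simp: Group.iso_def)
qed (use assms in \<open>simp_all add: aut_form_def\<close>)

text \<open>The value at (0, s0) pins down j because 1 - \<chi> s0 is invertible; i is then read off
  at (1, \<one>).\<close>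

lemma aut_form_unique:
  assumes F: "aut_form F i j g" and F': "aut_form F' i' j' g'"
    and eq: "\<And>x. x \<in> carrier S \<Longrightarrow> F x = F' x"
  shows "[i = i'] (mod int q)" "[j = j'] (mod int q)" "t \<in> carrier P \<Longrightarrow> g t = g' t"
proof -
  have e: "[i * a + j * (1 - \<chi> t) = i' * a + j' * (1 - \<chi> t)] (mod int q) \<and> g t = g' t"
    if "a \<in> {0..<int q}" "t \<in> carrier P" for a t
    using eq[of "(a, t)"] that aut_formD(4)[OF F that] aut_formD(4)[OF F' that]
    by (simp add: carrier_S cong_def)
  show "t \<in> carrier P \<Longrightarrow> g t = g' t" using e[of 0 t] q_gt_1 by simp
  have "[(1 - \<chi> s0) * j = (1 - \<chi> s0) * j'] (mod int q)"
    using e[of 0 s0] s0 q_gt_1 by (simp add: mult.commute)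
  then show j: "[j = j'] (mod int q)" using mult_cancel_q[OF one_minus_chi_s0] by blast
  have "[i * 1 + j * (1 - \<chi> \<one>\<^bsub>P\<^esub>) - j * (1 - \<chi> \<one>\<^bsub>P\<^esub>)
      = i' * 1 + j' * (1 - \<chi> \<one>\<^bsub>P\<^esub>) - j' * (1 - \<chi> \<one>\<^bsub>P\<^esub>)] (mod int q)"
    using e[of 1 "\<one>\<^bsub>P\<^esub>"] q_gt_1 j by (intro cong_diff cong_scalar_right) auto
  then show "[i = i'] (mod int q)" by simp
qed

text \<open>The pairs (i, j) compose like the affine maps z \<mapsto> i z + j; they do not interact
  with g because g preserves \<chi>.\<close>

lemma aut_form_comp:
  assumes F: "aut_form F i j g" and F': "aut_form F' i' j' g'"
  shows "aut_form (F \<circ> F') (i * i') (i * j' + j) (g \<circ> g')"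
  unfolding aut_form_def
proof (intro conjI ballI)
  note D = aut_formD[OF F] and D' = aut_formD[OF F']
  show "g \<circ> g' \<in> iso P P" using D(1) D'(1) by (metis iso_set_trans)
  show "\<not> [i * i' = 0] (mod int q)"
    using D(2) D'(2) mult_cancel_q[of i i' 0] by auto
  show "[\<chi> ((g \<circ> g') t) = \<chi> t] (mod int q)" if "t \<in> carrier P" for t
    using D(3)[OF D'(5)[OF that]] D'(3)[OF that] by (metis comp_apply cong_trans)
  show "(F \<circ> F') (a, t) = ((i * i' * a + (i * j' + j) * (1 - \<chi> t)) mod int q, (g \<circ> g') t)"
    if "a \<in> {0..<int q}" "t \<in> carrier P" for a t
  proof -
    let ?u = "i' * a + j' * (1 - \<chi> t)"
    have "[i * (?u mod int q) + j * (1 - \<chi> (g' t)) = i * ?u + j * (1 - \<chi> t)] (mod int q)"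
      by (intro cong_add cong_mult cong_diff cong_refl D'(3) that) simp
    moreover have "i * ?u + j * (1 - \<chi> t) = i * i' * a + (i * j' + j) * (1 - \<chi> t)"
      by (simp add: algebra_simps)
    ultimately show ?thesis
      using D(4)[of "?u mod int q" "g' t"] D'(4)[OF that] D'(5)[OF that(2)] q_gt_1
      by (simp add: cong_def)
  qed
qed

end

text \<open>
  In a brace on \<open>\<int>\<^sub>q \<rtimes> P\<close> the elements killed by \<open>q\<close> form \<open>\<int>\<^sub>q\<close>, so the next property, which is
  visibly invariant under isomorphisms, says that \<open>\<int>\<^sub>q\<close> acts trivially.
\<close>

definition left_trivial :: "nat \<Rightarrow> 'a monoid \<times> 'a monoid \<Rightarrow> bool" where
  "left_trivial q B \<longleftrightarrow> (\<forall>n\<in>carrier (fst B). n [^]\<^bsub>fst B\<^esub> q = \<one>\<^bsub>fst B\<^esub> \<longrightarrow>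
    (\<forall>b\<in>carrier (fst B). n \<otimes>\<^bsub>snd B\<^esub> b = n \<otimes>\<^bsub>fst B\<^esub> b))"

lemma left_trivial_iso:
  assumes "skew_brace A M" "skew_brace A' M'" "f \<in> brace_isos (A, M) (A', M')"
    "left_trivial q (A', M')"
  shows "left_trivial q (A, M)"
  unfolding left_trivial_def fst_conv snd_conv
proof (intro ballI impI)
  interpret B: skew_brace A M by fact
  interpret B': skew_brace A' M' by fact
  have f: "f \<in> hom A A'" "f \<in> hom M M'" "inj_on f (carrier A)"
    using assms(3) by (auto simp: brace_isos_def Group.iso_def bij_betw_def)
  fix n b assume n: "n \<in> carrier A" "n [^]\<^bsub>A\<^esub> q = \<one>\<^bsub>A\<^esub>" "b \<in> carrier A"
  have c: "f n \<in> carrier A'" "f b \<in> carrier A'" using f(1) n by (auto simp: hom_def)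
  have "f n [^]\<^bsub>A'\<^esub> q = \<one>\<^bsub>A'\<^esub>"
    using hom_nat_pow[OF f(1) n(1) B.add.is_group B'.add.is_group, of q] n(2)
      hom_one[OF f(1) B.add.is_group B'.add.is_group] by simp
  then have "f n \<otimes>\<^bsub>M'\<^esub> f b = f n \<otimes>\<^bsub>A'\<^esub> f b"
    using assms(4) c by (simp add: left_trivial_def)
  then have "f (n \<otimes>\<^bsub>M\<^esub> b) = f (n \<otimes>\<^bsub>A\<^esub> b)"
    using n f(1,2) B.carrier_eq by (simp add: hom_def)
  then show "n \<otimes>\<^bsub>M\<^esub> b = n \<otimes>\<^bsub>A\<^esub> b"
    using f(3) n B.mult_closed by (auto dest: inj_onD)
qed

section \<open>The lambda map in coordinates, and the action of Z_q\<close>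

locale char_product_brace = prime_char P q \<chi> s0 + skew_brace "char_product q P \<chi>" M
  for P :: "'b monoid" and q \<chi> s0 and M :: "(int \<times> 'b) monoid" +
  fixes i j :: "int \<times> 'b \<Rightarrow> int" and g :: "int \<times> 'b \<Rightarrow> 'b \<Rightarrow> 'b"
  assumes form: "x \<in> carrier (char_product q P \<chi>) \<Longrightarrow>
    aut_form (brace_act (char_product q P \<chi>) M x) (i x) (j x) (g x)"
begin

lemma mem_S [simp]: "(a, s) \<in> carrier S \<longleftrightarrow> 0 \<le> a \<and> a < int q \<and> s \<in> carrier P"
  by (auto simp: carrier_S)

lemma mult_form:
  assumes "(a, s) \<in> carrier S" "(b, t) \<in> carrier S"
  shows "(a, s) \<otimes>\<^bsub>M\<^esub> (b, t) =
    ((a + \<chi> s * (i (a, s) * b + j (a, s) * (1 - \<chi> t))) mod int q, s \<otimes>\<^bsub>P\<^esub> g (a, s) t)"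
  using mult_eq_act[OF assms] aut_formD(4)[OF form[OF assms(1)], of b t] assms
  by (simp add: mod_add_mult_mod)

text \<open>The lambda map is a homomorphism on the multiplicative group, and coordinates are
  unique. So i and g are multiplicative and j is a cocycle twisted by i.\<close>

lemma
  assumes "x \<in> carrier S" "y \<in> carrier S"
  shows i_mult: "[i (x \<otimes>\<^bsub>M\<^esub> y) = i x * i y] (mod int q)"
    and j_mult: "[j (x \<otimes>\<^bsub>M\<^esub> y) = i x * j y + j x] (mod int q)"
    and g_mult: "t \<in> carrier P \<Longrightarrow> g (x \<otimes>\<^bsub>M\<^esub> y) t = g x (g y t)"
  using aut_form_unique[OF form[OF mult_closed[OF assms]] aut_form_comp[OF form form, OF assms]]
    brace_act_mult[OF assms] by simp_all

lemma act_one: "x \<in> carrier S \<Longrightarrow> brace_act S M \<one>\<^bsub>S\<^esub> x = x"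
proof -
  assume x: "x \<in> carrier S"
  have "\<one>\<^bsub>S\<^esub> \<otimes>\<^bsub>M\<^esub> x = x" using mult.l_one[of x] x unfolding carrier_eq one_eq by blast
  then show ?thesis using x by (simp add: brace_act_def del: one_char_product)
qed

lemma
  shows i_one: "[i \<one>\<^bsub>S\<^esub> = 1] (mod int q)"
    and g_one: "t \<in> carrier P \<Longrightarrow> g \<one>\<^bsub>S\<^esub> t = t"
  using aut_form_unique[OF form[OF S.one_closed] aut_form_id] act_one by blast+

abbreviation N where "N \<equiv> {0..<int q} \<times> {\<one>\<^bsub>P\<^esub>}"

text \<open>Each g fixes the identity of P, so the second coordinate stays trivial. Thus Z_q has q
  elements and is closed under the multiplication too.\<close>

lemma N_closed: "x \<in> N \<Longrightarrow> y \<in> N \<Longrightarrow> x \<otimes>\<^bsub>M\<^esub> y \<in> N"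
  using q_gt_1 mult_form aut_formD(7)[OF form] by auto

lemma N_power: "x \<in> N \<Longrightarrow> x [^]\<^bsub>M\<^esub> q = \<one>\<^bsub>S\<^esub>"
proof -
  assume "x \<in> N"
  then have "x [^]\<^bsub>M\<^esub> card N = \<one>\<^bsub>M\<^esub>"
    using N_closed by (intro mult.pow_card_closed_eq_one) (auto simp: carrier_eq)
  then show ?thesis using one_eq by (simp add: card_cartesian_product)
qed

lemma pow_closed_S: "x \<in> carrier S \<Longrightarrow> x [^]\<^bsub>M\<^esub> (n::nat) \<in> carrier S"
  using mult.nat_pow_closed carrier_eq by metis

text \<open>The q-th multiplicative power of x is the identity. Hence i x ^ q = 1 modulo q, while
  Fermat gives i x ^ q = i x; and g x is a self-map of P whose q-th iterate is the identity, with
  |P| < q.\<close>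

lemma N_act_trivial:
  assumes x: "x \<in> N"
  shows "[i x = 1] (mod int q)" "t \<in> carrier P \<Longrightarrow> g x t = t"
proof -
  have xS: "x \<in> carrier S" using x by auto
  have "[i (x [^]\<^bsub>M\<^esub> n) = i x ^ n] (mod int q)" for n :: nat
  proof (induction n)
    case 0
    then show ?case using i_one one_eq by (simp del: one_char_product)
  next
    case (Suc n)
    have "[i (x [^]\<^bsub>M\<^esub> n \<otimes>\<^bsub>M\<^esub> x) = i x ^ n * i x] (mod int q)"
      using cong_trans[OF i_mult[OF pow_closed_S xS] cong_scalar_right[OF Suc]] xS by blast
    then show ?case by (simp add: mult.commute)
  qed
  from this[of q] have "[i x ^ q = 1] (mod int q)"
    using N_power[OF x] i_one by (metis cong_sym cong_trans)
  moreover have "[i x ^ (q - 1) * i x = 1 * i x] (mod int q)"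
    by (intro cong_scalar_right fermat_int prime_q aut_formD(2)[OF form[OF xS]])
  then have "[i x ^ q = i x] (mod int q)"
    using q_gt_1 by (simp flip: power_Suc2)
  ultimately show "[i x = 1] (mod int q)" by (metis cong_sym cong_trans)
  have pow: "g (x [^]\<^bsub>M\<^esub> n) t = (g x ^^ n) t" if "t \<in> carrier P" for n t
    using that
  proof (induction n arbitrary: t)
    case 0
    then show ?case using g_one one_eq by (simp del: one_char_product)
  next
    case (Suc n)
    have "g (x [^]\<^bsub>M\<^esub> n \<otimes>\<^bsub>M\<^esub> x) t = g (x [^]\<^bsub>M\<^esub> n) (g x t)"
      using xS Suc.prems by (intro g_mult pow_closed_S)
    then show ?case
      using Suc aut_formD(5)[OF form[OF xS]] by (simp add: funpow_swap1)
  qed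
  show "g x t = t" if t: "t \<in> carrier P"
  proof (rule prime_funpow_fixpoint[OF prime_q fin_P card_P _ t])
    show "g x ` carrier P \<subseteq> carrier P" using aut_formD(5)[OF form[OF xS]] by auto
    show "(g x ^^ q) t = t" using pow[OF t, of q] N_power[OF x] g_one[OF t] by simp
  qed
qed

text \<open>
  The element \<open>(a, 1)\<close> acts as the inner automorphism given by \<open>a * kappa\<close>. Conjugating by an element
  on which \<open>\<chi>\<close> is nontrivial leaves only the values 0 and -1; the opposite additive group swaps them.
\<close>

definition kappa where "kappa = j (1, \<one>\<^bsub>P\<^esub>)"

lemma N_mult_aux:
  assumes "(a, \<one>\<^bsub>P\<^esub>) \<in> N" "(b, t) \<in> carrier S"
  shows "(a, \<one>\<^bsub>P\<^esub>) \<otimes>\<^bsub>M\<^esub> (b, t) = ((a + b + j (a, \<one>\<^bsub>P\<^esub>) * (1 - \<chi> t)) mod int q, t)"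
proof -
  let ?n = "(a, \<one>\<^bsub>P\<^esub>)"
  have "[a + \<chi> \<one>\<^bsub>P\<^esub> * (i ?n * b + j ?n * (1 - \<chi> t)) = a + 1 * (1 * b + j ?n * (1 - \<chi> t))] (mod int q)"
    by (intro cong_add cong_mult cong_refl chi_one N_act_trivial assms)
  then show ?thesis
    using assms by (simp add: mult_form N_act_trivial cong_def add.assoc)
qed

text \<open>On Z_q the two operations agree and i is trivial, so the cocycle law for j is plain
  additivity.\<close>

lemma j_N: "[j (int n mod int q, \<one>\<^bsub>P\<^esub>) = int n * kappa] (mod int q)"
proof (induction n)
  case 0
  show ?case
    using aut_form_unique(2)[OF form[OF S.one_closed] aut_form_id] act_one by simp
next
  case (Suc n)
  let ?n = "(int n mod int q, \<one>\<^bsub>P\<^esub>)" and ?m = "(int (Suc n) mod int q, \<one>\<^bsub>P\<^esub>)"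
  have n: "?n \<in> N" "(1, \<one>\<^bsub>P\<^esub>) \<in> carrier S" "?n \<in> carrier S" using q_gt_1 by auto
  have "[int n mod int q + 1 + j ?n * (1 - \<chi> \<one>\<^bsub>P\<^esub>) = int n + 1 + j ?n * (1 - 1)] (mod int q)"
    by (intro cong_add cong_mult cong_diff cong_refl chi_one) simp
  then have "?n \<otimes>\<^bsub>M\<^esub> (1, \<one>\<^bsub>P\<^esub>) = ?m"
    using N_mult_aux[OF n(1,2)] by (simp add: cong_def add.commute)
  then have "[j ?m = i ?n * kappa + j ?n] (mod int q)"
    using j_mult[OF n(3,2)] by (simp add: kappa_def)
  also have "[i ?n * kappa + j ?n = 1 * kappa + int n * kappa] (mod int q)"
    by (intro cong_add cong_scalar_right N_act_trivial n Suc)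
  finally show ?case by (simp add: algebra_simps)
qed

lemma j_N': "0 \<le> a \<Longrightarrow> a < int q \<Longrightarrow> [j (a, \<one>\<^bsub>P\<^esub>) = a * kappa] (mod int q)"
  using j_N[of "nat a"] by simp

lemma N_mult:
  assumes "0 \<le> a" "a < int q" "(b, t) \<in> carrier S"
  shows "(a, \<one>\<^bsub>P\<^esub>) \<otimes>\<^bsub>M\<^esub> (b, t) = ((a + b + a * kappa * (1 - \<chi> t)) mod int q, t)"
proof -
  have "[a + b + j (a, \<one>\<^bsub>P\<^esub>) * (1 - \<chi> t) = a + b + a * kappa * (1 - \<chi> t)] (mod int q)"
    using assms by (intro cong_add cong_mult cong_refl j_N')
  then show ?thesis using N_mult_aux[of a b t] assms by (simp add: cong_def)
qed

lemma kappa_cases: "[kappa = 0] (mod int q) \<or> [kappa = -1] (mod int q)"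
proof -
  let ?s = "(0, s0)" and ?e = "(1, \<one>\<^bsub>P\<^esub>)"
  \<comment> \<open>Multiplying (0, s0) from the left by (a, \<one>) gives (a r, s0). So r is
    nonzero, as left factors 1 and 0 must have different products.\<close>
  define r where "r = 1 + kappa * (1 - \<chi> s0)"
  have s: "?s \<in> carrier S" "?e \<in> carrier S" using s0 q_gt_1 by auto
  have Ns: "(a, \<one>\<^bsub>P\<^esub>) \<otimes>\<^bsub>M\<^esub> ?s = (a * r mod int q, s0)" if "0 \<le> a" "a < int q" for a
    using N_mult[OF that s(1)] by (simp add: r_def algebra_simps)
  have r0: "\<not> [r = 0] (mod int q)"
  proof
    assume "[r = 0] (mod int q)"
    then have "?e \<otimes>\<^bsub>M\<^esub> ?s = ?s" using Ns[of 1] q_gt_1 by (simp add: cong_def)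
    then have "?e = \<one>\<^bsub>M\<^esub>"
      using s carrier_eq by (metis mult.one_closed mult.l_one mult.r_cancel)
    then show False using one_eq by simp
  qed
  then obtain v where v: "[r * v = 1] (mod int q)" using inverse_mod_q by blast
  \<comment> \<open>Chosen so that (a, \<one>) is the multiplicative conjugate of (1, \<one>) by (0,
    s0). Computing j on both sides of this relation yields a kappa = i kappa with i = i (0,
    s0).\<close>
  define a where "a = v * (\<chi> s0 * i ?s) mod int q"
  have a: "0 \<le> a" "a < int q" "(a, \<one>\<^bsub>P\<^esub>) \<in> carrier S" using q_gt_1 by (auto simp: a_def)
  have "[a * r = v * (\<chi> s0 * i ?s) * r] (mod int q)"
    unfolding a_def by (intro cong_scalar_right) simp
  also have "v * (\<chi> s0 * i ?s) * r = (r * v) * (\<chi> s0 * i ?s)" by (simp add: algebra_simps)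
  also have "[(r * v) * (\<chi> s0 * i ?s) = 1 * (\<chi> s0 * i ?s)] (mod int q)"
    by (intro cong_scalar_right v)
  finally have ar: "[a * r = \<chi> s0 * i ?s] (mod int q)" by simp
  have "[\<chi> s0 * (i ?s * 1 + j ?s * (1 - \<chi> \<one>\<^bsub>P\<^esub>)) = \<chi> s0 * (i ?s * 1 + j ?s * (1 - 1))] (mod int q)"
    by (intro cong_add cong_mult cong_diff cong_refl chi_one)
  then have "?s \<otimes>\<^bsub>M\<^esub> ?e = ((\<chi> s0 * i ?s) mod int q, s0)"
    using s by (simp add: mult_form cong_def aut_formD(7)[OF form])
  then have "(a, \<one>\<^bsub>P\<^esub>) \<otimes>\<^bsub>M\<^esub> ?s = ?s \<otimes>\<^bsub>M\<^esub> ?e" using Ns[of a] a ar by (simp add: cong_def)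
  then have "[i (a, \<one>\<^bsub>P\<^esub>) * j ?s + j (a, \<one>\<^bsub>P\<^esub>) = i ?s * kappa + j ?s] (mod int q)"
    using j_mult[OF a(3) s(1)] j_mult[OF s] by (simp add: cong_def kappa_def)
  moreover have "[i (a, \<one>\<^bsub>P\<^esub>) * j ?s + j (a, \<one>\<^bsub>P\<^esub>) = 1 * j ?s + a * kappa] (mod int q)"
    using a by (intro cong_add cong_scalar_right j_N' N_act_trivial) auto
  ultimately have "[1 * j ?s + a * kappa = i ?s * kappa + j ?s] (mod int q)"
    by (rule cong_via[rotated])
  then have 1: "int q dvd a * kappa - i ?s * kappa"
    by (simp add: cong_iff_dvd_diff algebra_simps)
  have 2: "int q dvd a * r - \<chi> s0 * i ?s" using ar by (simp add: cong_iff_dvd_diff)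
  \<comment> \<open>Multiplication by r eliminates a, since a r = \<chi> s0 i; the rest factors
    because r - \<chi> s0 = (1 + kappa)(1 - \<chi> s0).\<close>
  have "int q dvd (a * kappa - i ?s * kappa) * r - (a * r - \<chi> s0 * i ?s) * kappa"
    by (rule dvd_diff[OF dvd_mult2[OF 1] dvd_mult2[OF 2]])
  also have "\<dots> = - (i ?s * (kappa * (1 + kappa) * (1 - \<chi> s0)))"
    by (simp add: r_def algebra_simps)
  finally have "int q dvd i ?s * ((kappa * (1 + kappa)) * (1 - \<chi> s0))" by simp
  then have "int q dvd kappa \<or> int q dvd 1 + kappa"
    using prime_q aut_formD(2)[OF form[OF s(1)]] one_minus_chi_s0
    by (simp add: prime_dvd_mult_iff cong_0_iff)
  then show ?thesis by (auto simp: cong_iff_dvd_diff add.commute)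
qed

text \<open>By \<open>N_mult\<close> the first coordinate of (a, \<one>) \<circ> (c, t) is a + c for
  kappa = 0, and c + \<chi> t a for kappa = -1. The latter is the sum in the reversed order.\<close>

lemma left_trivial_cases: "left_trivial q (S, M) \<or> left_trivial q (opposite S, M)"
  using kappa_cases
proof
  assume k: "[kappa = 0] (mod int q)"
  have "left_trivial q (S, M)"
    unfolding left_trivial_def fst_conv snd_conv
  proof (intro ballI impI)
    fix n b assume *: "n \<in> carrier S" "n [^]\<^bsub>S\<^esub> q = \<one>\<^bsub>S\<^esub>" "b \<in> carrier S"
    then obtain a c t where n: "n = (a, \<one>\<^bsub>P\<^esub>)" "b = (c, t)" using q_torsion by (metis prod.collapse)
    have "[a + c + a * kappa * (1 - \<chi> t) = a + c + a * 0 * (1 - \<chi> t)] (mod int q)"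
      by (intro cong_add cong_mult cong_refl k)
    moreover have "[a + \<chi> \<one>\<^bsub>P\<^esub> * c = a + 1 * c] (mod int q)"
      by (intro cong_add cong_mult cong_refl chi_one)
    ultimately show "n \<otimes>\<^bsub>M\<^esub> b = n \<otimes>\<^bsub>S\<^esub> b" using * n by (simp add: N_mult cong_def)
  qed
  then show ?thesis ..
next
  assume k: "[kappa = -1] (mod int q)"
  have "left_trivial q (opposite S, M)"
    unfolding left_trivial_def fst_conv snd_conv
  proof (intro ballI impI)
    fix n b assume "n \<in> carrier (opposite S)" "n [^]\<^bsub>opposite S\<^esub> q = \<one>\<^bsub>opposite S\<^esub>"
      "b \<in> carrier (opposite S)"
    then have *: "n \<in> carrier S" "n [^]\<^bsub>S\<^esub> q = \<one>\<^bsub>S\<^esub>" "b \<in> carrier S"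
      using nat_pow_opposite[OF S.is_group] by (simp_all del: one_char_product)
    then obtain a c t where n: "n = (a, \<one>\<^bsub>P\<^esub>)" "b = (c, t)" using q_torsion by (metis prod.collapse)
    have "[a + c + a * kappa * (1 - \<chi> t) = a + c + a * (-1) * (1 - \<chi> t)] (mod int q)"
      by (intro cong_add cong_mult cong_refl k)
    then show "n \<otimes>\<^bsub>M\<^esub> b = n \<otimes>\<^bsub>opposite S\<^esub> b"
      using * n by (simp add: N_mult cong_def algebra_simps)
  qed
  then show ?thesis ..
qed

text \<open>Now (a, s) = (a, \<one>) \<circ> (0, s) with a trivially acting factor, so i, j, g
  depend on s alone and the product descends to P, giving Q with lambda map g'. Invariance of \<chi>
  under g' makes \<chi> a character of Q. If j' s = (1 - i' s) c for all s, then every action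
  preserves the complement of elements (c (1 - \<chi> t), t), in which the product has the form
  \<open>char_product q Q \<psi>\<close>.\<close>

lemma left_trivial_normal_form:
  assumes lt: "left_trivial q (S, M)"
  obtains Q \<psi> f where "skew_brace P Q" "mod_char q Q \<chi>" "mod_char q Q \<psi>"
    "f \<in> brace_isos (S, char_product q Q \<psi>) (S, M)"
proof -
  have ltD: "(a, \<one>\<^bsub>P\<^esub>) \<otimes>\<^bsub>M\<^esub> b = (a, \<one>\<^bsub>P\<^esub>) \<otimes>\<^bsub>S\<^esub> b" if "0 \<le> a" "a < int q" "b \<in> carrier S" for a b
    using lt that q_torsion[of "(a, \<one>\<^bsub>P\<^esub>)"] by (simp add: left_trivial_def)
  have eq0: "[i (a, s) = i (0, s)] (mod int q)" "[j (a, s) = j (0, s)] (mod int q)"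
    "t \<in> carrier P \<Longrightarrow> g (a, s) t = g (0, s) t" if as: "(a, s) \<in> carrier S" for a s t
  proof -
    let ?n = "(a, \<one>\<^bsub>P\<^esub>)" and ?s = "(0, s)"
    have n: "?n \<in> carrier S" "?s \<in> carrier S" "?n \<in> N" using as by auto
    have e: "(a, s) = ?n \<otimes>\<^bsub>M\<^esub> ?s" using ltD[of a ?s] as by simp
    have "brace_act S M ?n x = x" if "x \<in> carrier S" for x
      using ltD[of a x] as that n(1)
      by (simp add: brace_act_def S.m_assoc[symmetric] del: mult_char_product one_char_product)
    then have j0: "[j ?n = 0] (mod int q)"
      using aut_form_unique(2)[OF form[OF n(1)] aut_form_id] by blast
    have "[i ?n * i ?s = 1 * i ?s] (mod int q)"
      by (intro cong_scalar_right N_act_trivial n)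
    then show "[i (a, s) = i (0, s)] (mod int q)"
      using cong_trans[OF i_mult[OF n(1,2)]] e by simp
    have "[i ?n * j ?s + j ?n = 1 * j ?s + 0] (mod int q)"
      by (intro cong_add cong_scalar_right N_act_trivial n j0)
    then show "[j (a, s) = j (0, s)] (mod int q)"
      using cong_trans[OF j_mult[OF n(1,2)]] e by simp
    show "g (a, s) t = g (0, s) t" if t: "t \<in> carrier P"
      using g_mult[OF n(1,2) t] e N_act_trivial(2)[OF n(3)] t aut_formD(5)[OF form[OF n(2)]] by simp
  qed
  define i' where "i' s = i (0, s)" for s
  define j' where "j' s = j (0, s)" for s
  define g' where "g' s = g (0, s)" for s
  define Q where "Q = \<lparr>carrier = carrier P, monoid.mult = (\<lambda>s t. s \<otimes>\<^bsub>P\<^esub> g' s t), one = \<one>\<^bsub>P\<^esub>\<rparr>"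
  have Q [simp]: "carrier Q = carrier P" "s \<otimes>\<^bsub>Q\<^esub> t = s \<otimes>\<^bsub>P\<^esub> g' s t" "\<one>\<^bsub>Q\<^esub> = \<one>\<^bsub>P\<^esub>" for s t
    by (simp_all add: Q_def)
  have c0: "(0, s) \<in> carrier S" if "s \<in> carrier P" for s using that q_gt_1 by simp
  have f0: "aut_form (brace_act S M (0, s)) (i' s) (j' s) (g' s)" if "s \<in> carrier P" for s
    using form[OF c0[OF that]] by (simp add: i'_def j'_def g'_def)
  note g'D = aut_formD(1,3,5,6,7)[OF f0]
  have M_mult: "(a, s) \<otimes>\<^bsub>M\<^esub> (b, t) =
      ((a + \<chi> s * (i' s * b + j' s * (1 - \<chi> t))) mod int q, s \<otimes>\<^bsub>Q\<^esub> t)"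
    if "(a, s) \<in> carrier S" "(b, t) \<in> carrier S" for a s b t
  proof -
    have "[a + \<chi> s * (i (a, s) * b + j (a, s) * (1 - \<chi> t))
        = a + \<chi> s * (i' s * b + j' s * (1 - \<chi> t))] (mod int q)"
      unfolding i'_def j'_def using that by (intro cong_add cong_mult cong_refl eq0)
    then show ?thesis using that mult_form[OF that] eq0(3)[OF that(1), of t] by (simp add: cong_def g'_def)
  qed
  have Q_closed: "s \<otimes>\<^bsub>Q\<^esub> t \<in> carrier P" if "s \<in> carrier P" "t \<in> carrier P" for s t
    using that g'D(3) by simp
  have hom: "[i' (s \<otimes>\<^bsub>Q\<^esub> t) = i' s * i' t] (mod int q)"
    "[j' (s \<otimes>\<^bsub>Q\<^esub> t) = i' s * j' t + j' s] (mod int q)"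
    "r \<in> carrier P \<Longrightarrow> g' (s \<otimes>\<^bsub>Q\<^esub> t) r = g' s (g' t r)"
    if st: "s \<in> carrier P" "t \<in> carrier P" for s t r
  proof -
    \<comment> \<open>The product of (0, s) and (0, t) can have a nonzero first coordinate a, coming
      from j' s; \<open>eq0\<close> discards it.\<close>
    obtain a where a: "(0, s) \<otimes>\<^bsub>M\<^esub> (0, t) = (a, s \<otimes>\<^bsub>Q\<^esub> t)" "(a, s \<otimes>\<^bsub>Q\<^esub> t) \<in> carrier S"
      using M_mult[of 0 s 0 t] st mult_closed[OF c0 c0] by (metis c0)
    show "[i' (s \<otimes>\<^bsub>Q\<^esub> t) = i' s * i' t] (mod int q)"
      using eq0(1)[OF a(2)] i_mult[OF c0 c0, OF st] unfolding i'_def a(1) by (rule cong_via)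
    show "[j' (s \<otimes>\<^bsub>Q\<^esub> t) = i' s * j' t + j' s] (mod int q)"
      using eq0(2)[OF a(2)] j_mult[OF c0 c0, OF st] unfolding i'_def j'_def a(1) by (rule cong_via)
    show "g' (s \<otimes>\<^bsub>Q\<^esub> t) r = g' s (g' t r)" if "r \<in> carrier P"
      using g_mult[OF c0 c0, OF st that] eq0(3)[OF a(2) that] a(1) unfolding g'_def by metis
  qed
  have g'1: "g' \<one>\<^bsub>P\<^esub> t = t" if "t \<in> carrier P" for t using g_one[OF that] by (simp add: g'_def)
  have grQ: "group Q"
  proof (rule groupI)
    fix x y z assume *: "x \<in> carrier Q" "y \<in> carrier Q" "z \<in> carrier Q"
    then have "g' (x \<otimes>\<^bsub>Q\<^esub> y) z = g' x (g' y z)" by (simp only: hom Q(1))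
    then show "x \<otimes>\<^bsub>Q\<^esub> y \<otimes>\<^bsub>Q\<^esub> z = x \<otimes>\<^bsub>Q\<^esub> (y \<otimes>\<^bsub>Q\<^esub> z)"
      using * g'D(3,4) by (simp add: P.m_assoc)
  next
    fix x assume x: "x \<in> carrier Q"
    obtain a t where at: "inv\<^bsub>M\<^esub> (0, x) = (a, t)" by (cases "inv\<^bsub>M\<^esub> (0, x)")
    have "(a, t) \<in> carrier S" "(a, t) \<otimes>\<^bsub>M\<^esub> (0, x) = \<one>\<^bsub>S\<^esub>"
      using x c0[of x] carrier_eq at mult.inv_closed[of "(0, x)"] mult.l_inv[of "(0, x)"] one_eq
      by (auto simp del: one_char_product mem_S)
    then have "t \<in> carrier P" "t \<otimes>\<^bsub>Q\<^esub> x = \<one>\<^bsub>P\<^esub>"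
      using M_mult[of a t 0 x] x c0 by auto
    then show "\<exists>y\<in>carrier Q. y \<otimes>\<^bsub>Q\<^esub> x = \<one>\<^bsub>Q\<^esub>" by auto
  qed (use Q_closed g'1 in auto)
  have sb: "skew_brace P Q"
    using g'D(1) by (intro skew_brace_of_act[of P Q g'] P.is_group grQ)
      (auto simp: Group.iso_def)
  have chiQ: "mod_char q Q \<chi>"
  proof -
    have "[\<chi> (s \<otimes>\<^bsub>P\<^esub> g' s t) = \<chi> s * \<chi> t] (mod int q)" if "s \<in> carrier P" "t \<in> carrier P" for s t
      using chi_mult[OF that(1) g'D(3)[OF that]] cong_scalar_left[OF g'D(2)[OF that], of "\<chi> s"]
      by (rule cong_trans)
    then show ?thesis using chi_one by (simp add: mod_char_def)
  qed
  \<comment> \<open>The coefficient of b in \<open>M_mult\<close>: \<chi> s stems from the addition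
    and i' s from the action.\<close>
  define \<psi> where "\<psi> s = \<chi> s * i' s" for s
  have psiQ: "mod_char q Q \<psi>"
  proof -
    have "[\<chi> (s \<otimes>\<^bsub>Q\<^esub> t) * i' (s \<otimes>\<^bsub>Q\<^esub> t) = (\<chi> s * \<chi> t) * (i' s * i' t)] (mod int q)"
      if "s \<in> carrier P" "t \<in> carrier P" for s t
      using that chiQ by (intro cong_mult hom) (auto simp: mod_char_def)
    moreover have "[\<chi> \<one>\<^bsub>P\<^esub> * i' \<one>\<^bsub>P\<^esub> = 1 * 1] (mod int q)"
      using i_one by (intro cong_mult chi_one) (simp add: i'_def)
    ultimately show ?thesis by (simp add: mod_char_def \<psi>_def ac_simps)
  qed
  \<comment> \<open>Averaging the cocycle \<open>j'\<close> over \<open>P\<close>, whose order is invertible modulo \<open>q\<close>, shows that it is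
    a coboundary.\<close>
  let ?n = "int (card (carrier P))"
  have "\<not> q dvd card (carrier P)"
    using card_P fin_P s0 by (metis card_gt_0_iff empty_iff nat_dvd_not_less)
  then have "\<not> [?n = 0] (mod int q)" by (simp add: cong_0_iff)
  then obtain w where w: "[?n * w = 1] (mod int q)" using inverse_mod_q by blast
  define T where "T = (\<Sum>t\<in>carrier P. j' t)"
  define c where "c = T * w"
  have j_c: "[j' s = (1 - i' s) * c] (mod int q)" if s: "s \<in> carrier P" for s
  proof -
    have "bij_betw (\<lambda>t. s \<otimes>\<^bsub>Q\<^esub> t) (carrier P) (carrier P)"
      using group.inj_on_multc[OF grQ, of s] endo_inj_surj[OF fin_P, of "\<lambda>t. s \<otimes>\<^bsub>Q\<^esub> t"] s Q_closed
        group.inj_on_cmult[OF grQ, of s]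
      by (simp only: bij_betw_def Q(1)) blast
    then have "T = (\<Sum>t\<in>carrier P. j' (s \<otimes>\<^bsub>Q\<^esub> t))"
      unfolding T_def by (rule sum.reindex_bij_betw[symmetric])
    also have "[\<dots> = (\<Sum>t\<in>carrier P. i' s * j' t + j' s)] (mod int q)"
      using s by (intro cong_sum hom)
    also have "(\<Sum>t\<in>carrier P. i' s * j' t + j' s) = i' s * T + ?n * j' s"
      by (simp add: T_def sum.distrib sum_distrib_left)
    finally have 1: "[T = i' s * T + ?n * j' s] (mod int q)" .
    have 1: "[?n * j' s = (1 - i' s) * T] (mod int q)"
      using 1 by (simp add: cong_iff_dvd_diff dvd_diff_commute algebra_simps)
    have "[w * (?n * j' s) = j' s * 1] (mod int q)"
      using cong_scalar_left[OF w, of "j' s"] by (simp add: ac_simps)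
    then have "[j' s * 1 = w * ((1 - i' s) * T)] (mod int q)"
      using cong_scalar_left[OF 1] by (rule cong_via)
    then show ?thesis by (simp add: c_def ac_simps)
  qed
  \<comment> \<open>Conjugation by (c, \<one>), which carries the standard complement P to the
    invariant one.\<close>
  define f where "f = (\<lambda>(a, s). ((a + c * (1 - \<chi> s)) mod int q, s :: 'b))"
  have f: "f (a, s) = ((a + c * (1 - \<chi> s)) mod int q, s)" for a s by (simp add: f_def)
  have bij: "bij_betw f (carrier S) (carrier S)"
    using q_gt_1
    by (intro bij_betw_byWitness[where f' = "\<lambda>(a, s). ((a - c * (1 - \<chi> s)) mod int q, s)"])
      (auto simp: f mod_simps)
  have f_cl: "f x \<in> carrier S" if "x \<in> carrier S" for x
    using bij that by (auto simp: bij_betw_def)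
  have "f (x \<otimes>\<^bsub>S\<^esub> y) = f x \<otimes>\<^bsub>S\<^esub> f y" if "x \<in> carrier S" "y \<in> carrier S" for x y
  proof -
    obtain a s b t where xy: "x = (a, s)" "y = (b, t)" by (metis surj_pair)
    have "[a + \<chi> s * b + c * (1 - \<chi> (s \<otimes>\<^bsub>P\<^esub> t)) = a + \<chi> s * b + c * (1 - \<chi> s * \<chi> t)] (mod int q)"
      using that xy by (intro cong_add cong_mult cong_diff cong_refl chi_mult) auto
    moreover have "[(a + c * (1 - \<chi> s)) mod int q + \<chi> s * ((b + c * (1 - \<chi> t)) mod int q)
        = a + c * (1 - \<chi> s) + \<chi> s * (b + c * (1 - \<chi> t))] (mod int q)"
      by (intro cong_add cong_mult cong_refl) simp_all
    moreover have "a + c * (1 - \<chi> s) + \<chi> s * (b + c * (1 - \<chi> t))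
        = a + \<chi> s * b + c * (1 - \<chi> s * \<chi> t)" by (simp add: algebra_simps)
    ultimately show ?thesis
      unfolding xy f mult_char_product by (simp add: cong_def mod_simps)
  qed
  moreover have "f (x \<otimes>\<^bsub>char_product q Q \<psi>\<^esub> y) = f x \<otimes>\<^bsub>M\<^esub> f y" if "x \<in> carrier S" "y \<in> carrier S" for x y
  proof -
    obtain a s b t where xy: "x = (a, s)" "y = (b, t)" by (metis surj_pair)
    have st: "s \<in> carrier P" "t \<in> carrier P" using that xy by auto
    have cx: "((a + c * (1 - \<chi> s)) mod int q, s) \<in> carrier S"
      "((b + c * (1 - \<chi> t)) mod int q, t) \<in> carrier S" using st q_gt_1 by auto
    have l: "[a + \<psi> s * b + c * (1 - \<chi> (s \<otimes>\<^bsub>Q\<^esub> t)) = a + \<psi> s * b + c * (1 - \<chi> s * \<chi> t)] (mod int q)"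
      using st chiQ by (intro cong_add cong_mult cong_diff cong_refl) (auto simp: mod_char_def)
    have r: "[a + c * (1 - \<chi> s) + \<chi> s * (i' s * (b + c * (1 - \<chi> t)) + j' s * (1 - \<chi> t))
      = a + c * (1 - \<chi> s) + \<chi> s * (i' s * (b + c * (1 - \<chi> t)) + ((1 - i' s) * c) * (1 - \<chi> t))] (mod int q)"
      using st by (intro cong_add cong_mult cong_refl j_c)
    have e: "a + c * (1 - \<chi> s) + \<chi> s * (i' s * (b + c * (1 - \<chi> t)) + ((1 - i' s) * c) * (1 - \<chi> t))
      = a + \<psi> s * b + c * (1 - \<chi> s * \<chi> t)" by (simp add: \<psi>_def algebra_simps)
    have "[(a + c * (1 - \<chi> s)) mod int q + \<chi> s * (i' s * ((b + c * (1 - \<chi> t)) mod int q) + j' s * (1 - \<chi> t))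
      = a + c * (1 - \<chi> s) + \<chi> s * (i' s * (b + c * (1 - \<chi> t)) + j' s * (1 - \<chi> t))] (mod int q)"
      by (intro cong_add cong_mult cong_refl) simp_all
    from cong_trans[OF this r] show ?thesis
      using l unfolding xy f mult_char_product M_mult[OF cx] e
      by (simp add: cong_def mod_simps)
  qed
  ultimately have "f \<in> brace_isos (S, char_product q Q \<psi>) (S, M)"
    using bij f_cl carrier_eq q_gt_1
    by (auto simp: brace_isos_def Group.iso_def hom_def carrier_char_product[of q Q] carrier_S)
  then show ?thesis using that sb chiQ psiQ by blast
qed

end

text \<open>
  Isomorphism of the data \<open>(Q, \<psi>)\<close> that describe a brace on \<open>\<int>\<^sub>q \<rtimes>\<^sub>\<chi> P\<close> whose multiplicative group is
  \<open>\<int>\<^sub>q \<rtimes>\<^sub>\<psi> Q\<close>.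
\<close>

definition char_brace_iso ::
  "'b monoid \<Rightarrow> nat \<Rightarrow> ('b \<Rightarrow> int) \<Rightarrow> 'b monoid \<Rightarrow> ('b \<Rightarrow> int) \<Rightarrow> 'b monoid \<Rightarrow> ('b \<Rightarrow> int) \<Rightarrow> ('b \<Rightarrow> 'b) \<Rightarrow> bool"
  where "char_brace_iso P q \<chi> Q \<psi> Q' \<psi>' h \<longleftrightarrow> h \<in> iso P P \<and> h \<in> iso Q Q' \<and>
    (\<forall>t\<in>carrier P. [\<chi> (h t) = \<chi> t] (mod int q) \<and> [\<psi>' (h t) = \<psi> t] (mod int q))"

lemma char_product_iso:
  assumes h: "h \<in> iso R R'" and \<phi>: "\<And>t. t \<in> carrier R \<Longrightarrow> [\<phi>' (h t) = \<phi> t] (mod int q)"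
    and q: "q > 0"
  shows "map_prod id h \<in> iso (char_product q R \<phi>) (char_product q R' \<phi>')"
proof -
  have "(a + \<phi> s * b) mod int q = (a + \<phi>' (h s) * b) mod int q" if "s \<in> carrier R" for a s b
    using cong_add[OF cong_refl cong_scalar_right[OF \<phi>[OF that]], of a b] by (simp add: cong_def)
  then have "map_prod id h \<in> hom (char_product q R \<phi>) (char_product q R' \<phi>')"
    using h q by (auto simp: hom_def Group.iso_def carrier_char_product)
  moreover have "bij_betw (map_prod id h) ({0..<int q} \<times> carrier R) ({0..<int q} \<times> carrier R')"
    using h by (intro bij_betw_map_prod) (auto simp: Group.iso_def)
  ultimately show ?thesis using q by (simp add: Group.iso_def carrier_char_product)
qed

lemma char_brace_iso_trans:
  assumes "carrier Q = carrier P" "char_brace_iso P q \<chi> Q \<psi> Q' \<psi>' f" "char_brace_iso P q \<chi> Q' \<psi>' Q'' \<psi>'' g"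
  shows "char_brace_iso P q \<chi> Q \<psi> Q'' \<psi>'' (g \<circ> f)"
proof -
  have f: "f \<in> iso P P" "f \<in> iso Q Q'" and g: "g \<in> iso P P" "g \<in> iso Q' Q''"
    using assms(2,3) by (auto simp: char_brace_iso_def)
  have cl: "f t \<in> carrier P" if "t \<in> carrier P" for t
    using f that by (auto simp: Group.iso_def hom_def)
  have "[\<chi> (g (f t)) = \<chi> t] (mod int q) \<and> [\<psi>'' (g (f t)) = \<psi> t] (mod int q)" if "t \<in> carrier P" for t
    using assms(2,3) that cl[OF that] unfolding char_brace_iso_def by (meson cong_trans)
  then show ?thesis
    using iso_set_trans[OF f(1) g(1)] iso_set_trans[OF f(2) g(2)] by (simp add: char_brace_iso_def)
qed

section \<open>Braces built from the data (Q, \<psi>) and their isomorphisms\<close>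

context prime_char
begin

lemma chi_nonzero: "s \<in> carrier P \<Longrightarrow> \<not> [\<chi> s = 0] (mod int q)"
proof
  assume s: "s \<in> carrier P" "[\<chi> s = 0] (mod int q)"
  have "[1 = \<chi> s * \<chi> (inv\<^bsub>P\<^esub> s)] (mod int q)"
    using chi_mult[of s "inv\<^bsub>P\<^esub> s"] chi_one s by (simp add: cong_def)
  also have "[\<chi> s * \<chi> (inv\<^bsub>P\<^esub> s) = 0 * \<chi> (inv\<^bsub>P\<^esub> s)] (mod int q)"
    using s by (intro cong_scalar_right)
  finally show False using q_gt_1 by (simp add: cong_def)
qed

text \<open>Compare \<chi> (s \<circ> t) computed with \<chi> as a character of Q and, after writing
  s \<circ> t as s plus the action on t, as a character of P.\<close>

lemma chi_act:
  assumes "skew_brace P Q" "mod_char q Q \<chi>" "s \<in> carrier P" "t \<in> carrier P"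
  shows "[\<chi> (brace_act P Q s t) = \<chi> t] (mod int q)"
proof -
  interpret Q: skew_brace P Q by fact
  have "[\<chi> (s \<otimes>\<^bsub>Q\<^esub> t) = \<chi> s * \<chi> t] (mod int q)"
    using assms by (auto simp: mod_char_def Q.carrier_eq)
  moreover have "[\<chi> (s \<otimes>\<^bsub>Q\<^esub> t) = \<chi> s * \<chi> (brace_act P Q s t)] (mod int q)"
    using Q.mult_eq_act[OF assms(3,4)] chi_mult[OF assms(3) Q.brace_act_closed[OF assms(3,4)]] by simp
  ultimately have "[\<chi> s * \<chi> (brace_act P Q s t) = \<chi> s * \<chi> t] (mod int q)"
    using cong_via by blast
  then show ?thesis using mult_cancel_q chi_nonzero assms by blast
qed

text \<open>Converse of the normal form. The action of (a, s) is b \<mapsto> u s b on Z_q, with u =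
  \<psi> / \<chi>, and the lambda map of Q on P; it is additive because that lambda map preserves
  \<chi>.\<close>

lemma skew_brace_char_product:
  assumes "skew_brace P Q" "mod_char q Q \<chi>" "mod_char q Q \<psi>"
  shows "skew_brace S (char_product q Q \<psi>)"
proof -
  interpret Q: skew_brace P Q by fact
  define u where "u s = \<chi> (inv\<^bsub>P\<^esub> s) * \<psi> s" for s
  define f where "f = (\<lambda>(a :: int, s) (b, t). ((u s * b) mod int q, brace_act P Q s t))"
  have chi_u: "[\<chi> s * (u s * b) = \<psi> s * b] (mod int q)" if "s \<in> carrier P" for s b
  proof -
    have "[\<chi> s * \<chi> (inv\<^bsub>P\<^esub> s) = 1] (mod int q)"
      using chi_mult[of s "inv\<^bsub>P\<^esub> s"] chi_one that by (simp add: cong_def)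
    from cong_scalar_right[OF this, of "\<psi> s * b"] show ?thesis by (simp add: u_def ac_simps)
  qed
  show ?thesis
  proof (rule skew_brace_of_act[of _ _ f])
    show "group S" by (rule S.is_group)
    show "group (char_product q Q \<psi>)"
      using q_gt_1 by (intro group_char_product Q.mult.is_group assms) simp
    show "carrier (char_product q Q \<psi>) = carrier S"
      using q_gt_1 by (simp add: carrier_char_product Q.carrier_eq)
  next
    fix x assume "x \<in> carrier S"
    then obtain a s where x: "x = (a, s)" "s \<in> carrier P" by (auto simp: carrier_S)
    show "f x \<in> hom S S"
    proof (rule homI)
      fix y assume "y \<in> carrier S"
      then show "f x y \<in> carrier S"
        using x q_gt_1 by (auto simp: f_def carrier_S Q.brace_act_closed)
    next
      fix y z assume yz: "y \<in> carrier S" "z \<in> carrier S"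
      then obtain b t c r where *: "y = (b, t)" "z = (c, r)" "t \<in> carrier P" "r \<in> carrier P"
        by (auto simp: carrier_S)
      have "[u s * b + \<chi> (brace_act P Q s t) * (u s * c) = u s * b + \<chi> t * (u s * c)] (mod int q)"
        by (intro cong_add cong_mult cong_refl chi_act assms x *)
      moreover have "u s * b + \<chi> t * (u s * c) = u s * (b + \<chi> t * c)" by (simp add: algebra_simps)
      ultimately show "f x (y \<otimes>\<^bsub>S\<^esub> z) = f x y \<otimes>\<^bsub>S\<^esub> f x z"
        using x * by (simp add: f_def Q.brace_act_add cong_def mod_simps mod_add_mult_mod)
    qed
  next
    fix x y assume "x \<in> carrier S" "y \<in> carrier S"
    then obtain a s b t where *: "x = (a, s)" "y = (b, t)" "s \<in> carrier P" "t \<in> carrier P"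
      by (auto simp: carrier_S)
    have "[a + \<chi> s * (u s * b) = a + \<psi> s * b] (mod int q)"
      by (intro cong_add cong_refl chi_u *)
    then show "x \<otimes>\<^bsub>char_product q Q \<psi>\<^esub> y = x \<otimes>\<^bsub>S\<^esub> f x y"
      using * by (simp add: f_def Q.mult_eq_act cong_def mod_add_mult_mod)
  qed
qed

lemma left_trivial_char_product:
  assumes "skew_brace P Q" "mod_char q Q \<psi>"
  shows "left_trivial q (S, char_product q Q \<psi>)"
  unfolding left_trivial_def fst_conv snd_conv
proof (intro ballI impI)
  interpret Q: skew_brace P Q by fact
  fix n b assume *: "n \<in> carrier S" "n [^]\<^bsub>S\<^esub> q = \<one>\<^bsub>S\<^esub>" "b \<in> carrier S"
  then obtain a c t where n: "n = (a, \<one>\<^bsub>P\<^esub>)" "b = (c, t)" using q_torsion by (metis prod.collapse)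
  have "[a + \<psi> \<one>\<^bsub>P\<^esub> * c = a + \<chi> \<one>\<^bsub>P\<^esub> * c] (mod int q)"
    using assms(2) chi_one Q.one_eq
    by (intro cong_add cong_mult cong_refl) (simp add: mod_char_def cong_def)
  moreover have "\<one>\<^bsub>P\<^esub> \<otimes>\<^bsub>Q\<^esub> t = t"
    using * n Q.mult.l_one[of t] Q.carrier_eq Q.one_eq by (simp add: carrier_S)
  ultimately show "n \<otimes>\<^bsub>char_product q Q \<psi>\<^esub> b = n \<otimes>\<^bsub>S\<^esub> b"
    using * n by (simp add: cong_def carrier_S)
qed

text \<open>Left triviality for both orders of addition would make (1, \<one>) commute with (0, s0)
  in \<open>S\<close>, against \<chi> s0 \<noteq> 1. This separates the models on \<open>S\<close>
  from those on \<open>opposite S\<close>.\<close>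

lemma not_left_trivial_opposite:
  assumes "skew_brace P Q" "mod_char q Q \<psi>"
  shows "\<not> left_trivial q (opposite S, char_product q Q \<psi>)"
proof
  let ?n = "(1, \<one>\<^bsub>P\<^esub>)" and ?b = "(0, s0)"
  assume l: "left_trivial q (opposite S, char_product q Q \<psi>)"
  have c: "?n \<in> carrier S" "?b \<in> carrier S" using q_gt_1 s0 by (auto simp: carrier_S)
  have pow: "?n [^]\<^bsub>S\<^esub> q = \<one>\<^bsub>S\<^esub>" using q_torsion[OF c(1)] by simp
  then have "?n [^]\<^bsub>opposite S\<^esub> q = \<one>\<^bsub>opposite S\<^esub>"
    using nat_pow_opposite[OF S.is_group c(1), of q] by simp
  then have "?n \<otimes>\<^bsub>char_product q Q \<psi>\<^esub> ?b = ?b \<otimes>\<^bsub>S\<^esub> ?n"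
    using l c by (simp add: left_trivial_def del: mult_char_product)
  moreover have "?n \<otimes>\<^bsub>char_product q Q \<psi>\<^esub> ?b = ?n \<otimes>\<^bsub>S\<^esub> ?b"
    using left_trivial_char_product[OF assms] c pow
    by (simp add: left_trivial_def del: mult_char_product)
  ultimately show False using q_gt_1 chi_s0 by (simp add: cong_def)
qed

lemma brace_isos_of_char_brace_iso:
  assumes "skew_brace P Q" "skew_brace P Q'" "char_brace_iso P q \<chi> Q \<psi> Q' \<psi>' h"
  shows "map_prod id h \<in> brace_isos (S, char_product q Q \<psi>) (S, char_product q Q' \<psi>')"
proof -
  interpret Q: skew_brace P Q by fact
  interpret Q': skew_brace P Q' by fact
  have h: "h \<in> iso P P" "h \<in> iso Q Q'"
    "t \<in> carrier P \<Longrightarrow> [\<chi> (h t) = \<chi> t] (mod int q)" "t \<in> carrier P \<Longrightarrow> [\<psi>' (h t) = \<psi> t] (mod int q)" for t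
    using assms(3) by (auto simp: char_brace_iso_def)
  show ?thesis using h char_product_iso[of h P P \<chi> \<chi> q] char_product_iso[of h Q Q' \<psi>' \<psi> q] q_gt_1
    by (simp add: brace_isos_def Q.carrier_eq)
qed

text \<open>The P-part h of F is the required map. The image of (0, t) \<circ> (1, \<one>) compares
  i \<psi>' (h t) with i \<psi> t, since the inner part j occurs on both sides and cancels.\<close>

lemma char_brace_iso_of_brace_isos:
  assumes "skew_brace P Q" "skew_brace P Q'" "mod_char q Q' \<psi>'"
    and F: "F \<in> brace_isos (S, char_product q Q \<psi>) (S, char_product q Q' \<psi>')"
  obtains h where "char_brace_iso P q \<chi> Q \<psi> Q' \<psi>' h"
proof -
  interpret Q: skew_brace P Q by fact
  interpret Q': skew_brace P Q' by fact
  have F1: "F \<in> iso S S" using F by (simp add: brace_isos_def)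
  then obtain i j h where f: "aut_form F i j h" by (rule automorphism_form)
  note D = aut_formD[OF f]
  have cS: "(a, t) \<in> carrier S" if "0 \<le> a" "a < int q" "t \<in> carrier P" for a t
    using that by (simp add: carrier_S)
  have hom: "F (x \<otimes>\<^bsub>char_product q Q \<psi>\<^esub> y) = F x \<otimes>\<^bsub>char_product q Q' \<psi>'\<^esub> F y"
    if "x \<in> carrier S" "y \<in> carrier S" for x y
    using F that q_gt_1
    by (auto simp: brace_isos_def Group.iso_def hom_def carrier_S carrier_char_product[of q Q] Q.carrier_eq)
  have "h (s \<otimes>\<^bsub>Q\<^esub> t) = h s \<otimes>\<^bsub>Q'\<^esub> h t" if st: "s \<in> carrier P" "t \<in> carrier P" for s t
    using hom[OF cS cS, of 0 s 0 t] st q_gt_1 Q.mult_closed[OF st] by (simp add: D(4))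
  then have hQ: "h \<in> iso Q Q'"
    using D(1) by (auto simp: Group.iso_def hom_def Q.carrier_eq Q'.carrier_eq)
  have psi: "[\<psi>' (h t) = \<psi> t] (mod int q)" if t: "t \<in> carrier P" for t
  proof -
    have one: "t \<otimes>\<^bsub>Q\<^esub> \<one>\<^bsub>P\<^esub> = t" using Q.mult.r_one[of t] t Q.carrier_eq Q.one_eq by simp
    have e: "(j * (1 - \<chi> t) + \<psi>' (h t) * i) mod int q = (i * \<psi> t + j * (1 - \<chi> t)) mod int q"
    proof -
      have "[i + j * (1 - \<chi> \<one>\<^bsub>P\<^esub>) = i + j * (1 - 1)] (mod int q)"
        by (intro cong_add cong_mult cong_diff cong_refl chi_one)
      then have "F (1, \<one>\<^bsub>P\<^esub>) = (i mod int q, \<one>\<^bsub>P\<^esub>)"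
        using D(4)[of 1 "\<one>\<^bsub>P\<^esub>"] D(7) q_gt_1 by (simp add: cong_def)
      moreover have "F (\<psi> t mod int q, t) = ((i * \<psi> t + j * (1 - \<chi> t)) mod int q, h t)"
        using D(4)[of "\<psi> t mod int q" t] t q_gt_1 by (simp add: mod_add_mult_mod)
      moreover have "F (0, t) = ((j * (1 - \<chi> t)) mod int q, h t)"
        using D(4)[of 0 t] t q_gt_1 by simp
      ultimately show ?thesis
        using hom[OF cS cS, of 0 t 1 "\<one>\<^bsub>P\<^esub>"] t q_gt_1
        by (simp add: one mod_simps mod_add_mult_mod)
    qed
    then have "[i * \<psi>' (h t) = i * \<psi> t] (mod int q)"
      unfolding cong_def[symmetric] by (simp add: cong_iff_dvd_diff algebra_simps)
    then show ?thesis using mult_cancel_q D(2) by blast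
  qed
  show ?thesis using D(1,3) hQ psi by (intro that[of h]) (simp add: char_brace_iso_def)
qed

lemma brace_normal_form:
  fixes A M :: "'c monoid"
  assumes A: "skew_brace A M" "A \<cong> S"
  obtains (left) Q \<psi> where "skew_brace P Q" "mod_char q Q \<chi>" "mod_char q Q \<psi>"
      "brace_isos (S, char_product q Q \<psi>) (A, M) \<noteq> {}"
    | (right) Q \<psi> where "skew_brace P Q" "mod_char q Q \<chi>" "mod_char q Q \<psi>"
      "brace_isos (opposite S, char_product q Q \<psi>) (A, M) \<noteq> {}"
proof -
  have forms: "\<exists>i j g. char_product_brace P q \<chi> s0 M i j g" if M: "skew_brace S M" for M
  proof -
    interpret B: skew_brace S M by fact
    have "\<forall>x. \<exists>i j g. x \<in> carrier S \<longrightarrow> aut_form (brace_act S M x) i j g"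
      using automorphism_form B.brace_act_iso by metis
    then obtain i j g where "\<And>x. x \<in> carrier S \<Longrightarrow> aut_form (brace_act S M x) (i x) (j x) (g x)"
      by metis
    then have "char_product_brace P q \<chi> s0 M i j g" by unfold_locales
    then show ?thesis by blast
  qed
  have nf: "\<exists>Q \<psi> f. skew_brace P Q \<and> mod_char q Q \<chi> \<and> mod_char q Q \<psi> \<and>
    f \<in> brace_isos (S, char_product q Q \<psi>) (S, M)"
    if "skew_brace S M" "left_trivial q (S, M)" for M
    using forms[OF that(1)] char_product_brace.left_trivial_normal_form[OF _ that(2)] by metis
  have cases: "left_trivial q (S, M) \<or> left_trivial q (opposite S, M)" if "skew_brace S M" for M
    using forms[OF that] by (elim exE) (rule char_product_brace.left_trivial_cases)
  have "group A" using A(1) by (simp add: skew_brace_def)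
  then have "S \<cong> A" using A(2) by (rule group.iso_sym)
  then obtain f where "f \<in> iso S A" by (auto simp: is_iso_def)
  then obtain M' where M': "skew_brace S M'" "f \<in> brace_isos (S, M') (A, M)"
    using A(1) S.is_group by (metis skew_brace_pullback)
  from cases[OF M'(1)] show ?thesis
  proof
    assume "left_trivial q (S, M')"
    then show ?thesis using nf[OF M'(1)] M'(2) left brace_isos_trans by (metis empty_iff)
  next
    assume l: "left_trivial q (opposite S, M')"
    have op: "skew_brace (opposite S) M'" by (rule skew_brace_opposite[OF M'(1)])
    \<comment> \<open>The normal form is available on \<open>S\<close> only, so the opposite brace
      is first moved to \<open>S\<close>; taking opposites once more at the end restores the
      original order of addition.\<close>
    have "S \<cong> opposite S"
      by (rule group.iso_sym[OF group_opposite[OF S.is_group] opposite_is_iso[OF S.is_group]])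
    then obtain e where "e \<in> iso S (opposite S)" by (auto simp: is_iso_def)
    then obtain M'' where M'': "skew_brace S M''" "e \<in> brace_isos (S, M'') (opposite S, M')"
      using op S.is_group by (metis skew_brace_pullback)
    obtain Q \<psi> k where Q: "skew_brace P Q" "mod_char q Q \<chi>" "mod_char q Q \<psi>"
      "k \<in> brace_isos (S, char_product q Q \<psi>) (S, M'')"
      using nf[OF M''(1) left_trivial_iso[OF M''(1) op M''(2) l]] by blast
    have "e \<circ> k \<in> brace_isos (opposite (opposite S), char_product q Q \<psi>) (opposite S, M')"
      using brace_isos_trans[OF Q(4) M''(2)] by simp
    then have "e \<circ> k \<in> brace_isos (opposite S, char_product q Q \<psi>) (S, M')"
      unfolding brace_isos_opposite .
    then show ?thesis using right Q(1-3) brace_isos_trans[OF _ M'(2)] by blast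
  qed
qed

text \<open>The models are indexed by a Boolean, which chooses \<open>S\<close> or its opposite, and
  an element of D. What remains for a concrete P is a system of representatives for the
  data.\<close>

theorem num_skew_braces_char_product:
  fixes Q :: "'d \<Rightarrow> 'b monoid" and \<psi> :: "'d \<Rightarrow> 'b \<Rightarrow> int"
  assumes G: "S \<cong> G"
    and data: "\<And>d. d \<in> D \<Longrightarrow> skew_brace P (Q d) \<and> mod_char q (Q d) \<chi> \<and> mod_char q (Q d) (\<psi> d)"
    and complete: "\<And>Q' \<psi>'. skew_brace P Q' \<Longrightarrow> mod_char q Q' \<chi> \<Longrightarrow> mod_char q Q' \<psi>' \<Longrightarrow>
      \<exists>d\<in>D. \<exists>h. char_brace_iso P q \<chi> (Q d) (\<psi> d) Q' \<psi>' h"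
    and distinct: "\<And>d d' h. d \<in> D \<Longrightarrow> d' \<in> D \<Longrightarrow>
      char_brace_iso P q \<chi> (Q d) (\<psi> d) (Q d') (\<psi> d') h \<Longrightarrow> d = d'"
  shows "num_skew_braces G H = 2 * card {d \<in> D. char_product q (Q d) (\<psi> d) \<cong> H}"
proof -
  define M where "M d = char_product q (Q d) (\<psi> d)" for d
  define A where "A b = (if b then S else opposite S)" for b
  define model where "model = (\<lambda>(b, d). (A b, M d))"
  have sbM: "skew_brace (A b) (M d)" if "d \<in> D" for b d
    using that data skew_brace_char_product[of "Q d" "\<psi> d"] skew_brace_opposite[of S "M d"]
    by (auto simp: A_def M_def)
  have eqD: "d = d'" if "d \<in> D" "d' \<in> D" "brace_isos (S, M d) (S, M d') \<noteq> {}" for d d'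
    using that data[of d] data[of d'] distinct[of d d'] char_brace_iso_of_brace_isos[of "Q d" "Q d'" "\<psi> d'"]
    unfolding M_def by (metis ex_in_conv)
  have LR: "brace_isos (opposite S, M d) (S, M d') = {}" if "d \<in> D" "d' \<in> D" for d d'
    using left_trivial_iso[OF sbM[of d False] sbM[of d' True]] that
      left_trivial_char_product[of "Q d'" "\<psi> d'"] not_left_trivial_opposite[of "Q d" "\<psi> d"] data
    unfolding A_def M_def by (simp split: if_splits) blast
  have RL: "brace_isos (S, M d) (opposite S, M d') = {}" if "d \<in> D" "d' \<in> D" for d d'
    using brace_isos_sym[OF sbM[of d True] sbM[of d' False]] that LR[of d' d]
    unfolding A_def by auto
  have "num_skew_braces G H = card {bd \<in> UNIV \<times> D. snd (model bd) \<cong> H}"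
  proof (rule num_skew_braces_eq_card_models)
    show "finite (carrier G)" using fin_S iso_finite[OF G] by simp
  next
    fix bd :: "bool \<times> 'd" assume "bd \<in> UNIV \<times> D"
    moreover have "opposite S \<cong> G" using opposite_is_iso[OF S.is_group] G by (rule iso_trans)
    ultimately show "skew_brace (fst (model bd)) (snd (model bd)) \<and> fst (model bd) \<cong> G"
      using sbM G by (auto simp: model_def A_def)
  next
    fix A' M' :: "nat monoid" assume "skew_brace A' M'" "A' \<cong> G"
    moreover have "A' \<cong> S" using \<open>A' \<cong> G\<close> S.iso_sym[OF G] by (rule iso_trans)
    ultimately obtain b Q' \<psi>' where Q': "skew_brace P Q'" "mod_char q Q' \<chi>" "mod_char q Q' \<psi>'"
      "brace_isos (A b, char_product q Q' \<psi>') (A', M') \<noteq> {}"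
      by (metis brace_normal_form A_def)
    obtain d h where d: "d \<in> D" "char_brace_iso P q \<chi> (Q d) (\<psi> d) Q' \<psi>' h"
      using complete[OF Q'(1-3)] by blast
    then have "map_prod id h \<in> brace_isos (S, M d) (S, char_product q Q' \<psi>')"
      unfolding M_def using data Q'(1) by (intro brace_isos_of_char_brace_iso) auto
    then have "map_prod id h \<in> brace_isos (A b, M d) (A b, char_product q Q' \<psi>')"
      by (simp add: A_def brace_isos_opposite)
    then have "brace_isos (model (b, d)) (A', M') \<noteq> {}"
      using Q'(4) brace_isos_trans by (fastforce simp: model_def)
    then show "\<exists>bd\<in>UNIV \<times> D. brace_isos (model bd) (A', M') \<noteq> {}" using d(1) by blast
  next
    fix x y :: "bool \<times> 'd" assume xy: "x \<in> UNIV \<times> D" "y \<in> UNIV \<times> D" "brace_isos (model x) (model y) \<noteq> {}"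
    obtain b d b' d' where *: "x = (b, d)" "y = (b', d')" "d \<in> D" "d' \<in> D" using xy by auto
    have i: "brace_isos (A b, M d) (A b', M d') \<noteq> {}" using xy(3) * by (simp add: model_def)
    have "b = b'" using i LR RL *(3,4) by (auto simp: A_def split: if_splits)
    moreover from this i have "brace_isos (S, M d) (S, M d') \<noteq> {}"
      by (auto simp: A_def brace_isos_opposite split: if_splits)
    ultimately show "x = y" using eqD * by auto
  qed
  also have "{bd \<in> UNIV \<times> D. snd (model bd) \<cong> H} = (UNIV :: bool set) \<times> {d \<in> D. M d \<cong> H}"
    by (auto simp: model_def)
  also have "card \<dots> = 2 * card {d \<in> D. M d \<cong> H}"
    by (simp add: card_cartesian_product)
  finally show ?thesis by (simp add: M_def)
qed

end

subsection \<open>Powers of an element of given order modulo a prime\<close>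

locale prime_power_root =
  fixes q n h :: nat
  assumes prime_q: "Factorial_Ring.prime q" and n_pos: "n > 0" and ord_h: "ord q h = n"
begin

text \<open>Reducing the exponent modulo the order n of h gives a meaning to negative
  exponents.\<close>

definition hpow :: "int \<Rightarrow> int" where "hpow e = int h ^ nat (e mod int n)"

lemma q_gt_1: "1 < q" using prime_q by (rule prime_gt_1_nat)

lemma coprime_h: "coprime q h" using ord_eq_0[of q h] ord_h n_pos by simp

lemma pow_cong_iff: "[int h ^ a = int h ^ b] (mod int q) \<longleftrightarrow> [a = b] (mod n)"
  using order_divides_expdiff[OF coprime_h, of a b] cong_int_iff[of "h ^ a" "h ^ b" q] ord_h by simp

lemma hpow_of_nat: "[hpow (int a) = int h ^ a] (mod int q)"
  unfolding hpow_def pow_cong_iff by (simp add: nat_mod_as_int cong_def)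

lemma hpow_cong_iff: "[hpow a = hpow b] (mod int q) \<longleftrightarrow> [a = b] (mod int n)"
proof -
  have "[nat (a mod int n) = nat (b mod int n)] (mod n) \<longleftrightarrow> [a = b] (mod int n)"
    using n_pos by (simp add: cong_def nat_eq_iff nat_mod_as_int)
  then show ?thesis unfolding hpow_def pow_cong_iff .
qed

lemma hpow_0 [simp]: "hpow 0 = 1" by (simp add: hpow_def)

lemma hpow_add: "[hpow (a + b) = hpow a * hpow b] (mod int q)"
proof -
  have "[nat ((a + b) mod int n) = nat (a mod int n) + nat (b mod int n)] (mod n)"
    using n_pos by (simp add: cong_def nat_mod_as_int mod_simps)
  then show ?thesis unfolding hpow_def power_add[symmetric] pow_cong_iff .
qed

lemma hpow_cong_add: "[c = a + b] (mod int n) \<Longrightarrow> [hpow c = hpow a * hpow b] (mod int q)"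
  using hpow_cong_iff hpow_add cong_trans by blast

lemma hpow_power: "[hpow a ^ k = hpow (a * int k)] (mod int q)"
proof (induction k)
  case (Suc k)
  have "[hpow a ^ k * hpow a = hpow (a * int k) * hpow a] (mod int q)"
    by (intro cong_scalar_right Suc)
  also have "[hpow (a * int k) * hpow a = hpow (a * int k + a)] (mod int q)"
    by (rule cong_sym[OF hpow_add])
  finally show ?case by (simp add: algebra_simps)
qed simp

text \<open>Modulo the prime q the equation y^n = 1 has at most n solutions, and the n distinct
  powers of h already fill this bound.\<close>

lemma root_of_unity_eq_hpow:
  assumes "[x ^ n = 1] (mod int q)"
  obtains k where "0 \<le> k" "k < int n" "[x = hpow k] (mod int q)"
proof -
  let ?A = "{y \<in> {..<q}. [y ^ n = 1] (mod q)}" and ?B = "(\<lambda>k. h ^ k mod q) ` {..<n}"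
  have fin: "finite ?A" by simp
  have "card ?A \<le> n" using roots_mod_prime_bound[OF prime_q n_pos] .
  moreover have "?B \<subseteq> ?A"
  proof
    fix y assume "y \<in> ?B"
    then obtain k where y: "y = h ^ k mod q" by auto
    have "[y ^ n = (h ^ k) ^ n] (mod q)" unfolding y by (intro cong_pow) simp
    also have "(h ^ k) ^ n = (h ^ n) ^ k" by (simp add: power_mult[symmetric] mult.commute)
    also have "[(h ^ n) ^ k = 1 ^ k] (mod q)" using ord[of h q] ord_h by (intro cong_pow) simp
    finally show "y \<in> ?A" using q_gt_1 y by simp
  qed
  moreover have "card ?B = n"
  proof -
    have "inj_on (\<lambda>k. h ^ k mod q) {..<n}"
      using order_divides_expdiff[OF coprime_h] ord_h by (auto simp: inj_on_def cong_def)
    then show ?thesis by (simp add: card_image)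
  qed
  ultimately have AB: "?B = ?A" by (intro card_seteq fin) simp_all
  define y where "y = nat (x mod int q)"
  have y: "int y = x mod int q" "y < q" using q_gt_1 by (simp_all add: y_def nat_less_iff)
  have "[int y ^ n = x ^ n] (mod int q)" unfolding y by (intro cong_pow) simp
  with assms have "[int y ^ n = 1] (mod int q)" using cong_trans by blast
  then have "[y ^ n = 1] (mod q)" using cong_int_iff[of "y ^ n" 1 q] by simp
  then have "y \<in> ?B" using AB y(2) by simp
  then obtain k where k: "k < n" "y = h ^ k mod q" by auto
  then have "x mod int q = int (h ^ k mod q)" using y by simp
  then have "[x = int h ^ k] (mod int q)" by (simp add: cong_def zmod_int)
  moreover have "[hpow (int k) = int h ^ k] (mod int q)" by (rule hpow_of_nat)
  ultimately have "[x = hpow (int k)] (mod int q)" using cong_sym cong_trans by blast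
  then show ?thesis using that[of "int k"] k(1) by simp
qed

end

lemma mod_char_nat_pow:
  assumes "group G" "mod_char q G \<psi>" "x \<in> carrier G"
  shows "[\<psi> (x [^]\<^bsub>G\<^esub> (k::nat)) = \<psi> x ^ k] (mod int q)"
proof (induction k)
  case 0
  then show ?case using assms by (simp add: mod_char_def)
next
  case (Suc k)
  interpret group G by fact
  have "[\<psi> (x [^]\<^bsub>G\<^esub> k \<otimes>\<^bsub>G\<^esub> x) = \<psi> (x [^]\<^bsub>G\<^esub> k) * \<psi> x] (mod int q)"
    using assms by (simp add: mod_char_def)
  also have "[\<psi> (x [^]\<^bsub>G\<^esub> k) * \<psi> x = \<psi> x ^ k * \<psi> x] (mod int q)"
    by (intro cong_scalar_right Suc)
  finally show ?case by (simp add: mult.commute)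
qed

subsection \<open>Isomorphism invariants of groups\<close>

text \<open>These three invariants separate the five groups of the theorem: commutativity, whether
  the p-part is elementary abelian (exponent p q), and whether Z_{p^2} acts faithfully (trivial
  centre).\<close>

definition commuting :: "'a monoid \<Rightarrow> bool" where
  "commuting G \<longleftrightarrow> (\<forall>x\<in>carrier G. \<forall>y\<in>carrier G. x \<otimes>\<^bsub>G\<^esub> y = y \<otimes>\<^bsub>G\<^esub> x)"

definition exponent_dvd :: "nat \<Rightarrow> 'a monoid \<Rightarrow> bool" where
  "exponent_dvd n G \<longleftrightarrow> (\<forall>x\<in>carrier G. x [^]\<^bsub>G\<^esub> n = \<one>\<^bsub>G\<^esub>)"

definition trivial_center :: "'a monoid \<Rightarrow> bool" where
  "trivial_center G \<longleftrightarrow> (\<forall>z\<in>carrier G.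
    (\<forall>x\<in>carrier G. z \<otimes>\<^bsub>G\<^esub> x = x \<otimes>\<^bsub>G\<^esub> z) \<longrightarrow> z = \<one>\<^bsub>G\<^esub>)"

lemma iso_invariants:
  assumes "group G" "group H" "G \<cong> H"
  shows "commuting G \<longleftrightarrow> commuting H" "exponent_dvd n G \<longleftrightarrow> exponent_dvd n H"
    "trivial_center G \<longleftrightarrow> trivial_center H"
proof -
  have imp: "(commuting G \<longrightarrow> commuting H) \<and> (exponent_dvd n G \<longrightarrow> exponent_dvd n H) \<and>
      (trivial_center G \<longrightarrow> trivial_center H)"
    if gr: "group G" "group H" "G \<cong> H" for G :: "'x monoid" and H :: "'y monoid"
  proof -
    obtain f where f: "f \<in> iso G H" using gr(3) by (auto simp: is_iso_def)
    then have hom: "f \<in> hom G H" and img: "carrier H = f ` carrier G" and inj: "inj_on f (carrier G)"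
      by (auto simp: Group.iso_def bij_betw_def)
    have m: "f (x \<otimes>\<^bsub>G\<^esub> y) = f x \<otimes>\<^bsub>H\<^esub> f y" if "x \<in> carrier G" "y \<in> carrier G" for x y
      using hom that by (simp add: hom_def)
    have c: "x \<otimes>\<^bsub>G\<^esub> y \<in> carrier G" if "x \<in> carrier G" "y \<in> carrier G" for x y
      using gr(1) that by (simp add: group.is_monoid monoid.m_closed)
    have "f \<one>\<^bsub>G\<^esub> = \<one>\<^bsub>H\<^esub>" by (rule hom_one[OF hom gr(1,2)])
    moreover have "f x [^]\<^bsub>H\<^esub> n = f (x [^]\<^bsub>G\<^esub> n)" if "x \<in> carrier G" for x
      using hom_nat_pow[OF hom that gr(1,2)] by simp
    moreover have "commuting G \<longrightarrow> commuting H"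
      unfolding commuting_def img by (metis m imageE)
    moreover have "trivial_center H" if "trivial_center G"
      unfolding trivial_center_def
    proof (intro ballI impI)
      fix z assume z: "z \<in> carrier H" "\<forall>x\<in>carrier H. z \<otimes>\<^bsub>H\<^esub> x = x \<otimes>\<^bsub>H\<^esub> z"
      then obtain y where y: "y \<in> carrier G" "z = f y" using img by auto
      have "y \<otimes>\<^bsub>G\<^esub> x = x \<otimes>\<^bsub>G\<^esub> y" if x: "x \<in> carrier G" for x
      proof (rule inj_onD[OF inj _ c c])
        have "f x \<in> carrier H" using x img by auto
        then show "f (y \<otimes>\<^bsub>G\<^esub> x) = f (x \<otimes>\<^bsub>G\<^esub> y)" using x y z(2) m by simp
      qed (use x y in auto)
      then have "y = \<one>\<^bsub>G\<^esub>" using that y(1) by (simp add: trivial_center_def)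
      then show "z = \<one>\<^bsub>H\<^esub>" using y hom_one[OF hom gr(1,2)] by simp
    qed
    ultimately show ?thesis unfolding exponent_dvd_def img by auto
  qed
  have "H \<cong> G" using assms by (simp add: group.iso_sym)
  then show "commuting G \<longleftrightarrow> commuting H" "exponent_dvd n G \<longleftrightarrow> exponent_dvd n H"
    "trivial_center G \<longleftrightarrow> trivial_center H"
    using imp[OF assms] imp[of H G] assms by auto
qed

lemma exponent_dvd_of_order:
  assumes "group G" "order G dvd n" shows "exponent_dvd n G"
proof -
  interpret group G by fact
  obtain k where "n = order G * k" using assms(2) by auto
  then show ?thesis by (simp add: exponent_dvd_def pow_order_eq_1 nat_pow_pow[symmetric])
qed

lemma nat_pow_DirProd: "(x, y) [^]\<^bsub>G \<times>\<times> H\<^esub> (k::nat) = (x [^]\<^bsub>G\<^esub> k, y [^]\<^bsub>H\<^esub> k)"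
  by (induction k) (simp_all add: nat_pow_def)

lemma exponent_dvd_DirProd:
  "exponent_dvd n G \<Longrightarrow> exponent_dvd n H \<Longrightarrow> exponent_dvd n (G \<times>\<times> H)"
  by (auto simp: exponent_dvd_def nat_pow_DirProd)

lemma nat_pow_fst_zero:
  "(0, s) [^]\<^bsub>char_product q P \<chi>\<^esub> (k::nat) = (0, s [^]\<^bsub>P\<^esub> k)"
  by (induction k) simp_all

subsection \<open>Cyclic complement\<close>

text \<open>The binomial coefficient "s choose 2". Its deviation from additivity is s t, so
  subtracting a multiple of it linearizes both families of groups Q.\<close>

definition triangle :: "int \<Rightarrow> int" where "triangle s = s * (s - 1) div 2"

lemma two_triangle: "2 * triangle s = s * (s - 1)"
  by (simp add: triangle_def)

lemma triangle_add: "triangle (s + t) = triangle s + triangle t + s * t"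
proof -
  have "2 * triangle (s + t) = 2 * (triangle s + triangle t + s * t)"
    unfolding distrib_left two_triangle by (simp add: algebra_simps)
  then show ?thesis by simp
qed

lemma triangle_simps [simp]: "triangle 0 = 0" "triangle 1 = 0"
  by (simp_all add: triangle_def)

text \<open>For odd p the factor 2 can be cancelled. For p = 2 the parity of
  \<open>triangle s\<close> depends on s modulo 4.\<close>

lemma triangle_cong:
  assumes "Factorial_Ring.prime (p::nat)" "p > 2" "[s = t] (mod int p)"
  shows "[triangle s = triangle t] (mod int p)"
proof -
  have "coprime 2 p" using assms by (metis primes_coprime two_is_prime_nat less_irrefl)
  then have c: "coprime (int p) 2" by (metis coprime_commute coprime_int_iff of_nat_numeral)
  have "int p dvd (s - t) * (s + t - 1)" using assms(3) by (simp add: cong_iff_dvd_diff)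
  also have "(s - t) * (s + t - 1) = 2 * (triangle s - triangle t)"
    unfolding right_diff_distrib two_triangle by (simp add: algebra_simps)
  finally show ?thesis using coprime_dvd_mult_right_iff[OF c] cong_iff_dvd_diff by blast
qed

locale cyclic_complement =
  fixes p q n h :: nat
  assumes prime_p: "Factorial_Ring.prime p" and p_gt_2: "p > 2" and n: "n = p * p" and n_less_q: "n < q"
    and prime_q': "Factorial_Ring.prime q" and ord_h': "ord q h = n"
begin

sublocale prime_power_root q n h
  using prime_q' ord_h' n p_gt_2 by unfold_locales auto

abbreviation Z where "Z \<equiv> integer_mod_group n"

lemma int_n: "int n = int p * int p" by (simp add: n)

lemma carrier_Z: "carrier Z = {0..<int n}" using n_pos by (simp add: carrier_integer_mod_group)

lemma n_gt_1: "1 < int n"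
  using p_gt_2 less_1_mult[of "int p" "int p"] by (simp add: int_n)

lemma p_cong_iff: "[int p * a = int p * b] (mod int n) \<longleftrightarrow> [a = b] (mod int p)"
  using p_gt_2 by (simp add: cong_iff_dvd_diff int_n flip: right_diff_distrib)

lemma cong_p: "[a = b] (mod int n) \<Longrightarrow> [a = b] (mod int p)"
  using int_n by (metis cong_modulus_mult)

definition circle :: "int \<Rightarrow> int monoid" where
  "circle m = \<lparr>carrier = {0..<int n},
    monoid.mult = (\<lambda>s t. (s + t + int p * m * s * t) mod int n), one = 0\<rparr>"

lemma circle_simps [simp]: "carrier (circle m) = carrier Z"
  "s \<otimes>\<^bsub>circle m\<^esub> t = (s + t + int p * m * s * t) mod int n" "\<one>\<^bsub>circle m\<^esub> = 0"
  by (simp_all add: circle_def carrier_Z)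

text \<open>
  The logarithm to the base 1 in \<open>circle m\<close>: the \<open>k\<close>-th power of 1 is
  \<open>((1 + pm)\<^sup>k - 1) / (pm) = k + pm k(k - 1)/2\<close> modulo \<open>p\<^sup>2\<close>.
\<close>

definition circle_log :: "int \<Rightarrow> int \<Rightarrow> int" where
  "circle_log m s = s - int p * (m * triangle s)"

lemma circle_log_simps [simp]: "circle_log m 0 = 0" "circle_log m 1 = 1"
  by (simp_all add: circle_log_def)

text \<open>The triangle term carries a factor p, so its argument matters only modulo p, where it is
  s + t. By \<open>triangle_add\<close> it then contributes -p m s t, which cancels the
  twist.\<close>

lemma circle_log_add:
  "[circle_log m (s + t + int p * m * s * t) = circle_log m s + circle_log m t] (mod int n)"
proof -
  let ?u = "s + t + int p * m * s * t"
  have "[?u = s + t] (mod int p)" by (simp add: cong_iff_dvd_diff)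
  then have "[m * triangle ?u = m * triangle (s + t)] (mod int p)"
    by (intro cong_scalar_left triangle_cong prime_p p_gt_2)
  then have "[?u - int p * (m * triangle ?u) = ?u - int p * (m * triangle (s + t))] (mod int n)"
    using p_cong_iff by (intro cong_diff cong_refl) blast
  moreover have "?u - int p * (m * triangle (s + t)) = circle_log m s + circle_log m t"
    by (simp add: circle_log_def triangle_add algebra_simps)
  ultimately show ?thesis by (simp add: circle_log_def)
qed

text \<open>Modulo p the logarithm is the identity. So equal logarithms give s = t modulo p first,
  and then the corrections with factor p agree modulo p^2.\<close>

lemma circle_log_cong_iff:
  "[circle_log m s = circle_log m t] (mod int n) \<longleftrightarrow> [s = t] (mod int n)"
proof -
  have aux: "[int p * (m * triangle s) = int p * (m * triangle t)] (mod int n)"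
    if "[s = t] (mod int p)" for s t
    using that triangle_cong[OF prime_p p_gt_2] p_cong_iff cong_scalar_left by blast
  show ?thesis
  proof
    assume "[s = t] (mod int n)"
    then show "[circle_log m s = circle_log m t] (mod int n)"
      unfolding circle_log_def by (intro cong_diff aux cong_p)
  next
    assume l: "[circle_log m s = circle_log m t] (mod int n)"
    then have "int p dvd circle_log m s - circle_log m t"
      using cong_p cong_iff_dvd_diff by blast
    also have "circle_log m s - circle_log m t = s - t - int p * (m * triangle s - m * triangle t)"
      by (simp add: circle_log_def algebra_simps)
    finally have "[s = t] (mod int p)" by (simp add: cong_iff_dvd_diff dvd_diff_left_iff)
    from cong_add[OF l aux[OF this]] show "[s = t] (mod int n)" by (simp add: circle_log_def)
  qed
qed

definition log_map where "log_map m s = circle_log m s mod int n"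

lemma log_map_hom:
  "log_map m (s \<otimes>\<^bsub>circle m\<^esub> t) = log_map m s \<otimes>\<^bsub>Z\<^esub> log_map m t"
proof -
  have "[circle_log m ((s + t + int p * m * s * t) mod int n) = circle_log m (s + t + int p * m * s * t)] (mod int n)"
    unfolding circle_log_cong_iff by simp
  from cong_trans[OF this circle_log_add] show ?thesis
    by (simp add: log_map_def cong_def mod_simps)
qed

lemma log_map_bij: "bij_betw (log_map m) (carrier Z) (carrier Z)"
proof -
  have "inj_on (log_map m) (carrier Z)"
  proof (rule inj_onI)
    fix s t assume "s \<in> carrier Z" "t \<in> carrier Z" "log_map m s = log_map m t"
    moreover from this have "[s = t] (mod int n)"
      using circle_log_cong_iff[of m s t] by (simp add: log_map_def cong_def)
    ultimately show "s = t" by (simp add: carrier_Z cong_def)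
  qed
  moreover have "log_map m ` carrier Z \<subseteq> carrier Z"
    using n_pos by (auto simp: log_map_def carrier_Z)
  ultimately show ?thesis
    using endo_inj_surj[of "carrier Z" "log_map m"] by (auto simp: bij_betw_def carrier_Z)
qed

lemma group_circle: "group (circle m)"
proof (rule group_of_bij_hom[of Z "log_map m"])
  fix x y assume "x \<in> carrier (circle m)" "y \<in> carrier (circle m)"
  then show "x \<otimes>\<^bsub>circle m\<^esub> y \<in> carrier (circle m) \<and>
    log_map m (x \<otimes>\<^bsub>circle m\<^esub> y) = log_map m x \<otimes>\<^bsub>Z\<^esub> log_map m y"
    using log_map_hom[of m x y] n_pos by (simp add: carrier_Z)
qed (use log_map_bij n_pos in \<open>auto simp: carrier_Z log_map_def\<close>)

lemma log_map_iso: "log_map m \<in> iso (circle m) Z"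
proof (rule isoI)
  show "log_map m \<in> hom (circle m) Z"
    using log_map_bij[of m] log_map_hom[of m] by (intro homI) (auto simp: bij_betw_def)
qed (use log_map_bij in auto)

lemma mult_hom_Z: "(\<lambda>t. (u * t) mod int n) \<in> hom Z Z"
  using n_pos by (intro homI) (auto simp: carrier_Z mod_simps distrib_left)

lemma hom_Z_eq:
  assumes f: "f \<in> hom Z Z" and t: "t \<in> carrier Z"
  shows "f t = (f 1 * t) mod int n"
proof -
  have "f (int k mod int n) = (f 1 * int k) mod int n" for k
  proof (induction k)
    case 0
    show ?case using hom_one[OF f] by simp
  next
    case (Suc k)
    have "f (int (Suc k) mod int n) = f ((int k mod int n) \<otimes>\<^bsub>Z\<^esub> 1)"
      by (simp add: mod_simps add.commute)
    also have "\<dots> = f (int k mod int n) \<otimes>\<^bsub>Z\<^esub> f 1"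
      using f n_gt_1 by (intro hom_mult[of f Z Z]) (simp_all add: carrier_Z)
    finally show ?case using Suc by (simp add: mod_simps algebra_simps)
  qed
  from this[of "nat t"] show ?thesis using t by (simp add: carrier_Z)
qed

lemma skew_brace_circle: "skew_brace Z (circle m)"
proof (rule skew_brace_of_act[of _ _ "\<lambda>s t. ((1 + int p * m * s) * t) mod int n"])
  show "(\<lambda>t. ((1 + int p * m * x) * t) mod int n) \<in> hom Z Z" for x
    by (rule mult_hom_Z)
next
  fix x y assume "x \<in> carrier Z" "y \<in> carrier Z"
  have e: "x + y + int p * m * x * y = x + (1 + int p * m * x) * y" by (simp add: algebra_simps)
  show "x \<otimes>\<^bsub>circle m\<^esub> y = x \<otimes>\<^bsub>Z\<^esub> (((1 + int p * m * x) * y) mod int n)"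
    by (simp only: circle_simps mult_integer_mod_group mod_add_right_eq e)
qed (use group_circle in auto)

definition chi :: "int \<Rightarrow> int \<Rightarrow> int" where "chi c s = hpow (c * s)"

definition psi :: "int \<Rightarrow> int \<Rightarrow> int \<Rightarrow> int" where "psi m k s = hpow (k * circle_log m s)"

lemma mod_char_psi: "mod_char q (circle m) (psi m k)"
proof -
  have "[k * circle_log m (s \<otimes>\<^bsub>circle m\<^esub> t) = k * circle_log m s + k * circle_log m t] (mod int n)" for s t
  proof -
    have "[circle_log m (s \<otimes>\<^bsub>circle m\<^esub> t) = circle_log m s + circle_log m t] (mod int n)"
      using log_map_hom[of m s t] by (simp add: log_map_def cong_def mod_simps)
    from cong_scalar_left[OF this, of k] show ?thesis by (simp add: distrib_left)
  qed
  then show ?thesis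
    by (simp add: mod_char_def psi_def hpow_cong_add del: circle_simps(2))
qed

text \<open>The defect of additivity of the exponent is p (c m) s t. Hence every m is allowed when c
  = p, whereas for c = 1 only multiples of p qualify.\<close>

lemma mod_char_chi: "int p dvd c * m \<Longrightarrow> mod_char q (circle m) (chi c)"
proof -
  assume "int p dvd c * m"
  then obtain r where r: "c * m = int p * r" by auto
  have "[c * ((s + t + int p * m * s * t) mod int n) = c * s + c * t] (mod int n)" for s t
  proof -
    have "[c * ((s + t + int p * m * s * t) mod int n) = c * (s + t + int p * m * s * t)] (mod int n)"
      by (intro cong_scalar_left) simp
    also have "c * (s + t + int p * m * s * t) = c * s + c * t + int p * (c * m) * s * t"
      by (simp add: algebra_simps)
    also have "[\<dots> = c * s + c * t] (mod int n)"
      by (simp add: r cong_iff_dvd_diff int_n mult.assoc)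
    finally show ?thesis .
  qed
  then show ?thesis by (simp add: mod_char_def chi_def hpow_cong_add)
qed

lemma mod_char_Z: "mod_char q Z (chi c)"
proof -
  have "[c * ((s + t) mod int n) = c * s + c * t] (mod int n)" for s t
    using cong_scalar_left[of "(s + t) mod int n" "s + t" "int n" c] by (simp add: distrib_left)
  then show ?thesis by (simp add: mod_char_def chi_def hpow_cong_add)
qed

lemma prime_char_Z:
  assumes "\<not> int n dvd c" shows "prime_char Z q (chi c) 1"
proof (rule prime_char.intro)
  show "\<not> [chi c 1 = 1] (mod int q)"
    using assms hpow_cong_iff[of c 0] by (simp add: chi_def cong_0_iff)
  show "comm_group Z" by (rule abelian_integer_mod_group)
qed (use prime_q n_less_q mod_char_Z n_gt_1 in \<open>auto simp: carrier_Z\<close>)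

lemma cong_one_of_chi:
  assumes "c = 1 \<or> c = int p" "[c * e = c] (mod int n)" shows "[e = 1] (mod int p)"
  using assms(1)
proof
  assume "c = 1"
  then show ?thesis using assms(2) cong_p by simp
next
  assume "c = int p"
  then show ?thesis using assms(2) p_cong_iff[of e 1] by simp
qed

text \<open>The action of s is multiplication by lam s, and compatibility with \<chi> forces lam s =
  1 + p g s, where g s matters modulo p. Once g is known to be additive modulo p, g s = m s and Q is
  \<open>circle m\<close>. This group is generated by 1, so \<psi> is determined by the root of
  unity \<psi> 1.\<close>

lemma complete_data:
  assumes c: "c = 1 \<or> c = int p" and Q: "skew_brace Z Q" "mod_char q Q (chi c)" "mod_char q Q \<psi>"
  obtains m k where "0 \<le> m" "m < int p" "int p dvd c * m" "0 \<le> k" "k < int n"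
    "char_brace_iso Z q (chi c) (circle m) (psi m k) Q \<psi> (\<lambda>x. x)"
proof -
  interpret Q: skew_brace Z Q by fact
  have "0 < c" "c < int n"
    using c p_gt_2 n_gt_1 by (auto simp: int_n)
  then interpret prime_char Z q "chi c" 1 by (intro prime_char_Z zdvd_not_zless)
  define lam where "lam s = brace_act Z Q s 1" for s
  have one: "1 \<in> carrier Z" using n_gt_1 by (simp add: carrier_Z)
  have act: "brace_act Z Q s t = (lam s * t) mod int n" if "s \<in> carrier Z" "t \<in> carrier Z" for s t
    unfolding lam_def
    by (rule hom_Z_eq[OF iso_imp_homomorphism[OF Q.brace_act_iso[OF that(1)]] that(2)])
  have c_lam: "[c * lam s = c] (mod int n)" if "s \<in> carrier Z" for s
    using chi_act[OF Q(1,2) that one] by (simp add: chi_def hpow_cong_iff lam_def)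
  have p_lam: "[lam s = 1] (mod int p)" if "s \<in> carrier Z" for s
    using c c_lam[OF that] by (rule cong_one_of_chi)
  define g where "g s = (lam (s mod int n) - 1) div int p" for s
  have mem: "s mod int n \<in> carrier Z" for s using n_pos by (simp add: carrier_Z)
  have lam_g: "lam (s mod int n) = 1 + int p * g s" for s
    using p_lam[OF mem, of s] by (simp add: g_def cong_iff_dvd_diff)
  have g_cong: "g s = g t" if "[s = t] (mod int n)" for s t
    using that by (simp add: g_def cong_def)
  have mult: "(s mod int n) \<otimes>\<^bsub>Q\<^esub> (t mod int n) = (s + t + int p * g s * t) mod int n" for s t
  proof -
    have "(s mod int n) \<otimes>\<^bsub>Q\<^esub> (t mod int n) = (s + (1 + int p * g s) * t) mod int n"
      by (simp add: Q.mult_eq_act mem act lam_g mod_simps mod_add_mult_mod)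
    moreover have "s + (1 + int p * g s) * t = s + t + int p * g s * t" by (simp add: algebra_simps)
    ultimately show ?thesis by simp
  qed
  have g_mult: "[g (s + t + int p * g s * t) = g s + g t] (mod int p)" for s t
  proof -
    let ?s = "s mod int n" and ?t = "t mod int n" and ?u = "s + t + int p * g s * t"
    have "lam (?s \<otimes>\<^bsub>Q\<^esub> ?t) = brace_act Z Q ?s (lam ?t)"
      unfolding lam_def by (intro Q.brace_act_mult mem one)
    also have "\<dots> = (lam ?s * lam ?t) mod int n"
      unfolding lam_def[of ?t] by (intro act mem Q.brace_act_closed one)
    finally have "1 + int p * g ?u = ((1 + int p * g s) * (1 + int p * g t)) mod int n"
      using mult[of s t] by (simp add: lam_g)
    then have "[1 + int p * g ?u = (1 + int p * g s) * (1 + int p * g t)] (mod int n)"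
      by (simp add: cong_def)
    from cong_diff[OF this cong_refl[of 1]]
    have "[int p * g ?u = int p * (g s + g t + int p * g s * g t)] (mod int n)"
      by (simp add: algebra_simps)
    then have "[g ?u = g s + g t + int p * g s * g t] (mod int p)" unfolding p_cong_iff .
    also have "[g s + g t + int p * g s * g t = g s + g t] (mod int p)"
      by (simp add: cong_iff_dvd_diff)
    finally show ?thesis .
  qed
  \<comment> \<open>When the second argument is a multiple of p, the twist p g(s) p t vanishes
    modulo p^2.\<close>
  have g_add_p: "[g (s + int p * t) = g s + g (int p * t)] (mod int p)" for s t
  proof -
    have e: "[s + int p * t + int p * g s * (int p * t) = s + int p * t] (mod int n)"
      by (simp add: cong_iff_dvd_diff int_n ac_simps)
    from g_mult[of s "int p * t"] show ?thesis unfolding g_cong[OF e] .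
  qed
  have g0: "[g 0 = 0] (mod int p)"
    using g_add_p[of 0 0] by (simp add: cong_iff_dvd_diff)
  have g_p_nat: "[g (int p * int k) = int k * g (int p)] (mod int p)" for k
  proof (induction k)
    case (Suc k)
    have "[g (int p * int k + int p * 1) = g (int p * int k) + g (int p * 1)] (mod int p)"
      by (rule g_add_p)
    also have "[g (int p * int k) + g (int p * 1) = int k * g (int p) + g (int p * 1)] (mod int p)"
      by (intro cong_add Suc cong_refl)
    finally show ?case by (simp add: algebra_simps)
  qed (use g0 in simp)
  have g_p: "[g (int p * t) = t * g (int p)] (mod int p)" for t
  proof -
    have k: "int (nat (t mod int p)) = t mod int p" using p_gt_2 by simp
    have "g (int p * t) = g (int p * (t mod int p))"
      using p_cong_iff[of t "t mod int p"] by (intro g_cong) simp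
    moreover have "[t mod int p * g (int p) = t * g (int p)] (mod int p)"
      by (intro cong_scalar_right) simp
    ultimately show ?thesis
      using cong_trans[OF g_p_nat[of "nat (t mod int p)"]] unfolding k by simp
  qed
  have g_add': "[g s + g t = g (s + t) + g s * t * g (int p)] (mod int p)" for s t
  proof -
    have "[g (s + t + int p * (g s * t)) = g (s + t) + g (int p * (g s * t))] (mod int p)"
      by (rule g_add_p)
    also have "[g (s + t) + g (int p * (g s * t)) = g (s + t) + g s * t * g (int p)] (mod int p)"
      by (intro cong_add cong_refl g_p)
    finally have "[g (s + t + int p * g s * t) = g (s + t) + g s * t * g (int p)] (mod int p)"
      by (simp add: mult.assoc)
    then show ?thesis using cong_via g_mult by blast
  qed
  have gp0: "[g (int p) = 0] (mod int p)"
  proof -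
    \<comment> \<open>The left side of \<open>g_add'\<close> is symmetric. For the arguments 1 and
      p, the extra terms in the two orders are a multiple of p and the square of g p, and these must
      agree.\<close>
    have "[g (int p) + g 1 = g (1 + int p) + g 1 * int p * g (int p)] (mod int p)"
      using g_add'[of 1 "int p"] by (simp only: add.commute[of "g 1"])
    then have "[g (int p + 1) + g (int p) * 1 * g (int p) = g (1 + int p) + g 1 * int p * g (int p)] (mod int p)"
      by (rule cong_via[OF g_add'])
    then have "[g (int p) * g (int p) = int p * (g 1 * g (int p))] (mod int p)"
      by (simp add: add.commute cong_iff_dvd_diff ac_simps)
    then have "int p dvd g (int p) * g (int p)"
      by (metis cong_dvd_iff dvd_triv_left)
    then show ?thesis using prime_p by (simp add: cong_0_iff prime_dvd_mult_iff)
  qed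
  have g_add: "[g (s + t) = g s + g t] (mod int p)" for s t
  proof -
    have "[g (s + t) + g s * t * g (int p) = g (s + t) + g s * t * 0] (mod int p)"
      by (intro cong_add cong_mult cong_refl gp0)
    from cong_trans[OF g_add' this] show ?thesis by (simp add: cong_sym)
  qed
  have g_nat: "[g (int k) = int k * g 1] (mod int p)" for k
  proof (induction k)
    case (Suc k)
    have "[g (int k + 1) = g (int k) + g 1] (mod int p)" by (rule g_add)
    also have "[g (int k) + g 1 = int k * g 1 + g 1] (mod int p)"
      by (intro cong_add Suc cong_refl)
    finally show ?case by (simp add: algebra_simps)
  qed (use g0 in simp)
  define m where "m = g 1 mod int p"
  have m: "0 \<le> m" "m < int p" using p_gt_2 by (simp_all add: m_def)
  have mult_circle: "s \<otimes>\<^bsub>Q\<^esub> t = s \<otimes>\<^bsub>circle m\<^esub> t" if st: "s \<in> carrier Z" "t \<in> carrier Z" for s t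
  proof -
    have "[g s = s * g 1] (mod int p)" using g_nat[of "nat s"] st by (simp add: carrier_Z)
    also have "[s * g 1 = s * m] (mod int p)" by (intro cong_scalar_left) (simp add: m_def)
    finally have "[g s * t = s * m * t] (mod int p)" by (intro cong_scalar_right)
    then have "[int p * (g s * t) = int p * (s * m * t)] (mod int n)" unfolding p_cong_iff .
    from cong_add[OF cong_refl[of "s + t"] this] show ?thesis
      using mult[of s t] st by (simp add: carrier_Z cong_def ac_simps)
  qed
  have "int p dvd c * m"
    using c
  proof
    assume c1: "c = 1"
    \<comment> \<open>For c = 1 the action must fix 1 modulo p^2, not only modulo p.\<close>
    have "[int p * g 1 = int p * 0] (mod int n)"
      using c_lam[OF one] lam_g[of 1] n_gt_1 c1 by (simp add: cong_iff_dvd_diff)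
    then show ?thesis unfolding p_cong_iff by (simp add: m_def cong_def c1)
  qed simp
  interpret C: group "circle m" by (rule group_circle)
  have char_circle: "mod_char q (circle m) \<psi>"
    using Q(3) mult_circle Q.one_eq Q.carrier_eq by (simp add: mod_char_def del: circle_simps(2))
  have one_c: "1 \<in> carrier (circle m)" using one by simp
  have "1 [^]\<^bsub>circle m\<^esub> n = \<one>\<^bsub>circle m\<^esub>"
    using C.pow_order_eq_1[OF one_c] by (simp add: order_def carrier_Z)
  moreover have "[\<psi> \<one>\<^bsub>circle m\<^esub> = 1] (mod int q)"
    using char_circle unfolding mod_char_def by blast
  ultimately have "[\<psi> 1 ^ n = 1] (mod int q)"
    using cong_via mod_char_nat_pow[OF group_circle char_circle one_c, of n] by metis
  then obtain k where k: "0 \<le> k" "k < int n" "[\<psi> 1 = hpow k] (mod int q)"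
    by (rule root_of_unity_eq_hpow)
  have psi: "[\<psi> s = psi m k s] (mod int q)" if s: "s \<in> carrier Z" for s
  proof -
    \<comment> \<open>The discrete logarithm of s: s is the e-th power of 1 in
      \<open>circle m\<close>.\<close>
    define e where "e = nat (circle_log m s mod int n)"
    have e: "int e = circle_log m s mod int n" using n_pos by (simp add: e_def)
    let ?x = "1 [^]\<^bsub>circle m\<^esub> e"
    have "log_map m ?x = log_map m 1 [^]\<^bsub>Z\<^esub> e"
      by (rule hom_nat_pow[OF iso_imp_homomorphism[OF log_map_iso] one_c group_circle]) simp
    also have "\<dots> = log_map m s" using n_gt_1 by (simp add: log_map_def e)
    finally have "?x = s"
      using log_map_bij[of m] s C.nat_pow_closed[OF one_c, of e] by (auto simp: bij_betw_def dest: inj_onD)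
    then have "[\<psi> s = \<psi> 1 ^ e] (mod int q)"
      using mod_char_nat_pow[OF group_circle char_circle one_c, of e] by simp
    also have "[\<psi> 1 ^ e = hpow k ^ e] (mod int q)" by (intro cong_pow k)
    also have "[hpow k ^ e = hpow (k * int e)] (mod int q)" by (rule hpow_power)
    also have "[hpow (k * int e) = psi m k s] (mod int q)"
      unfolding psi_def hpow_cong_iff e by (intro cong_scalar_left) simp
    finally show ?thesis .
  qed
  have "(\<lambda>x. x) \<in> iso (circle m) Q"
    using mult_circle Q.carrier_eq by (simp add: Group.iso_def hom_def bij_betw_def inj_on_def del: circle_simps(2))
  then have "char_brace_iso Z q (chi c) (circle m) (psi m k) Q \<psi> (\<lambda>x. x)"
    using psi by (simp add: char_brace_iso_def iso_set_refl)
  then show ?thesis using that m \<open>int p dvd c * m\<close> k by blast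
qed

section \<open>Isomorphisms between the data on the cyclic complement\<close>

lemma coprime_n: "\<not> int p dvd u \<Longrightarrow> coprime u (int n)"
  using prime_p by (metis coprime_commute coprime_mult_left_iff int_n prime_imp_coprime prime_nat_int_transfer)

lemma mult_iso_Z:
  assumes "\<not> int p dvd u" shows "(\<lambda>t. (u * t) mod int n) \<in> iso Z Z"
proof (rule isoI[OF mult_hom_Z])
  have "inj_on (\<lambda>t. (u * t) mod int n) (carrier Z)"
  proof (rule inj_onI)
    fix s t assume *: "s \<in> carrier Z" "t \<in> carrier Z" "(u * s) mod int n = (u * t) mod int n"
    then have "[s = t] (mod int n)"
      using cong_mult_lcancel[OF coprime_n[OF assms]] by (simp add: cong_def)
    then show "s = t" using * by (simp add: carrier_Z cong_def)
  qed
  moreover have "(\<lambda>t. (u * t) mod int n) ` carrier Z \<subseteq> carrier Z"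
    using n_pos by (auto simp: carrier_Z)
  ultimately show "bij_betw (\<lambda>t. (u * t) mod int n) (carrier Z) (carrier Z)"
    using endo_inj_surj[of "carrier Z"] by (auto simp: bij_betw_def carrier_Z)
qed

text \<open>Terms with a factor p do not notice e, as e = 1 modulo p. So scaling by e respects the
  twist p m s t and the exponents of \<chi>, and it commutes with \<open>circle_log\<close>; only k
  changes.\<close>

lemma char_brace_iso_scale:
  assumes e: "[e = 1] (mod int p)" and k: "[k = k' * e] (mod int n)"
  shows "char_brace_iso Z q (chi (int p)) (circle m) (psi m k) (circle m) (psi m k')
    (\<lambda>s. (e * s) mod int n)"
proof -
  let ?h = "\<lambda>s. (e * s) mod int n"
  have "\<not> int p dvd e"
  proof
    assume "int p dvd e"
    from dvd_diff[OF this e[unfolded cong_iff_dvd_diff]] show False using p_gt_2 by simp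
  qed
  then have iso: "?h \<in> iso Z Z" by (rule mult_iso_Z)
  have es: "[e * s = s] (mod int p)" for s using cong_scalar_right[OF e, of s] by simp
  have "?h (s \<otimes>\<^bsub>circle m\<^esub> t) = ?h s \<otimes>\<^bsub>circle m\<^esub> ?h t" for s t
  proof -
    have "[e * (m * s * t) = m * s * t] (mod int p)" by (rule es)
    moreover have "[m * (e * s) * (e * t) = m * s * t] (mod int p)"
      by (intro cong_mult cong_refl es)
    ultimately have "[e * (m * s * t) = m * (e * s) * (e * t)] (mod int p)"
      using cong_trans cong_sym by blast
    then have 1: "[int p * (e * (m * s * t)) = int p * (m * (e * s) * (e * t))] (mod int n)"
      unfolding p_cong_iff .
    have "[e * s + e * t + int p * (e * (m * s * t)) = e * s + e * t + int p * (m * (e * s) * (e * t))] (mod int n)"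
      by (intro cong_add cong_refl 1)
    also have "[e * s + e * t + int p * (m * (e * s) * (e * t))
        = ?h s + ?h t + int p * (m * ?h s * ?h t)] (mod int n)"
      by (intro cong_add cong_mult cong_refl) simp_all
    finally have "[e * (s + t + int p * m * s * t) = ?h s + ?h t + int p * m * ?h s * ?h t] (mod int n)"
      by (simp add: algebra_simps)
    then show ?thesis by (simp add: cong_def mod_simps)
  qed
  then have iso_c: "?h \<in> iso (circle m) (circle m)"
    using iso by (simp add: Group.iso_def hom_def del: circle_simps(2))
  have chi: "[chi (int p) (?h s) = chi (int p) s] (mod int q)" for s
  proof -
    have "[int p * ?h s = int p * (e * s)] (mod int n)" by (intro cong_scalar_left) simp
    also have "[int p * (e * s) = int p * s] (mod int n)" unfolding p_cong_iff by (rule es)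
    finally show ?thesis by (simp add: chi_def hpow_cong_iff)
  qed
  have psi: "[psi m k' (?h s) = psi m k s] (mod int q)" for s
  proof -
    have "[m * triangle (e * s) = m * triangle s] (mod int p)"
      by (intro cong_scalar_left triangle_cong prime_p p_gt_2 es)
    also have "[m * triangle s = e * (m * triangle s)] (mod int p)"
      by (rule cong_sym[OF es])
    finally have 1: "[int p * (m * triangle (e * s)) = int p * (e * (m * triangle s))] (mod int n)"
      unfolding p_cong_iff .
    have "[circle_log m (?h s) = circle_log m (e * s)] (mod int n)"
      unfolding circle_log_cong_iff by simp
    also have "[circle_log m (e * s) = e * s - int p * (e * (m * triangle s))] (mod int n)"
      unfolding circle_log_def by (intro cong_diff cong_refl 1)
    also have "e * s - int p * (e * (m * triangle s)) = e * circle_log m s"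
      by (simp add: circle_log_def algebra_simps)
    finally have "[k' * circle_log m (?h s) = k' * (e * circle_log m s)] (mod int n)"
      by (intro cong_scalar_left)
    also have "[k' * (e * circle_log m s) = k * circle_log m s] (mod int n)"
      using cong_scalar_right[OF cong_sym[OF k], of "circle_log m s"] by (simp add: mult.assoc)
    finally show ?thesis by (simp add: psi_def hpow_cong_iff)
  qed
  show ?thesis using iso iso_c chi psi by (simp add: char_brace_iso_def)
qed

text \<open>Everything is read off at the generator, with e = f 1: \<chi> gives c e = c, the product
  1 \<circ> 1 gives m = m' modulo p, and \<psi> relates k to k'.\<close>

lemma char_brace_iso_imp_cong:
  assumes c: "c = 1 \<or> c = int p"
    and f: "char_brace_iso Z q (chi c) (circle m) (psi m k) (circle m') (psi m' k') f"
  obtains e where "[e = 1] (mod int p)" "[c * e = c] (mod int n)" "[m = m'] (mod int p)"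
    "[k = k' * e] (mod int n)"
proof -
  define e where "e = f 1"
  have one: "1 \<in> carrier Z" using n_gt_1 by (simp add: carrier_Z)
  have hom: "f \<in> hom Z Z" "f \<in> hom (circle m) (circle m')"
    using f by (auto simp: char_brace_iso_def Group.iso_def)
  have h_eq: "f t = (e * t) mod int n" if "t \<in> carrier Z" for t
    using hom_Z_eq[OF hom(1) that] by (simp add: e_def)
  have chars: "[chi c (f 1) = chi c 1] (mod int q)" "[psi m' k' (f 1) = psi m k 1] (mod int q)"
    using f one unfolding char_brace_iso_def by blast+
  have ce: "[c * e = c] (mod int n)"
    using chars(1) by (simp add: chi_def hpow_cong_iff e_def)
  have e1: "[e = 1] (mod int p)" using c ce by (rule cong_one_of_chi)
  have "f (1 \<otimes>\<^bsub>circle m\<^esub> 1) = f 1 \<otimes>\<^bsub>circle m'\<^esub> f 1"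
    using hom(2) one by (simp add: hom_def del: circle_simps(2))
  then have "[e * (2 + int p * m) = e + e + int p * m' * e * e] (mod int n)"
    using n_pos by (simp add: h_eq carrier_Z e_def[symmetric] cong_def mod_simps)
  from cong_diff[OF this cong_refl[of "e + e"]]
  have "[int p * (e * m) = int p * (m' * e * e)] (mod int n)" by (simp add: algebra_simps)
  then have "[e * m = m' * e * e] (mod int p)" unfolding p_cong_iff .
  moreover have "[e * m = 1 * m] (mod int p)" "[m' * e * e = m' * 1 * 1] (mod int p)"
    by (intro cong_mult cong_refl e1)+
  ultimately have mm: "[m = m'] (mod int p)"
    by (simp add: cong_def)
  have "[k' * circle_log m' e = k] (mod int n)"
    using chars(2) by (simp add: psi_def hpow_cong_iff e_def)
  moreover have "[k' * circle_log m' e = k' * e] (mod int n)"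
  proof -
    have "[m' * triangle e = m' * triangle 1] (mod int p)"
      by (intro cong_scalar_left triangle_cong prime_p p_gt_2 e1)
    then have "[int p * (m' * triangle e) = int p * (m' * triangle 1)] (mod int n)"
      unfolding p_cong_iff .
    then have "[e - int p * (m' * triangle e) = e - 0] (mod int n)"
      by (intro cong_diff cong_refl) simp
    then show ?thesis unfolding circle_log_def by (intro cong_scalar_left) simp
  qed
  ultimately have "[k = k' * e] (mod int n)" by (rule cong_via)
  then show ?thesis using that e1 ce mm by blast
qed

section \<open>Isomorphism types of the multiplicative groups, and the counts\<close>

abbreviation Y where "Y k \<equiv> char_product q Z (chi k)"

lemma group_Y: "group (Y k)"
  using q_gt_1 by (intro group_char_product mod_char_Z) auto

lemma char_product_circle_iso: "char_product q (circle m) (psi m k) \<cong> Y k"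
proof (rule is_isoI[OF char_product_iso[OF log_map_iso]])
  show "[chi k (log_map m t) = psi m k t] (mod int q)" for t
    unfolding chi_def psi_def hpow_cong_iff log_map_def by (intro cong_scalar_left) simp
qed (use q_gt_1 in simp)

lemma char_product_circle_iso_iff: "char_product q (circle m) (psi m k) \<cong> H \<longleftrightarrow> Y k \<cong> H"
proof -
  have "group (char_product q (circle m) (psi m k))"
    using q_gt_1 by (intro group_char_product group_circle mod_char_psi) simp
  then have "Y k \<cong> char_product q (circle m) (psi m k)"
    using char_product_circle_iso by (rule group.iso_sym)
  then show ?thesis using char_product_circle_iso[of m k] iso_trans by blast
qed

text \<open>Changing the generator of \<open>Z\<close> multiplies the exponent of the character by a
  unit.\<close>

lemma Y_mult_iso:
  assumes "\<not> int p dvd u" shows "Y (c * u) \<cong> Y c"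
proof (rule is_isoI[OF char_product_iso[OF mult_iso_Z[OF assms]]])
  show "[chi c ((u * t) mod int n) = chi (c * u) t] (mod int q)" for t
    using cong_scalar_left[of "(u * t) mod int n" "u * t" "int n" c]
    by (simp add: chi_def hpow_cong_iff mult.assoc)
qed (use q_gt_1 in simp)

lemma carrier_Y: "carrier (Y k) = {0..<int q} \<times> {0..<int n}"
  using q_gt_1 by (simp add: carrier_char_product carrier_Z)

lemma commuting_Y: "commuting (Y k) \<longleftrightarrow> int n dvd k"
proof
  assume "commuting (Y k)"
  moreover have "(0, 1) \<in> carrier (Y k)" "(1, 0) \<in> carrier (Y k)"
    using q_gt_1 n_gt_1 by (auto simp: carrier_Y)
  ultimately have "(0, 1) \<otimes>\<^bsub>Y k\<^esub> (1, 0) = (1, 0) \<otimes>\<^bsub>Y k\<^esub> (0, 1)"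
    unfolding commuting_def by blast
  then have "[hpow k = hpow 0] (mod int q)" using q_gt_1 by (simp add: chi_def cong_def)
  then show "int n dvd k" using hpow_cong_iff[of k 0] by (simp add: cong_0_iff)
next
  assume k: "int n dvd k"
  have A: "[chi k s * b = b] (mod int q)" for s b
  proof -
    have "[chi k s = hpow 0] (mod int q)" using k hpow_cong_iff[of "k * s" 0] by (simp add: chi_def cong_0_iff)
    from cong_scalar_right[OF this, of b] show ?thesis by simp
  qed
  have "[a + chi k s * b = b + chi k t * a] (mod int q)" for a b s t
    using cong_add[OF cong_refl[of a] A[of s b]] cong_add[OF cong_refl[of b] A[of t a]]
    by (simp add: cong_def add.commute)
  then show "commuting (Y k)"
    by (auto simp: commuting_def carrier_Y cong_def add.commute)
qed

text \<open>The element (0, 1) has order p^2, which does not divide p q since p \<noteq> q.\<close>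

lemma not_exponent_dvd_Y: "\<not> exponent_dvd (p * q) (Y k)"
proof
  assume "exponent_dvd (p * q) (Y k)"
  then have "(0, 1) [^]\<^bsub>Y k\<^esub> (p * q) = \<one>\<^bsub>Y k\<^esub>"
    using q_gt_1 n_gt_1 by (simp add: exponent_dvd_def carrier_Y)
  then have "int n dvd int p * int q" by (simp add: nat_pow_fst_zero dvd_eq_mod_eq_0)
  then have "p dvd q" using p_gt_2 by (simp add: n flip: of_nat_mult)
  then have "p = q" using prime_p prime_q primes_dvd_imp_eq by blast
  moreover have "p < p * p" using p_gt_2 by simp
  ultimately show False using n_less_q n by simp
qed

text \<open>Commuting with (1, 0) forces s to act trivially, and the action is faithful; commuting
  with (0, 1) forces (h - 1) a = 0 modulo q.\<close>

lemma trivial_center_Y1: "trivial_center (Y 1)"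
  unfolding trivial_center_def
proof (intro ballI impI)
  fix z assume z: "z \<in> carrier (Y 1)" "\<forall>x\<in>carrier (Y 1). z \<otimes>\<^bsub>Y 1\<^esub> x = x \<otimes>\<^bsub>Y 1\<^esub> z"
  then obtain a s where as: "z = (a, s)" "0 \<le> a" "a < int q" "0 \<le> s" "s < int n"
    by (auto simp: carrier_Y)
  have c: "(1, 0) \<in> carrier (Y 1)" "(0, 1) \<in> carrier (Y 1)" using q_gt_1 n_gt_1 by (auto simp: carrier_Y)
  have "[a + hpow s = 1 + a] (mod int q)"
    using bspec[OF z(2) c(1)] by (simp add: as chi_def cong_def)
  then have "[hpow s = hpow 0] (mod int q)" by (simp add: cong_iff_dvd_diff)
  then have s: "s = 0" unfolding hpow_cong_iff using as by (simp add: cong_def)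
  have "[a = hpow 1 * a] (mod int q)"
    using bspec[OF z(2) c(2)] by (simp add: as chi_def cong_def)
  then have "int q dvd (hpow 1 - 1) * a" by (simp add: cong_iff_dvd_diff algebra_simps dvd_diff_commute)
  moreover have "\<not> [hpow 1 = hpow 0] (mod int q)"
    unfolding hpow_cong_iff using n_gt_1 by (simp add: cong_def)
  ultimately have "int q dvd a"
    using prime_q by (simp add: prime_dvd_mult_iff cong_iff_dvd_diff)
  then have "a = 0" using as zdvd_not_zless[of a "int q"] by force
  then show "z = \<one>\<^bsub>Y 1\<^esub>" using as s by simp
qed

text \<open>The element (0, p) is central: it acts by the power of h with exponent p^2, which is
  1.\<close>

lemma not_trivial_center_Yp: "\<not> trivial_center (Y (int p))"
proof
  assume t: "trivial_center (Y (int p))"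
  let ?z = "(0, int p)"
  have z: "?z \<in> carrier (Y (int p))" using q_gt_1 p_gt_2 by (simp add: carrier_Y int_n)
  have "[chi (int p) (int p) = hpow 0] (mod int q)"
    unfolding chi_def hpow_cong_iff by (simp add: int_n cong_def)
  from cong_scalar_right[OF this] have "[chi (int p) (int p) * b = b] (mod int q)" for b by simp
  then have "?z \<otimes>\<^bsub>Y (int p)\<^esub> x = x \<otimes>\<^bsub>Y (int p)\<^esub> ?z" for x
    by (cases x) (simp add: cong_def add.commute)
  then have "?z = \<one>\<^bsub>Y (int p)\<^esub>" using t z unfolding trivial_center_def by blast
  then show False using p_gt_2 by simp
qed

lemma Y_cases:
  assumes "0 \<le> k" "k < int n"
  shows "k = 0 \<or> (int p dvd k \<and> k \<noteq> 0 \<and> Y k \<cong> Y (int p)) \<or> (\<not> int p dvd k \<and> Y k \<cong> Y 1)"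
proof (cases "int p dvd k \<and> k \<noteq> 0")
  case True
  then obtain r where r: "k = int p * r" by auto
  then have "0 < r" "r < int p" using assms True p_gt_2
    by (auto simp: int_n zero_le_mult_iff)
  then have "\<not> int p dvd r" by (simp add: zdvd_not_zless)
  then show ?thesis using True Y_mult_iso[of r "int p"] r by simp
next
  case False
  then show ?thesis using Y_mult_iso[of k 1] by auto
qed

lemma Y_iso_iff:
  assumes k: "0 \<le> k" "k < int n" and H: "group H"
  shows "Y 0 \<cong> H \<Longrightarrow> Y k \<cong> H \<longleftrightarrow> k = 0"
    and "Y 1 \<cong> H \<Longrightarrow> Y k \<cong> H \<longleftrightarrow> \<not> int p dvd k"
    and "Y (int p) \<cong> H \<Longrightarrow> Y k \<cong> H \<longleftrightarrow> int p dvd k \<and> k \<noteq> 0"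
    and "exponent_dvd (p * q) H \<Longrightarrow> \<not> Y k \<cong> H"
proof -
  have inv: "commuting H \<longleftrightarrow> int n dvd j" "trivial_center (Y j) \<longleftrightarrow> trivial_center H"
    "\<not> exponent_dvd (p * q) H" if "Y j \<cong> H" for j
    using iso_invariants[OF group_Y H that] commuting_Y[of j] not_exponent_dvd_Y[of j] by auto
  have dvd: "\<not> int n dvd k" if "k \<noteq> 0" using that k zdvd_not_zless[of k "int n"] by auto
  have n1: "\<not> int n dvd 1" "\<not> int n dvd int p"
    using n_gt_1 zdvd_not_zless[of "int p" "int n"] p_gt_2 by (auto simp: int_n)
  have tc: "trivial_center (Y j) \<longleftrightarrow> trivial_center (Y i)" if "Y j \<cong> Y i" for i j
    using iso_invariants(3)[OF group_Y group_Y that] .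
  show "exponent_dvd (p * q) H \<Longrightarrow> \<not> Y k \<cong> H" using inv(3) by blast
  show "Y k \<cong> H \<longleftrightarrow> k = 0" if a: "Y 0 \<cong> H"
    using inv(1)[OF a] inv(1)[of k] dvd a by auto
  show "Y k \<cong> H \<longleftrightarrow> \<not> int p dvd k" if a: "Y 1 \<cong> H"
    using Y_cases[OF k] inv(1,2)[OF a] inv(1,2)[of k] trivial_center_Y1 not_trivial_center_Yp n1
      tc[of k "int p"] iso_trans[OF _ a, of "Y k"] by auto
  show "Y k \<cong> H \<longleftrightarrow> int p dvd k \<and> k \<noteq> 0" if a: "Y (int p) \<cong> H"
    using Y_cases[OF k] inv(1,2)[OF a] inv(1,2)[of k] trivial_center_Y1 not_trivial_center_Yp n1
      tc[of k 1] iso_trans[OF _ a, of "Y k"] by auto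
qed

text \<open>Here \<chi> is faithful. Compatibility forces m = 0, and only the identity preserves
  \<chi>, so every k is a class of its own.\<close>

lemma num_skew_braces_Y1:
  assumes G: "Y 1 \<cong> G" and H: "group H"
  shows "num_skew_braces G H = 2 * card {k \<in> {0..<int n}. Y k \<cong> H}"
proof -
  interpret prime_char Z q "chi 1" 1 using n_gt_1 by (intro prime_char_Z) auto
  have "num_skew_braces G H =
      2 * card {k \<in> {0..<int n}. char_product q (circle 0) (psi 0 k) \<cong> H}"
  proof (rule num_skew_braces_char_product[OF G])
    show "skew_brace Z (circle 0) \<and> mod_char q (circle 0) (chi 1) \<and> mod_char q (circle 0) (psi 0 k)" for k
      using skew_brace_circle mod_char_chi mod_char_psi by simp
  next
    fix Q \<psi> assume Q: "skew_brace Z Q" "mod_char q Q (chi 1)" "mod_char q Q \<psi>"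
    obtain m k where mk: "0 \<le> m" "m < int p" "int p dvd 1 * m" "0 \<le> k" "k < int n"
      "char_brace_iso Z q (chi 1) (circle m) (psi m k) Q \<psi> (\<lambda>x. x)"
      using complete_data[OF disjI1[OF refl] Q] by blast
    then have "m = 0" using zdvd_not_zless[of m "int p"] by force
    then show "\<exists>k\<in>{0..<int n}. \<exists>h. char_brace_iso Z q (chi 1) (circle 0) (psi 0 k) Q \<psi> h"
      using mk by auto
  next
    fix k k' h assume k: "k \<in> {0..<int n}" "k' \<in> {0..<int n}"
      "char_brace_iso Z q (chi 1) (circle 0) (psi 0 k) (circle 0) (psi 0 k') h"
    obtain e where "[1 * e = 1] (mod int n)" "[k = k' * e] (mod int n)"
      by (rule char_brace_iso_imp_cong[OF _ k(3)]) auto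
    then have "[k = k' * 1] (mod int n)" using cong_scalar_left[of e 1 "int n" k'] cong_trans by simp
    then show "k = k'" using k by (simp add: cong_def)
  qed
  then show ?thesis unfolding char_product_circle_iso_iff .
qed

text \<open>
  An automorphism \<open>s \<mapsto> e * s\<close> with \<open>e \<equiv> 1\<close> modulo \<open>p\<close> changes the exponent \<open>k\<close> of \<open>\<psi>\<close> by the factor \<open>e\<close>
  or its inverse. So multiples of \<open>p\<close> are fixed, and the other exponents matter only modulo \<open>p\<close>.
\<close>

definition reps :: "int set" where
  "reps = {0..<int p} \<union> {k \<in> {0..<int n}. int p dvd k \<and> k \<noteq> 0}"

lemma reps_range: "k \<in> reps \<Longrightarrow> 0 \<le> k \<and> k < int n"
proof -
  have "int p < int n" using p_gt_2 by (simp add: int_n)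
  then show "k \<in> reps \<Longrightarrow> 0 \<le> k \<and> k < int n" by (auto simp: reps_def)
qed

text \<open>Every m modulo p is compatible with \<chi> and is an isomorphism invariant, hence the
  factor p. The automorphisms that preserve \<chi> act on k alone.\<close>

lemma num_skew_braces_Yp:
  assumes G: "Y (int p) \<cong> G" and H: "group H"
  shows "num_skew_braces G H = 2 * (p * card {k \<in> reps. Y k \<cong> H})"
proof -
  have "int p < int n" using p_gt_2 by (simp add: int_n)
  then interpret prime_char Z q "chi (int p)" 1
    using p_gt_2 by (intro prime_char_Z zdvd_not_zless) auto
  have "num_skew_braces G H = 2 * card {d \<in> {0..<int p} \<times> reps.
      char_product q (circle (fst d)) (psi (fst d) (snd d)) \<cong> H}"
  proof (rule num_skew_braces_char_product[OF G])
    show "skew_brace Z (circle (fst d)) \<and> mod_char q (circle (fst d)) (chi (int p)) \<and>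
      mod_char q (circle (fst d)) (psi (fst d) (snd d))" for d :: "int \<times> int"
      using skew_brace_circle mod_char_chi mod_char_psi by simp
  next
    fix Q \<psi> assume Q: "skew_brace Z Q" "mod_char q Q (chi (int p))" "mod_char q Q \<psi>"
    obtain m k where mk: "0 \<le> m" "m < int p" "0 \<le> k" "k < int n"
      "char_brace_iso Z q (chi (int p)) (circle m) (psi m k) Q \<psi> (\<lambda>x. x)"
      using complete_data[OF disjI2[OF refl] Q] by blast
    have "\<exists>k0\<in>reps. \<exists>e. [e = 1] (mod int p) \<and> [k0 = k * e] (mod int n)"
    proof (cases "int p dvd k")
      case True
      then have "k \<in> reps" using mk p_gt_2 by (auto simp: reps_def)
      then show ?thesis by (intro bexI[of _ k] exI[of _ 1]) auto
    next
      case False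
      obtain v where v: "[k * v = 1] (mod int n)"
        using cong_solve_coprime_int[OF coprime_n[OF False]] by blast
      \<comment> \<open>With v = 1/k modulo p^2, the factor e is (k mod p)/k. It turns k into its
        residue, and is 1 modulo p because the two agree there.\<close>
      let ?k0 = "k mod int p" and ?e = "v * (k mod int p)"
      have k0: "?k0 \<in> reps" using p_gt_2 by (auto simp: reps_def)
      have ke: "[k * ?e = ?k0] (mod int n)"
        using cong_scalar_right[OF v, of ?k0] by (simp add: mult.assoc)
      have "[k * ?e = k * 1] (mod int p)" using cong_p[OF ke] by (simp add: cong_def)
      moreover have "coprime k (int p)"
        using coprime_n[OF False] by (simp add: int_n)
      ultimately have "[?e = 1] (mod int p)" using cong_mult_lcancel by blast
      then show ?thesis using k0 cong_sym[OF ke] by blast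
    qed
    then obtain k0 e where "k0 \<in> reps" "[e = 1] (mod int p)" "[k0 = k * e] (mod int n)" by blast
    moreover from this(2,3) have "char_brace_iso Z q (chi (int p)) (circle m) (psi m k0) (circle m) (psi m k)
        (\<lambda>s. (e * s) mod int n)" by (rule char_brace_iso_scale)
    ultimately show "\<exists>d\<in>{0..<int p} \<times> reps. \<exists>h.
        char_brace_iso Z q (chi (int p)) (circle (fst d)) (psi (fst d) (snd d)) Q \<psi> h"
      using mk char_brace_iso_trans[OF circle_simps(1) _ mk(5)]
      by (intro bexI[of _ "(m, k0)"]) auto
  next
    fix d d' h assume d: "d \<in> {0..<int p} \<times> reps" "d' \<in> {0..<int p} \<times> reps"
      "char_brace_iso Z q (chi (int p)) (circle (fst d)) (psi (fst d) (snd d))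
        (circle (fst d')) (psi (fst d') (snd d')) h"
    obtain m k m' k' where mk: "d = (m, k)" "d' = (m', k')" by (metis surj_pair)
    obtain e where e: "[e = 1] (mod int p)" "[m = m'] (mod int p)" "[k = k' * e] (mod int n)"
      using d(3) unfolding mk fst_conv snd_conv by (rule char_brace_iso_imp_cong[rotated]) auto
    have "m = m'" using e(2) d mk by (simp add: cong_def)
    moreover have "k = k'"
    proof -
      have r: "k \<in> reps" "k' \<in> reps" using d mk by auto
      have kk: "[k = k' * 1] (mod int p)"
        using cong_trans[OF cong_p[OF e(3)] cong_scalar_left[OF e(1)]] .
      show ?thesis
      proof (cases "int p dvd k'")
        case True
        then obtain r' where r': "k' = int p * r'" by auto
        have "[r' * e = r' * 1] (mod int p)" by (intro cong_scalar_left e)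
        then have "[int p * (r' * e) = int p * (r' * 1)] (mod int n)" unfolding p_cong_iff .
        then have "[k = k'] (mod int n)" using cong_trans[OF e(3)] by (simp add: r' mult.assoc)
        then show ?thesis using reps_range[OF r(1)] reps_range[OF r(2)] by (simp add: cong_def)
      next
        case False
        have "\<not> int p dvd k"
        proof
          assume "int p dvd k"
          from dvd_diff[OF this kk[unfolded cong_iff_dvd_diff]] show False using False by simp
        qed
        then have "k < int p" "0 \<le> k" "k' < int p" "0 \<le> k'" using r False by (auto simp: reps_def)
        then show ?thesis using kk by (simp add: cong_def)
      qed
    qed
    ultimately show "d = d'" by (simp add: mk)
  qed
  also have "{d \<in> {0..<int p} \<times> reps. char_product q (circle (fst d)) (psi (fst d) (snd d)) \<cong> H} =
      {0..<int p} \<times> {k \<in> reps. Y k \<cong> H}"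
    unfolding char_product_circle_iso_iff by auto
  finally show ?thesis by (simp add: card_cartesian_product)
qed

lemma card_dvd: "card {k \<in> {0..<int n}. int p dvd k \<and> k \<noteq> 0} = p - 1"
proof -
  have "{k \<in> {0..<int n}. int p dvd k \<and> k \<noteq> 0} = (*) (int p) ` {1..<int p}"
  proof (intro equalityI subsetI)
    fix k assume k: "k \<in> {k \<in> {0..<int n}. int p dvd k \<and> k \<noteq> 0}"
    then obtain r where r: "k = int p * r" by auto
    then have "0 < r" "r < int p" using k p_gt_2 by (auto simp: int_n zero_le_mult_iff)
    then show "k \<in> (*) (int p) ` {1..<int p}" using r by auto
  qed (use p_gt_2 in \<open>auto simp: int_n\<close>)
  moreover have "inj_on ((*) (int p)) {1..<int p}" using p_gt_2 by (auto simp: inj_on_def)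
  ultimately show ?thesis by (simp add: card_image)
qed

lemma card_not_dvd: "card {k \<in> {0..<int n}. \<not> int p dvd k} = p * (p - 1)"
proof -
  let ?R = "{k \<in> {0..<int n}. int p dvd k \<and> k \<noteq> 0}"
  have "{k \<in> {0..<int n}. \<not> int p dvd k} = {0..<int n} - insert 0 ?R" by auto
  moreover have fin: "finite ?R" by (rule finite_subset[of _ "{0..<int n}"]) auto
  then have "card (insert 0 ?R) = p" using card_dvd p_gt_2 by (subst card_insert_disjoint) auto
  moreover have "card ({0..<int n} - insert 0 ?R) = card {0..<int n} - card (insert 0 ?R)"
    using fin n_gt_1 by (intro card_Diff_subset) auto
  ultimately have "card {k \<in> {0..<int n}. \<not> int p dvd k} = n - p"
    by (simp only: card_atLeastLessThan_int)
  then show ?thesis by (simp add: n diff_mult_distrib2)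
qed

lemma card_reps_not_dvd: "card {k \<in> reps. \<not> int p dvd k} = p - 1"
proof -
  have "{k \<in> reps. \<not> int p dvd k} = {1..<int p}"
  proof (intro equalityI subsetI)
    fix k assume k: "k \<in> {k \<in> reps. \<not> int p dvd k}"
    then have "k \<noteq> 0" by auto
    then show "k \<in> {1..<int p}" using k by (auto simp: reps_def)
  next
    fix k assume "k \<in> {1..<int p}"
    then show "k \<in> {k \<in> reps. \<not> int p dvd k}" by (auto simp: reps_def zdvd_not_zless)
  qed
  then show ?thesis by simp
qed

theorem num_skew_braces_Y1_cases:
  assumes G: "Y 1 \<cong> G" and H: "group H"
  shows "Y 0 \<cong> H \<Longrightarrow> num_skew_braces G H = 2"
    and "Y (int p) \<cong> H \<Longrightarrow> num_skew_braces G H = 2 * (p - 1)"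
    and "Y 1 \<cong> H \<Longrightarrow> num_skew_braces G H = 2 * p * (p - 1)"
    and "exponent_dvd (p * q) H \<Longrightarrow> num_skew_braces G H = 0"
proof -
  note N = num_skew_braces_Y1[OF G H] and I = Y_iso_iff[OF _ _ H]
  show "num_skew_braces G H = 2" if "Y 0 \<cong> H"
  proof -
    have "{k \<in> {0..<int n}. Y k \<cong> H} = {0}" using I(1)[OF _ _ that] n_gt_1 by auto
    then show ?thesis unfolding N by simp
  qed
  show "num_skew_braces G H = 2 * (p - 1)" if "Y (int p) \<cong> H"
  proof -
    have "{k \<in> {0..<int n}. Y k \<cong> H} = {k \<in> {0..<int n}. int p dvd k \<and> k \<noteq> 0}"
      using I(3)[OF _ _ that] by auto
    then show ?thesis unfolding N by (simp only: card_dvd)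
  qed
  show "num_skew_braces G H = 2 * p * (p - 1)" if "Y 1 \<cong> H"
  proof -
    have "{k \<in> {0..<int n}. Y k \<cong> H} = {k \<in> {0..<int n}. \<not> int p dvd k}"
      using I(2)[OF _ _ that] by auto
    then show ?thesis unfolding N by (simp only: card_not_dvd mult.assoc)
  qed
  show "num_skew_braces G H = 0" if "exponent_dvd (p * q) H"
  proof -
    have "{k \<in> {0..<int n}. Y k \<cong> H} = {}" using I(4)[OF _ _ that] by auto
    then show ?thesis unfolding N by (simp only: card.empty mult_0_right)
  qed
qed

theorem num_skew_braces_Yp_cases:
  assumes G: "Y (int p) \<cong> G" and H: "group H"
  shows "Y 0 \<cong> H \<Longrightarrow> num_skew_braces G H = 2 * p"
    and "Y (int p) \<cong> H \<Longrightarrow> num_skew_braces G H = 2 * p * (p - 1)"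
    and "Y 1 \<cong> H \<Longrightarrow> num_skew_braces G H = 2 * p * (p - 1)"
    and "exponent_dvd (p * q) H \<Longrightarrow> num_skew_braces G H = 0"
proof -
  note N = num_skew_braces_Yp[OF G H] and I = Y_iso_iff[OF _ _ H]
  show "num_skew_braces G H = 2 * p" if "Y 0 \<cong> H"
  proof -
    have "0 \<in> reps" using p_gt_2 by (simp add: reps_def)
    then have "{k \<in> reps. Y k \<cong> H} = {0}" using I(1)[OF _ _ that] reps_range by auto
    then show ?thesis by (simp add: N)
  qed
  show "num_skew_braces G H = 2 * p * (p - 1)" if "Y (int p) \<cong> H"
  proof -
    have "int p < int n" using p_gt_2 by (simp add: int_n)
    have "{k \<in> reps. Y k \<cong> H} = {k \<in> reps. int p dvd k \<and> k \<noteq> 0}"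
      using I(3)[OF _ _ that] reps_range by blast
    also have "\<dots> = {k \<in> {0..<int n}. int p dvd k \<and> k \<noteq> 0}"
      using \<open>int p < int n\<close> unfolding reps_def by auto
    finally show ?thesis unfolding N by (simp only: card_dvd mult.assoc)
  qed
  show "num_skew_braces G H = 2 * p * (p - 1)" if "Y 1 \<cong> H"
  proof -
    have "{k \<in> reps. Y k \<cong> H} = {k \<in> reps. \<not> int p dvd k}"
      using I(2)[OF _ _ that] reps_range by auto
    then show ?thesis unfolding N by (simp only: card_reps_not_dvd mult.assoc)
  qed
  show "num_skew_braces G H = 0" if "exponent_dvd (p * q) H"
  proof -
    have "{k \<in> reps. Y k \<cong> H} = {}" using I(4)[OF _ _ that] reps_range by auto
    then show ?thesis unfolding N by (simp only: card.empty mult_0_right)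
  qed
qed

end

subsection \<open>Elementary abelian complement\<close>

locale elementary_complement =
  fixes p q w :: nat
  assumes prime_p: "Factorial_Ring.prime p" and p_gt_2: "p > 2" and less_q: "p * p < q"
    and prime_q': "Factorial_Ring.prime q" and ord_w: "ord q w = p"
begin

sublocale prime_power_root q p w
  using prime_q' ord_w p_gt_2 by unfold_locales auto

abbreviation V where "V \<equiv> integer_mod_group p \<times>\<times> integer_mod_group p"

lemma carrier_V: "carrier V = {0..<int p} \<times> {0..<int p}"
  using n_pos by (simp add: carrier_integer_mod_group)

declare carrier_DirProd [simp del]

lemma mult_V: "(x, y) \<otimes>\<^bsub>V\<^esub> (x', y') = ((x + x') mod int p, (y + y') mod int p)"
  by simp

lemma group_V: "group V" by (intro DirProd_group) simp_all

lemma comm_group_V: "comm_group V"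
  by (rule group.group_comm_groupI[OF group_V]) (auto simp: add.commute)

lemma p_gt_1: "1 < int p" using p_gt_2 by simp

text \<open>The character \<chi> is (x, y) \<mapsto> w^x, so the second coordinate is its kernel;
  the twist pairs the quotient with itself and takes values in this kernel.\<close>

definition twisted :: "int \<Rightarrow> (int \<times> int) monoid" where
  "twisted m = \<lparr>carrier = carrier V,
    monoid.mult = (\<lambda>(x, y) (x', y'). ((x + x') mod int p, (y + y' + m * x * x') mod int p)),
    one = (0, 0)\<rparr>"

lemma twisted_simps [simp]: "carrier (twisted m) = carrier V"
  "(x, y) \<otimes>\<^bsub>twisted m\<^esub> (x', y') = ((x + x') mod int p, (y + y' + m * x * x') mod int p)"
  "\<one>\<^bsub>twisted m\<^esub> = (0, 0)"
  by (simp_all add: twisted_def)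

definition untwist :: "int \<Rightarrow> int \<times> int \<Rightarrow> int \<times> int" where
  "untwist m = (\<lambda>(x, y). (x, (y - m * triangle x) mod int p))"

lemma untwist: "untwist m (x, y) = (x, (y - m * triangle x) mod int p)"
  by (simp add: untwist_def)

lemma triangle_mod: "[triangle (x mod int p) = triangle x] (mod int p)"
  by (rule triangle_cong[OF prime_p p_gt_2]) simp

lemma untwist_hom: "untwist m (s \<otimes>\<^bsub>twisted m\<^esub> t) = untwist m s \<otimes>\<^bsub>V\<^esub> untwist m t"
proof -
  obtain x y x' y' where st: "s = (x, y)" "t = (x', y')" by (metis surj_pair)
  have "[(y + y' + m * x * x') mod int p - m * triangle ((x + x') mod int p)
      = y + y' + m * x * x' - m * triangle (x + x')] (mod int p)"
    by (intro cong_diff cong_mult cong_refl triangle_mod) simp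
  moreover have "y + y' + m * x * x' - m * triangle (x + x') = (y - m * triangle x) + (y' - m * triangle x')"
    by (simp add: triangle_add algebra_simps)
  ultimately show ?thesis
    by (simp add: st untwist cong_def mod_add_eq)
qed

lemma untwist_bij: "bij_betw (untwist m) (carrier V) (carrier V)"
  using n_pos
  by (intro bij_betw_byWitness[where f' = "\<lambda>(x, y). (x, (y + m * triangle x) mod int p)"])
    (auto simp: untwist carrier_V mod_simps)

lemma group_twisted: "group (twisted m)"
proof (rule group_of_bij_hom[OF group_V, of "untwist m"])
  show "x \<otimes>\<^bsub>twisted m\<^esub> y \<in> carrier (twisted m) \<and>
    untwist m (x \<otimes>\<^bsub>twisted m\<^esub> y) = untwist m x \<otimes>\<^bsub>V\<^esub> untwist m y" for x y
    using untwist_hom[of m x y] n_pos by (cases x; cases y) (simp add: carrier_V)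
qed (use untwist_bij n_pos in \<open>auto simp: carrier_V untwist\<close>)

lemma untwist_iso: "untwist m \<in> iso (twisted m) V"
proof (rule isoI)
  show "untwist m \<in> hom (twisted m) V"
    using untwist_bij[of m] untwist_hom[of m] unfolding bij_betw_def hom_def by auto
qed (use untwist_bij in auto)

lemma skew_brace_twisted: "skew_brace V (twisted m)"
proof (rule skew_brace_of_act[of _ _ "\<lambda>(x, y) (x', y'). (x', (y' + m * x * x') mod int p)"])
  show "(case s of (x, y) \<Rightarrow> \<lambda>(x', y'). (x', (y' + m * x * x') mod int p)) \<in> hom V V" for s
  proof -
    obtain x y where s: "s = (x, y)" by (cases s)
    have "[b + b' + m * x * ((a + a') mod int p) = b + b' + m * x * (a + a')] (mod int p)" for a b a' b'
      by (intro cong_add cong_refl cong_scalar_left) simp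
    then have "(b + b' + m * x * ((a + a') mod int p)) mod int p
        = ((b + m * x * a) + (b' + m * x * a')) mod int p" for a b a' b'
      by (simp add: cong_def algebra_simps)
    then show ?thesis
      using n_pos unfolding s
      by (auto simp: hom_def carrier_V mod_simps)
  qed
next
  fix s t assume "s \<in> carrier V" "t \<in> carrier V"
  show "s \<otimes>\<^bsub>twisted m\<^esub> t = s \<otimes>\<^bsub>V\<^esub> (case s of (x, y) \<Rightarrow> \<lambda>(x', y'). (x', (y' + m * x * x') mod int p)) t"
    by (cases s; cases t) (simp add: mod_simps add.assoc)
qed (use group_V group_twisted in auto)

definition chi :: "int \<Rightarrow> int \<Rightarrow> int \<times> int \<Rightarrow> int" where
  "chi a b = (\<lambda>(x, y). hpow (a * x + b * y))"

lemma chi: "chi a b (x, y) = hpow (a * x + b * y)" by (simp add: chi_def)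

definition psi :: "int \<Rightarrow> int \<Rightarrow> int \<Rightarrow> int \<times> int \<Rightarrow> int" where
  "psi m a b s = chi a b (untwist m s)"

lemma chi_mult: "[chi a b (s \<otimes>\<^bsub>V\<^esub> t) = chi a b s * chi a b t] (mod int q)"
proof -
  obtain x y x' y' where st: "s = (x, y)" "t = (x', y')" by (metis surj_pair)
  have "[a * ((x + x') mod int p) + b * ((y + y') mod int p) = a * (x + x') + b * (y + y')] (mod int p)"
    by (intro cong_add cong_scalar_left) simp_all
  also have "a * (x + x') + b * (y + y') = (a * x + b * y) + (a * x' + b * y')"
    by (simp add: algebra_simps)
  finally show ?thesis unfolding st mult_V chi by (rule hpow_cong_add)
qed

lemma mod_char_chi: "mod_char q V (chi a b)"
  using chi_mult by (simp add: mod_char_def chi)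

lemma mod_char_psi: "mod_char q (twisted m) (psi m a b)"
  using chi_mult by (simp add: mod_char_def psi_def untwist_hom untwist chi del: twisted_simps(2))

lemma psi_m_one: "s \<in> carrier V \<Longrightarrow> psi m 1 0 s = chi 1 0 s"
  by (cases s) (simp add: psi_def chi untwist)

text \<open>\<open>untwist\<close> leaves the first coordinate alone, and \<chi> reads only that
  coordinate, so \<chi> coincides with \<open>psi m 1 0\<close>.\<close>

lemma mod_char_chi_twisted: "mod_char q (twisted m) (chi 1 0)"
proof -
  have "s \<otimes>\<^bsub>twisted m\<^esub> t \<in> carrier V" if "s \<in> carrier V" "t \<in> carrier V" for s t
    using monoid.m_closed[OF group.is_monoid[OF group_twisted], of s m t] that
    by (simp del: twisted_simps(2))
  then show ?thesis
    using mod_char_psi[of m 1 0] psi_m_one[of "(0, 0)" m] n_pos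
    by (simp add: mod_char_def psi_m_one chi carrier_V[symmetric] del: twisted_simps(2))
qed

lemma hpow_eq_one_iff: "[hpow a = 1] (mod int q) \<longleftrightarrow> int p dvd a"
  using hpow_cong_iff[of a 0] by (simp add: cong_0_iff)

sublocale prime_char V q "chi 1 0" "(1, 0)"
proof (rule prime_char.intro)
  show "\<not> [chi 1 0 (1, 0) = 1] (mod int q)"
    using p_gt_2 by (simp add: chi hpow_eq_one_iff)
  show "card (carrier V) < q" using less_q by (simp add: carrier_V card_cartesian_product)
qed (use comm_group_V prime_q' mod_char_chi p_gt_1 in \<open>auto simp: carrier_V\<close>)

text \<open>Maps compatible with \<chi> preserve the first coordinate, so only a linear form in (x,
  y) remains for the second.\<close>

lemma hom_V_form:
  assumes F: "F \<in> hom V V" and fst: "\<And>s. s \<in> carrier V \<Longrightarrow> fst (F s) = fst s"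
    and s: "(x, y) \<in> carrier V"
  shows "F (x, y) = (x, (snd (F (1, 0)) * x + snd (F (0, 1)) * y) mod int p)"
proof -
  have pow: "F (s [^]\<^bsub>V\<^esub> (k::nat)) = F s [^]\<^bsub>V\<^esub> k" if "s \<in> carrier V" for s k
    using hom_nat_pow[OF F that group_V group_V] .
  have xy: "0 \<le> x" "x < int p" "0 \<le> y" "y < int p" using s by (auto simp: carrier_V)
  have c: "(1, 0) \<in> carrier V" "(0, 1) \<in> carrier V" "(x, 0) \<in> carrier V" "(0, y) \<in> carrier V"
    using p_gt_1 xy by (auto simp: carrier_V)
  have "F (x, 0) = F ((1, 0) [^]\<^bsub>V\<^esub> nat x)" using xy by (simp add: nat_pow_DirProd)
  also have "\<dots> = F (1, 0) [^]\<^bsub>V\<^esub> nat x" by (rule pow[OF c(1)])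
  finally have 1: "snd (F (x, 0)) = (snd (F (1, 0)) * x) mod int p"
    using xy by (cases "F (1, 0)") (simp add: nat_pow_DirProd mult.commute)
  have "F (0, y) = F ((0, 1) [^]\<^bsub>V\<^esub> nat y)" using xy by (simp add: nat_pow_DirProd)
  also have "\<dots> = F (0, 1) [^]\<^bsub>V\<^esub> nat y" by (rule pow[OF c(2)])
  finally have 2: "snd (F (0, y)) = (snd (F (0, 1)) * y) mod int p"
    using xy by (cases "F (0, 1)") (simp add: nat_pow_DirProd mult.commute)
  have "F (x, y) = F (x, 0) \<otimes>\<^bsub>V\<^esub> F (0, y)"
    using hom_mult[OF F c(3,4)] xy by simp
  then have "snd (F (x, y)) = (snd (F (x, 0)) + snd (F (0, y))) mod int p"
    by (simp add: mult_DirProd')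
  then show ?thesis using fst[OF s] 1 2 by (simp add: prod_eq_iff mod_simps)
qed

text \<open>The action of s is (x, y) \<mapsto> (x, g0 s x + l s y). Here l is a character modulo p
  of a group of order p^2: its p^2-th power is 1, and Fermat reduces that power to l itself, so l =
  1. The shear coefficient g turns out to be linear in the first coordinate of s alone, and \<psi>
  is fixed by its values at (1, 0) and (0, 1).\<close>

lemma complete_data:
  assumes Q: "skew_brace V Q" "mod_char q Q (chi 1 0)" "mod_char q Q \<psi>"
  obtains m a b where "char_brace_iso V q (chi 1 0) (twisted m) (psi m a b) Q \<psi> (\<lambda>x. x)"
proof -
  interpret Q: skew_brace V Q by fact
  let ?u = "(1, 0) :: int \<times> int" and ?v = "(0, 1) :: int \<times> int"
  have c: "?u \<in> carrier V" "?v \<in> carrier V" using p_gt_1 by (auto simp: carrier_V)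
  define l where "l s = snd (brace_act V Q s ?v)" for s
  define g0 where "g0 s = snd (brace_act V Q s ?u)" for s
  have fst_act: "fst (brace_act V Q s t) = fst t" if "s \<in> carrier V" "t \<in> carrier V" for s t
  proof -
    have "[chi 1 0 (brace_act V Q s t) = chi 1 0 t] (mod int q)"
      using chi_act Q that by blast
    then have "[fst (brace_act V Q s t) = fst t] (mod int p)"
      by (cases "brace_act V Q s t"; cases t) (simp add: chi hpow_cong_iff)
    moreover have "brace_act V Q s t \<in> carrier V" using that by (rule Q.brace_act_closed)
    ultimately show ?thesis using that by (auto simp: carrier_V cong_def)
  qed
  have act: "brace_act V Q s (x, y) = (x, (g0 s * x + l s * y) mod int p)"
    if "s \<in> carrier V" "(x, y) \<in> carrier V" for s x y
    unfolding g0_def l_def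
    using hom_V_form[OF iso_imp_homomorphism[OF Q.brace_act_iso[OF that(1)]] fst_act[OF that(1)] that(2)] .
  have act_v: "brace_act V Q s ?v = (0, l s)" and act_u: "brace_act V Q s ?u = (1, g0 s)"
    and range: "0 \<le> l s" "l s < int p" "0 \<le> g0 s" "g0 s < int p" if "s \<in> carrier V" for s
    using fst_act[OF that c(1)] fst_act[OF that c(2)]
      Q.brace_act_closed[OF that c(1)] Q.brace_act_closed[OF that c(2)]
    by (auto simp: l_def g0_def carrier_V prod_eq_iff)
  have comp: "brace_act V Q (s \<otimes>\<^bsub>Q\<^esub> t) r = brace_act V Q s (brace_act V Q t r)"
    if "s \<in> carrier V" "t \<in> carrier V" "r \<in> carrier V" for s t r
    using that by (rule Q.brace_act_mult)
  have l_one: "[l s = 1] (mod int p)" if s: "s \<in> carrier V" for s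
  proof -
    have l_mult: "[l (s \<otimes>\<^bsub>Q\<^esub> t) = l s * l t] (mod int p)" if st: "s \<in> carrier V" "t \<in> carrier V" for s t
    proof -
      have "(0, l (s \<otimes>\<^bsub>Q\<^esub> t)) = brace_act V Q s (0, l t)"
        using comp[OF st c(2)] act_v st Q.mult_closed[OF st] by simp
      then show ?thesis
        using act[OF st(1), of 0 "l t"] range[OF st(2)] p_gt_1 by (simp add: carrier_V cong_def)
    qed
    have "brace_act V Q \<one>\<^bsub>V\<^esub> ?v = ?v"
      using Q.mult.l_one[of ?v] c Q.carrier_eq Q.one_eq Q.mult_eq_act[of "\<one>\<^bsub>V\<^esub>" ?v]
        Q.brace_act_closed[of "\<one>\<^bsub>V\<^esub>" ?v] by (simp del: one_DirProd)
    then have l1: "[l \<one>\<^bsub>Q\<^esub> = 1] (mod int p)" using Q.one_eq by (simp add: l_def)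
    have mc: "mod_char p Q l"
      unfolding mod_char_def Q.carrier_eq using l1 l_mult by blast
    have sQ: "s \<in> carrier Q" using s Q.carrier_eq by simp
    have "s [^]\<^bsub>Q\<^esub> (p * p) = \<one>\<^bsub>Q\<^esub>"
      using Q.mult.pow_order_eq_1[OF sQ] by (simp add: order_def Q.carrier_eq carrier_V card_cartesian_product)
    then have "[l \<one>\<^bsub>Q\<^esub> = l s ^ (p * p)] (mod int p)"
      using mod_char_nat_pow[OF Q.mult.is_group mc sQ, of "p * p"] by simp
    with l1 have lpp: "[l s ^ (p * p) = 1] (mod int p)" by (simp add: cong_def)
    have "\<not> [l s = 0] (mod int p)"
    proof
      assume "[l s = 0] (mod int p)"
      then have "[l s ^ (p * p) = 0 ^ (p * p)] (mod int p)" by (rule cong_pow)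
      with lpp show False using p_gt_2 by (simp add: cong_def power_0_left)
    qed
    then have "[l s ^ (p - 1) * l s = 1 * l s] (mod int p)"
      by (intro cong_scalar_right fermat_int prime_p)
    then have lp: "[l s ^ p = l s] (mod int p)" using p_gt_2 by (simp flip: power_Suc2)
    have "[(l s ^ p) ^ p = l s ^ p] (mod int p)" by (intro cong_pow lp)
    then have "[l s ^ (p * p) = l s] (mod int p)" using lp cong_trans by (simp add: power_mult)
    then show ?thesis using lpp by (rule cong_via)
  qed
  define g where "g x y = g0 (x mod int p, y mod int p)" for x y
  have mem: "(x mod int p, y mod int p) \<in> carrier V" for x y using n_pos by (simp add: carrier_V)
  have act': "brace_act V Q (x mod int p, y mod int p) (x', y') = (x', (y' + g x y * x') mod int p)"
    if "(x', y') \<in> carrier V" for x y x' y'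
  proof -
    have "[g x y * x' + l (x mod int p, y mod int p) * y' = g x y * x' + 1 * y'] (mod int p)"
      by (intro cong_add cong_scalar_right cong_refl l_one mem)
    then show ?thesis using act[OF mem that] by (simp add: g_def cong_def add.commute)
  qed
  have mult: "(x mod int p, y mod int p) \<otimes>\<^bsub>Q\<^esub> (x' mod int p, y' mod int p)
      = ((x + x') mod int p, (y + y' + g x y * x') mod int p)" for x y x' y'
    using Q.mult_eq_act[OF mem mem, of x y x' y'] act'[OF mem, of x y x' y']
    by (simp add: mod_simps mod_add_mult_mod add.assoc)
  have g_mult: "[g (x + x') (y + y' + g x y * x') = g x y + g x' y'] (mod int p)" for x y x' y'
  proof -
    let ?s = "(x mod int p, y mod int p)" and ?t = "(x' mod int p, y' mod int p)"
    have "brace_act V Q (?s \<otimes>\<^bsub>Q\<^esub> ?t) ?u = brace_act V Q ?s (1, g x' y')"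
      using comp[OF mem mem c(1)] act_u[OF mem, of x' y'] by (simp add: g_def)
    also have "\<dots> = (1, (g x' y' + g x y * 1) mod int p)"
      using range[OF mem] p_gt_1 by (intro act') (simp add: carrier_V g_def)
    finally show ?thesis
      unfolding mult using act'[OF c(1), of "x + x'" "y + y' + g x y * x'"]
      by (simp add: cong_def add.commute)
  qed
  \<comment> \<open>For x' = 0 the twist in \<open>g_mult\<close> disappears.\<close>
  have g_y: "[g x (y + y') = g x y + g 0 y'] (mod int p)" for x y y'
    using g_mult[of x 0 y y'] by simp
  have g_00: "[g 0 0 = 0] (mod int p)" using g_y[of 0 0 0] by (simp add: cong_iff_dvd_diff)
  have g_0_nat: "[g 0 (int k) = int k * g 0 1] (mod int p)" for k
  proof (induction k)
    case (Suc k)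
    have "[g 0 (int k + 1) = g 0 (int k) + g 0 1] (mod int p)" by (rule g_y)
    also have "[g 0 (int k) + g 0 1 = int k * g 0 1 + g 0 1] (mod int p)"
      by (intro cong_add Suc cong_refl)
    finally show ?case by (simp add: algebra_simps)
  qed (use g_00 in simp)
  have c0: "[g 0 1 = 0] (mod int p)"
  proof -
    let ?c = "g 0 1"
    have r: "0 \<le> ?c" "?c < int p" using range[OF mem[of 0 1]] by (simp_all add: g_def)
    \<comment> \<open>The product of (0, 1) and (1, 0) is (1, 1 + c). Evaluating g there by
      \<open>g_mult\<close> and by additivity in y leaves c^2 = 0.\<close>
    have "[g 1 (1 + ?c) = ?c + g 1 0] (mod int p)" using g_mult[of 0 1 1 0] by simp
    moreover have "[g 1 (1 + ?c) = g 1 1 + g 0 ?c] (mod int p)" by (rule g_y)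
    ultimately have "[?c + g 1 0 = g 1 1 + g 0 ?c] (mod int p)" by (rule cong_via)
    moreover have "[g 1 1 + g 0 ?c = (g 1 0 + ?c) + ?c * ?c] (mod int p)"
      using g_y[of 1 0 1] g_0_nat[of "nat ?c"] r by (intro cong_add) auto
    ultimately have "[?c + g 1 0 = (g 1 0 + ?c) + ?c * ?c] (mod int p)" by (rule cong_trans)
    then have "int p dvd ?c * ?c" by (simp add: cong_iff_dvd_diff)
    then show ?thesis using prime_p by (simp add: prime_dvd_mult_iff cong_0_iff)
  qed
  have g_0: "[g 0 y = 0] (mod int p)" for y
  proof -
    have y: "int (nat (y mod int p)) = y mod int p" using n_pos by simp
    have "g 0 y = g 0 (y mod int p)" by (simp add: g_def)
    then have "[g 0 y = (y mod int p) * g 0 1] (mod int p)"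
      using g_0_nat[of "nat (y mod int p)"] unfolding y by simp
    also have "[(y mod int p) * g 0 1 = (y mod int p) * 0] (mod int p)"
      by (intro cong_scalar_left c0)
    finally show ?thesis by simp
  qed
  have g_y0: "[g x y = g x 0] (mod int p)" for x y
    using g_y[of x 0 y] g_0[of y] cong_add[OF cong_refl[of "g x 0"] g_0[of y]] by (simp add: cong_def)
  have g_add: "[g (x + x') 0 = g x 0 + g x' 0] (mod int p)" for x x'
    using g_mult[of x x' 0 0] g_y0[of "x + x'" "g x 0 * x'"] by (simp add: cong_def)
  define m where "m = g 1 0"
  have g_nat: "[g (int k) 0 = int k * m] (mod int p)" for k
  proof (induction k)
    case (Suc k)
    have "[g (int k + 1) 0 = g (int k) 0 + m] (mod int p)" unfolding m_def by (rule g_add)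
    also have "[g (int k) 0 + m = int k * m + m] (mod int p)"
      by (intro cong_add Suc cong_refl)
    finally show ?case by (simp add: algebra_simps)
  qed (use g_00 in simp)
  have mult_twisted: "s \<otimes>\<^bsub>Q\<^esub> t = s \<otimes>\<^bsub>twisted m\<^esub> t" if st: "s \<in> carrier V" "t \<in> carrier V" for s t
  proof -
    obtain x y x' y' where *: "s = (x, y)" "t = (x', y')" by (metis surj_pair)
    have r: "0 \<le> x" "x < int p" "0 \<le> y" "y < int p" "0 \<le> x'" "x' < int p" "0 \<le> y'" "y' < int p"
      using st * by (auto simp: carrier_V)
    have "[g x y = m * x] (mod int p)"
      using cong_trans[OF g_y0 g_nat[of "nat x"]] r by (simp add: mult.commute)
    then have "[y + y' + g x y * x' = y + y' + m * x * x'] (mod int p)"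
      by (intro cong_add cong_refl cong_scalar_right)
    then show ?thesis using mult[of x y x' y'] r by (simp add: * cong_def)
  qed
  interpret T: group "twisted m" by (rule group_twisted)
  have char_T: "mod_char q (twisted m) \<psi>"
    using Q(3) mult_twisted Q.one_eq Q.carrier_eq
    by (simp add: mod_char_def del: twisted_simps(2))
  have cT: "?u \<in> carrier (twisted m)" "?v \<in> carrier (twisted m)" using c by simp_all
  have untwist_pow: "untwist m (s [^]\<^bsub>twisted m\<^esub> (k::nat)) = untwist m s [^]\<^bsub>V\<^esub> k"
    if "s \<in> carrier (twisted m)" for s k
    by (rule hom_nat_pow[OF iso_imp_homomorphism[OF untwist_iso] that group_twisted group_V])
  have inj: "s = t" if "s \<in> carrier V" "t \<in> carrier V" "untwist m s = untwist m t" for s t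
    using untwist_bij[of m] that by (auto simp: bij_betw_def dest: inj_onD)
  have root: "\<exists>k. [\<psi> s = hpow k] (mod int q)" if s: "s \<in> carrier (twisted m)" for s
  proof -
    obtain x y where xy: "untwist m s = (x, y)" by (cases "untwist m s")
    have e: "untwist m (s [^]\<^bsub>twisted m\<^esub> p) = untwist m \<one>\<^bsub>twisted m\<^esub>"
      by (simp add: untwist_pow[OF s] xy nat_pow_DirProd untwist)
    have "s [^]\<^bsub>twisted m\<^esub> p = \<one>\<^bsub>twisted m\<^esub>"
      using T.nat_pow_closed[OF s, of p] T.one_closed unfolding twisted_simps(1)
      by (rule inj[OF _ _ e])
    moreover have "[\<psi> \<one>\<^bsub>twisted m\<^esub> = 1] (mod int q)"
      using char_T unfolding mod_char_def by blast
    ultimately have "[\<psi> s ^ p = 1] (mod int q)"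
      using mod_char_nat_pow[OF group_twisted char_T s, of p] by (simp add: cong_def)
    then show ?thesis by (rule root_of_unity_eq_hpow) blast
  qed
  obtain a where a: "[\<psi> ?u = hpow a] (mod int q)" using root[OF cT(1)] by blast
  obtain b where b: "[\<psi> ?v = hpow b] (mod int q)" using root[OF cT(2)] by blast
  have psi: "[\<psi> s = psi m a b s] (mod int q)" if s: "s \<in> carrier V" for s
  proof -
    \<comment> \<open>The pair (x, z) gives the exponents of s as a product of powers of the
      generators (1, 0) and (0, 1) of \<open>twisted m\<close>.\<close>
    obtain x z where xz: "untwist m s = (x, z)" by (cases "untwist m s")
    then have "(x, z) \<in> carrier V" using untwist_bij[of m] s by (metis bij_betw_apply)
    then have r: "0 \<le> x" "x < int p" "0 \<le> z" "z < int p" by (auto simp: carrier_V)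
    let ?r = "?u [^]\<^bsub>twisted m\<^esub> nat x" and ?t = "?v [^]\<^bsub>twisted m\<^esub> nat z"
    have rt: "?r \<in> carrier (twisted m)" "?t \<in> carrier (twisted m)" using cT by blast+
    have "untwist m (?r \<otimes>\<^bsub>twisted m\<^esub> ?t) = untwist m s"
      unfolding untwist_hom untwist_pow[OF cT(1)] untwist_pow[OF cT(2)] untwist nat_pow_DirProd
      using r p_gt_1 by (simp add: xz)
    then have s_eq: "?r \<otimes>\<^bsub>twisted m\<^esub> ?t = s"
      by (rule inj[OF T.m_closed[OF rt, unfolded twisted_simps(1)] s])
    have "[\<psi> s = \<psi> ?r * \<psi> ?t] (mod int q)"
      using char_T rt s_eq unfolding mod_char_def by blast
    also have "[\<psi> ?r * \<psi> ?t = hpow (a * x) * hpow (b * z)] (mod int q)"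
    proof (rule cong_mult)
      have "[\<psi> ?r = hpow a ^ nat x] (mod int q)"
        using mod_char_nat_pow[OF group_twisted char_T cT(1)] cong_pow[OF a] by (rule cong_trans)
      then show "[\<psi> ?r = hpow (a * x)] (mod int q)"
        using hpow_power[of a "nat x"] r cong_trans by simp
      have "[\<psi> ?t = hpow b ^ nat z] (mod int q)"
        using mod_char_nat_pow[OF group_twisted char_T cT(2)] cong_pow[OF b] by (rule cong_trans)
      then show "[\<psi> ?t = hpow (b * z)] (mod int q)"
        using hpow_power[of b "nat z"] r cong_trans by simp
    qed
    also have "[hpow (a * x) * hpow (b * z) = psi m a b s] (mod int q)"
      unfolding psi_def xz chi by (rule cong_sym[OF hpow_add])
    finally show ?thesis .
  qed
  have "(\<lambda>x. x) \<in> iso (twisted m) Q"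
    using mult_twisted Q.carrier_eq
    by (simp add: Group.iso_def hom_def bij_betw_def inj_on_def del: twisted_simps(2))
  then have "char_brace_iso V q (chi 1 0) (twisted m) (psi m a b) Q \<psi> (\<lambda>x. x)"
    using psi by (simp add: char_brace_iso_def iso_set_refl)
  then show ?thesis by (rule that)
qed

section \<open>Isomorphisms between the data on the elementary abelian complement\<close>

definition shear :: "int \<Rightarrow> int \<Rightarrow> int \<times> int \<Rightarrow> int \<times> int" where
  "shear k l = (\<lambda>(x, y). (x, (k * x + l * y) mod int p))"

lemma shear: "shear k l (x, y) = (x, (k * x + l * y) mod int p)" by (simp add: shear_def)

lemma inverse_mod_p:
  assumes "\<not> int p dvd l" obtains v where "[l * v = 1] (mod int p)"
proof -
  have "coprime l (int p)"
    using assms prime_p by (metis coprime_commute prime_imp_coprime prime_nat_int_transfer)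
  then show ?thesis using that cong_solve_coprime_int by blast
qed

lemma mod_p_cancel: "[l * v = 1] (mod int p) \<Longrightarrow> [l * a = l * b] (mod int p) \<Longrightarrow> [a = b] (mod int p)"
proof -
  assume v: "[l * v = 1] (mod int p)" and ab: "[l * a = l * b] (mod int p)"
  have "coprime l (int p)" using v coprime_iff_invertible_int by blast
  then show "[a = b] (mod int p)" using ab cong_mult_lcancel by blast
qed

lemma bij_shear:
  assumes "\<not> int p dvd l" shows "bij_betw (shear k l) (carrier V) (carrier V)"
proof -
  obtain v where v: "[l * v = 1] (mod int p)" by (rule inverse_mod_p[OF assms])
  have "inj_on (shear k l) (carrier V)"
  proof (rule inj_onI)
    fix s t assume st: "s \<in> carrier V" "t \<in> carrier V" "shear k l s = shear k l t"
    obtain x y y' where *: "s = (x, y)" "t = (x, y')"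
      using st(3) by (cases s; cases t) (auto simp: shear)
    have "[k * x + l * y = k * x + l * y'] (mod int p)" using st(3) by (simp add: * shear cong_def)
    then have "[l * y = l * y'] (mod int p)" by (simp add: cong_add_lcancel)
    then have "[y = y'] (mod int p)" by (rule mod_p_cancel[OF v])
    then show "s = t" using st(1,2) by (simp add: * carrier_V cong_def)
  qed
  moreover have "shear k l ` carrier V \<subseteq> carrier V" using n_pos by (auto simp: shear carrier_V)
  moreover have "finite (carrier V)" by (simp add: carrier_V)
  ultimately show ?thesis using endo_inj_surj by (simp add: bij_betw_def)
qed

text \<open>The linear part k x is additive for the twisted product, and l scales its twist m x x',
  which must become m' x x'.\<close>

lemma shear_iso:
  assumes "\<not> int p dvd l" "[m' = l * m] (mod int p)"
  shows "shear k l \<in> iso (twisted m) (twisted m')"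
proof (rule isoI)
  show "shear k l \<in> hom (twisted m) (twisted m')"
  proof (rule homI)
    show "shear k l s \<in> carrier (twisted m')" if "s \<in> carrier (twisted m)" for s
      using bij_shear[OF assms(1), of k] that by (auto simp: bij_betw_def)
    fix s t assume "s \<in> carrier (twisted m)" "t \<in> carrier (twisted m)"
    obtain x y x' y' where *: "s = (x, y)" "t = (x', y')" by (metis surj_pair)
    have "[k * ((x + x') mod int p) + l * ((y + y' + m * x * x') mod int p)
        = k * (x + x') + l * (y + y' + m * x * x')] (mod int p)"
      by (intro cong_add cong_scalar_left) simp_all
    also have "k * (x + x') + l * (y + y' + m * x * x') = (k * x + l * y) + (k * x' + l * y') + l * m * x * x'"
      by (simp add: algebra_simps)
    also have "[(k * x + l * y) + (k * x' + l * y') + l * m * x * x'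
        = (k * x + l * y) mod int p + (k * x' + l * y') mod int p + m' * x * x'] (mod int p)"
      using cong_sym[OF assms(2)] by (intro cong_add cong_scalar_right) simp_all
    finally show "shear k l (s \<otimes>\<^bsub>twisted m\<^esub> t) = shear k l s \<otimes>\<^bsub>twisted m'\<^esub> shear k l t"
      by (simp add: * shear cong_def)
  qed
qed (use bij_shear[OF assms(1)] in simp)

lemma twisted_0_iso: "F \<in> iso (twisted 0) (twisted 0) \<longleftrightarrow> F \<in> iso V V"
proof -
  have "s \<otimes>\<^bsub>twisted 0\<^esub> t = s \<otimes>\<^bsub>V\<^esub> t" for s t by (cases s; cases t) simp
  then show ?thesis by (simp add: Group.iso_def hom_def)
qed

text \<open>Substituting y \<mapsto> k x + l y in the exponent a' x + b' y gives the rules for a and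
  b; the triangle terms match because m' = l m.\<close>

lemma char_brace_iso_shear:
  assumes l: "\<not> int p dvd l" and m: "[m' = l * m] (mod int p)"
    and a: "[a = a' + b' * k] (mod int p)" and b: "[b = b' * l] (mod int p)"
  shows "char_brace_iso V q (chi 1 0) (twisted m) (psi m a b) (twisted m') (psi m' a' b') (shear k l)"
  unfolding char_brace_iso_def
proof (intro conjI ballI)
  show "shear k l \<in> iso V V" using shear_iso[OF l, of 0 0] by (simp add: twisted_0_iso)
  show "shear k l \<in> iso (twisted m) (twisted m')" by (rule shear_iso[OF l m])
  fix s assume "s \<in> carrier V"
  obtain x y where s: "s = (x, y)" by (cases s)
  show "[chi 1 0 (shear k l s) = chi 1 0 s] (mod int q)" by (simp add: s shear chi)
  have "[a' * x + b' * (((k * x + l * y) mod int p - m' * triangle x) mod int p)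
      = a' * x + b' * ((k * x + l * y) mod int p - m' * triangle x)] (mod int p)"
    by (intro cong_add cong_scalar_left cong_refl) simp
  also have "[a' * x + b' * ((k * x + l * y) mod int p - m' * triangle x)
      = a' * x + b' * ((k * x + l * y) - l * m * triangle x)] (mod int p)"
    by (intro cong_add cong_scalar_left cong_diff cong_scalar_right cong_refl m) simp
  also have "a' * x + b' * ((k * x + l * y) - l * m * triangle x)
      = (a' + b' * k) * x + (b' * l) * (y - m * triangle x)" by (simp add: algebra_simps)
  also have "[(a' + b' * k) * x + (b' * l) * (y - m * triangle x)
      = a * x + b * ((y - m * triangle x) mod int p)] (mod int p)"
    using cong_sym[OF a] cong_sym[OF b] by (intro cong_add cong_mult) simp_all
  finally show "[psi m' a' b' (shear k l s) = psi m a b s] (mod int q)"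
    by (simp add: s shear psi_def untwist chi hpow_cong_iff)
qed

text \<open>F is a shear since it preserves \<chi>. Its values on u \<circ> u, u and v, for the two
  generators u = (1, 0) and v = (0, 1), yield the rules for m, a and b.\<close>

lemma char_brace_iso_imp_cong:
  assumes F: "char_brace_iso V q (chi 1 0) (twisted m) (psi m a b) (twisted m') (psi m' a' b') F"
  obtains k l where "\<not> int p dvd l" "[m' = l * m] (mod int p)" "[a = a' + b' * k] (mod int p)"
    "[b = b' * l] (mod int p)"
proof -
  let ?u = "(1, 0) :: int \<times> int" and ?v = "(0, 1) :: int \<times> int"
  have c: "?u \<in> carrier V" "?v \<in> carrier V" "(0, 0) \<in> carrier V" using p_gt_1 by (auto simp: carrier_V)
  have iso: "F \<in> iso V V" and hom: "F \<in> hom (twisted m) (twisted m')"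
    using F by (auto simp: char_brace_iso_def Group.iso_def)
  have chars: "[chi 1 0 (F s) = chi 1 0 s] (mod int q)" "[psi m' a' b' (F s) = psi m a b s] (mod int q)"
    if "s \<in> carrier V" for s using F that unfolding char_brace_iso_def by blast+
  have homV: "F \<in> hom V V" using iso by (rule iso_imp_homomorphism)
  have fst: "fst (F s) = fst s" if s: "s \<in> carrier V" for s
  proof -
    have "[fst (F s) = fst s] (mod int p)"
      using chars(1)[OF s] by (cases "F s"; cases s) (simp add: chi hpow_cong_iff)
    moreover have "F s \<in> carrier V" using homV s by (rule hom_in_carrier)
    ultimately show ?thesis using s by (auto simp: carrier_V cong_def)
  qed
  define k where "k = snd (F ?u)"
  define l where "l = snd (F ?v)"
  have F_eq: "F s = shear k l s" if "s \<in> carrier V" for s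
    using hom_V_form[OF homV fst] that by (cases s) (simp add: shear k_def l_def)
  have "\<not> int p dvd l"
  proof
    assume "int p dvd l"
    then have "F ?v = F (0, 0)" using F_eq c by (simp add: shear)
    moreover have "inj_on F (carrier V)" using iso by (simp add: Group.iso_def bij_betw_def)
    ultimately show False using inj_onD[of F "carrier V" "(0, 1)" "(0, 0)"] c(2,3) by simp
  qed
  moreover have "[m' = l * m] (mod int p)"
  proof -
    have uu: "?u \<otimes>\<^bsub>twisted m\<^esub> ?u \<in> carrier V"
      using monoid.m_closed[OF group.is_monoid[OF group_twisted], of ?u m ?u] c by (simp del: twisted_simps(2))
    have "F (?u \<otimes>\<^bsub>twisted m\<^esub> ?u) = F ?u \<otimes>\<^bsub>twisted m'\<^esub> F ?u"
      using hom c unfolding hom_def by (simp del: twisted_simps(2))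
    then have "shear k l (?u \<otimes>\<^bsub>twisted m\<^esub> ?u) = shear k l ?u \<otimes>\<^bsub>twisted m'\<^esub> shear k l ?u"
      using F_eq[OF uu] F_eq[OF c(1)] by simp
    then have "[k * (2 mod int p) + l * (m mod int p) = k mod int p + k mod int p + m'] (mod int p)"
      by (simp add: shear cong_def)
    moreover have "[k * (2 mod int p) + l * (m mod int p) = k * 2 + l * m] (mod int p)"
      by (intro cong_add cong_scalar_left) simp_all
    moreover have "[k mod int p + k mod int p + m' = k + k + m'] (mod int p)"
      by (intro cong_add cong_refl) simp_all
    ultimately have "[k * 2 + l * m = k + k + m'] (mod int p)" by (simp add: cong_def)
    then show ?thesis by (simp add: cong_iff_dvd_diff dvd_diff_commute)
  qed
  moreover have "[a = a' + b' * k] (mod int p)"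
  proof -
    have "[a' + b' * (k mod int p) = a] (mod int p)"
      using chars(2)[OF c(1)] F_eq[OF c(1)] by (simp add: psi_def untwist shear chi hpow_cong_iff)
    moreover have "[a' + b' * (k mod int p) = a' + b' * k] (mod int p)"
      by (intro cong_add cong_scalar_left cong_refl) simp
    ultimately show ?thesis by (rule cong_via)
  qed
  moreover have "[b = b' * l] (mod int p)"
  proof -
    have "[b' * (l mod int p) = b * (1 mod int p)] (mod int p)"
      using chars(2)[OF c(2)] F_eq[OF c(2)] by (simp add: psi_def untwist shear chi hpow_cong_iff)
    moreover have "[b' * (l mod int p) = b' * l] (mod int p)" by (intro cong_scalar_left) simp
    ultimately have "[b * (1 mod int p) = b' * l] (mod int p)" by (rule cong_via)
    then show ?thesis using p_gt_1 by simp
  qed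
  ultimately show ?thesis by (rule that)
qed

section \<open>Isomorphism types of the multiplicative groups, orbits and counts\<close>

abbreviation Y where "Y a b \<equiv> char_product q V (chi a b)"

lemma group_Y: "group (Y a b)"
  using q_gt_1 by (intro group_char_product group_V mod_char_chi) auto

lemma carrier_Y: "carrier (Y a b) = {0..<int q} \<times> carrier V"
  using q_gt_1 by (simp add: carrier_char_product)

lemma char_product_twisted_iso_iff:
  "char_product q (twisted m) (psi m a b) \<cong> H \<longleftrightarrow> Y a b \<cong> H"
proof -
  have i: "char_product q (twisted m) (psi m a b) \<cong> Y a b"
    using q_gt_1 by (intro is_isoI[OF char_product_iso[OF untwist_iso]]) (simp_all add: psi_def)
  have "group (char_product q (twisted m) (psi m a b))"
    using q_gt_1 by (intro group_char_product group_twisted mod_char_psi) simp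
  then have "Y a b \<cong> char_product q (twisted m) (psi m a b)" using i by (rule group.iso_sym)
  then show ?thesis using i iso_trans by blast
qed

lemma Y_zero_iso:
  assumes "int p dvd a" "int p dvd b" shows "Y a b \<cong> Y 0 0"
proof (rule is_isoI[OF char_product_iso[OF iso_set_refl]])
  show "[chi 0 0 t = chi a b t] (mod int q)" for t
    using assms by (cases t) (simp add: chi cong_sym_eq[of 1] hpow_eq_one_iff)
qed (use q_gt_1 in simp)

text \<open>A nonzero linear form (a, b) becomes the first coordinate of an automorphism: (x, y)
  \<mapsto> (a x + b y, y) if a is invertible, and (a x + b y, x) otherwise.\<close>

lemma Y_nonzero_iso:
  assumes "\<not> (int p dvd a \<and> int p dvd b)" shows "Y a b \<cong> Y 1 0"
proof -
  have *: "Y a b \<cong> Y 1 0" if h: "h \<in> iso V V" "\<And>t. t \<in> carrier V \<Longrightarrow> [fst (h t) = a * fst t + b * snd t] (mod int p)" for h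
  proof (rule is_isoI[OF char_product_iso[OF h(1)]])
    show "[chi 1 0 (h t) = chi a b t] (mod int q)" if "t \<in> carrier V" for t
      using h(2)[OF that] by (cases t; cases "h t") (simp add: chi hpow_cong_iff)
  qed (use q_gt_1 in simp)
  have swap: "prod.swap \<in> iso V V"
    by (auto simp: Group.iso_def hom_def bij_betw_def inj_on_def carrier_V image_iff)
  have sh: "shear k l \<in> iso V V" if "\<not> int p dvd l" for k l
    using shear_iso[OF that, of 0 0] by (simp add: twisted_0_iso)
  show ?thesis
  proof (cases "int p dvd a")
    case False
    have "prod.swap \<circ> (shear b a \<circ> prod.swap) \<in> iso V V"
      using iso_set_trans[OF iso_set_trans[OF swap sh[OF False]] swap] .
    then show ?thesis by (rule *) (auto simp: shear add.commute)
  next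
    case True
    then have "\<not> int p dvd b" using assms by simp
    then have "prod.swap \<circ> shear a b \<in> iso V V" using iso_set_trans[OF sh swap] by blast
    then show ?thesis by (rule *) (auto simp: shear)
  qed
qed

lemma commuting_Y: "commuting (Y a b) \<longleftrightarrow> int p dvd a \<and> int p dvd b"
proof
  assume com: "commuting (Y a b)"
  have comm: "(0, s) \<otimes>\<^bsub>Y a b\<^esub> (1, (0, 0)) = (1, (0, 0)) \<otimes>\<^bsub>Y a b\<^esub> (0, s)" if "s \<in> carrier V" for s
  proof -
    have "(0, s) \<in> carrier (Y a b)" "(1, (0, 0)) \<in> carrier (Y a b)"
      using q_gt_1 p_gt_1 that by (auto simp: carrier_Y carrier_V)
    then show ?thesis using com unfolding commuting_def by blast
  qed
  have "[hpow a = 1] (mod int q)" "[hpow b = 1] (mod int q)"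
    using comm[of "(1, 0)"] comm[of "(0, 1)"] q_gt_1 p_gt_1 by (simp_all add: carrier_V chi cong_def)
  then show "int p dvd a \<and> int p dvd b" by (simp add: hpow_eq_one_iff)
next
  assume ab: "int p dvd a \<and> int p dvd b"
  have A: "[chi a b s * c = c] (mod int q)" for s c
  proof -
    have "[chi a b s = 1] (mod int q)" using ab by (cases s) (simp add: chi hpow_eq_one_iff)
    from cong_scalar_right[OF this, of c] show ?thesis by simp
  qed
  have "[c + chi a b s * d = d + chi a b t * c] (mod int q)" for c d s t
    using cong_add[OF cong_refl[of c] A[of s d]] cong_add[OF cong_refl[of d] A[of t c]]
    by (simp add: cong_def add.commute)
  then show "commuting (Y a b)"
    by (auto simp: commuting_def carrier_Y cong_def add.commute)
qed

lemma Y_iso_iff: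
  fixes H :: "'c monoid"
  assumes H: "group H"
  shows "Y 0 0 \<cong> H \<Longrightarrow> Y a b \<cong> H \<longleftrightarrow> int p dvd a \<and> int p dvd b"
    and "Y 1 0 \<cong> H \<Longrightarrow> Y a b \<cong> H \<longleftrightarrow> \<not> (int p dvd a \<and> int p dvd b)"
proof -
  have inv: "commuting H \<longleftrightarrow> int p dvd c \<and> int p dvd d" if "Y c d \<cong> H" for c d
    using iso_invariants(1)[OF group_Y H that] commuting_Y[of c d] by auto
  have tr: "Y a b \<cong> H" if "Y a b \<cong> Y c d" "Y c d \<cong> H" for c d
    using that iso_trans by blast
  show "Y a b \<cong> H \<longleftrightarrow> int p dvd a \<and> int p dvd b" if "Y 0 0 \<cong> H"
    using inv[OF that] inv[of a b] tr[OF Y_zero_iso that] by auto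
  show "Y a b \<cong> H \<longleftrightarrow> \<not> (int p dvd a \<and> int p dvd b)" if "Y 1 0 \<cong> H"
    using inv[OF that] inv[of a b] tr[OF Y_nonzero_iso that] p_gt_2 by auto
qed

text \<open>Orbits of (m, a, b). If b = 0, then a is invariant and m can be scaled to 0 or 1, giving
  2p orbits. If b \<noteq> 0, then k removes a; for m = 0 the scaling makes b = 1, and for m
  \<noteq> 0 it makes m = 1 and leaves the invariant b m. In all 2p + 1 + (p - 1) = 3p.\<close>

definition reps :: "(int \<times> int \<times> int) set" where
  "reps = {0, 1} \<times> {0..<int p} \<times> {0} \<union> {(0, 0, 1)} \<union> {1} \<times> {0} \<times> {1..<int p}"

lemma reps_complete:
  obtains m a b k l where "(m, a, b) \<in> reps" "\<not> int p dvd l" "[m' = l * m] (mod int p)"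
    "[a = a' + b' * k] (mod int p)" "[b = b' * l] (mod int p)"
proof -
  have one: "\<not> int p dvd 1" using p_gt_2 by simp
  have r: "0 \<le> c mod int p" "c mod int p < int p" for c using n_pos by auto
  show ?thesis
  proof (cases "int p dvd b'")
    case True
    then have b: "[0 = b' * l] (mod int p)" for l by (simp add: cong_iff_dvd_diff)
    show ?thesis
    proof (cases "int p dvd m'")
      case True
      show ?thesis
        by (rule that[of 0 "a' mod int p" 0 1 0])
          (use b[of 1] True r one in \<open>auto simp: reps_def cong_0_iff\<close>)
    next
      case False
      show ?thesis
        by (rule that[of 1 "a' mod int p" 0 m' 0]) (use b[of m'] False r in \<open>auto simp: reps_def\<close>)
    qed
  next
    case False
    obtain v where v: "[b' * v = 1] (mod int p)" by (rule inverse_mod_p[OF False])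
    \<comment> \<open>The choice k = -a'/b' moves a to 0.\<close>
    have a: "[0 = a' + b' * (- v * a')] (mod int p)"
    proof -
      have "[a' + (b' * v) * (- a') = a' + 1 * (- a')] (mod int p)"
        by (intro cong_add cong_scalar_right v cong_refl)
      then show ?thesis by (simp add: cong_sym_eq[of 0] ac_simps)
    qed
    show ?thesis
    proof (cases "int p dvd m'")
      case True
      have "\<not> int p dvd v"
      proof
        assume "int p dvd v"
        from dvd_diff[OF dvd_mult[OF this, of b'] v[unfolded cong_iff_dvd_diff]] show False
          using p_gt_2 by simp
      qed
      \<comment> \<open>With m = 0 the factor l is free, and l = 1/b' gives b = 1.\<close>
      then show ?thesis
        by (intro that[of 0 0 1 v "- v * a'"])
          (use True a v in \<open>auto simp: reps_def cong_0_iff cong_sym_eq[of 1]\<close>)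
    next
      case m: False
      then have "\<not> int p dvd b' * m'" using False prime_p by (simp add: prime_dvd_mult_iff)
      then have "b' * m' mod int p \<noteq> 0" by (simp add: dvd_eq_mod_eq_0)
      then have "b' * m' mod int p \<in> {1..<int p}" using r[of "b' * m'"] by auto
      \<comment> \<open>Normalizing m to 1 uses up l = m', and b becomes b' m'.\<close>
      then show ?thesis
        by (intro that[of 1 0 "b' * m' mod int p" m' "- v * a'"]) (use m a in \<open>auto simp: reps_def\<close>)
    qed
  qed
qed

text \<open>For m = 1 the factor l is 1, so b is fixed; for b = 0 the shift of a vanishes; in the
  other cases \<open>reps\<close> leaves a single value.\<close>

lemma reps_distinct:
  assumes d: "(m, a, b) \<in> reps" "(m', a', b') \<in> reps"
    and c: "\<not> int p dvd l" "[m' = l * m] (mod int p)" "[a = a' + b' * k] (mod int p)"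
      "[b = b' * l] (mod int p)"
  shows "(m, a, b) = (m', a', b')"
proof -
  have eqI: "x = y" if "[x = y] (mod int p)" "0 \<le> x" "x < int p" "0 \<le> y" "y < int p" for x y
    using that by (simp add: cong_def)
  have range: "0 \<le> m \<and> m \<le> 1 \<and> 0 \<le> a \<and> a < int p \<and> 0 \<le> b \<and> b < int p"
    "0 \<le> m' \<and> m' \<le> 1 \<and> 0 \<le> a' \<and> a' < int p \<and> 0 \<le> b' \<and> b' < int p"
    using d p_gt_2 by (auto simp: reps_def)
  have zero: "x = 0" if "int p dvd x" "0 \<le> x" "x < int p" for x
    using eqI[of x 0] that p_gt_2 by (simp add: cong_0_iff)
  have "m = m'"
  proof -
    have "m' = 0" if "m = 0" using c(2) that zero[of m'] range p_gt_2 by (simp add: cong_0_iff)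
    moreover have "m = 0" if "m' = 0"
      using c(1,2) that zero[of m] range p_gt_2 prime_p
      by (simp add: cong_iff_dvd_diff prime_dvd_mult_iff)
    moreover have "m = 0 \<or> m = 1" "m' = 0 \<or> m' = 1" using range by auto
    ultimately show ?thesis by auto
  qed
  moreover have b0: "b = 0 \<longleftrightarrow> b' = 0"
  proof
    assume "b = 0"
    then have "int p dvd b' * l" using c(4) by (simp add: cong_iff_dvd_diff)
    then show "b' = 0" using c(1) prime_p zero range by (simp add: prime_dvd_mult_iff)
  next
    assume "b' = 0"
    then show "b = 0" using c(4) zero range by (simp add: cong_0_iff)
  qed
  moreover have "b = b'"
  proof (cases "m = 1")
    case True
    then have "[1 = l] (mod int p)" using c(2) \<open>m = m'\<close> by simp
    then have "[b = b' * 1] (mod int p)"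
      using cong_trans[OF c(4) cong_scalar_left[OF cong_sym]] by blast
    then show ?thesis using eqI range by simp
  next
    case False
    then show ?thesis using b0 d \<open>m = m'\<close> by (auto simp: reps_def)
  qed
  moreover have "a = a'"
  proof (cases "b = 0")
    case True
    then show ?thesis using b0 c(3) eqI range by simp
  next
    case False
    then show ?thesis using b0 d by (auto simp: reps_def)
  qed
  ultimately show ?thesis by simp
qed

lemma num_skew_braces_Y:
  assumes G: "Y 1 0 \<cong> G"
  shows "num_skew_braces G H = 2 * card {(m, a, b) \<in> reps. Y a b \<cong> H}"
proof -
  let ?Q = "\<lambda>(m, a :: int, b :: int). twisted m" and ?psi = "\<lambda>(m, a, b). psi m a b"
  have "num_skew_braces G H = 2 * card {d \<in> reps. char_product q (?Q d) (?psi d) \<cong> H}"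
  proof (rule num_skew_braces_char_product[OF G])
    show "skew_brace V (?Q d) \<and> mod_char q (?Q d) (chi 1 0) \<and> mod_char q (?Q d) (?psi d)" for d
      using skew_brace_twisted mod_char_chi_twisted mod_char_psi by (cases d) simp
  next
    fix Q \<psi> assume Q: "skew_brace V Q" "mod_char q Q (chi 1 0)" "mod_char q Q \<psi>"
    obtain m' a' b' where
      1: "char_brace_iso V q (chi 1 0) (twisted m') (psi m' a' b') Q \<psi> (\<lambda>x. x)"
      by (rule complete_data[OF Q])
    obtain m a b k l where d: "(m, a, b) \<in> reps" "\<not> int p dvd l" "[m' = l * m] (mod int p)"
      "[a = a' + b' * k] (mod int p)" "[b = b' * l] (mod int p)"
      by (rule reps_complete)
    have "char_brace_iso V q (chi 1 0) (twisted m) (psi m a b) Q \<psi> ((\<lambda>x. x) \<circ> shear k l)"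
      by (rule char_brace_iso_trans[OF _ char_brace_iso_shear[OF d(2-5)] 1]) simp
    then show "\<exists>d\<in>reps. \<exists>h. char_brace_iso V q (chi 1 0) (?Q d) (?psi d) Q \<psi> h"
      using d(1) by (intro bexI[of _ "(m, a, b)"]) auto
  next
    fix d d' F assume *: "d \<in> reps" "d' \<in> reps"
      "char_brace_iso V q (chi 1 0) (?Q d) (?psi d) (?Q d') (?psi d') F"
    obtain m a b m' a' b' where d: "d = (m, a, b)" "d' = (m', a', b')" by (metis surj_pair)
    obtain k l where "\<not> int p dvd l" "[m' = l * m] (mod int p)" "[a = a' + b' * k] (mod int p)"
      "[b = b' * l] (mod int p)"
      using *(3) unfolding d prod.case by (rule char_brace_iso_imp_cong)
    then show "d = d'" using reps_distinct *(1,2) unfolding d by blast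
  qed
  also have "{d \<in> reps. char_product q (?Q d) (?psi d) \<cong> H} = {(m, a, b) \<in> reps. Y a b \<cong> H}"
    by (auto simp: char_product_twisted_iso_iff)
  finally show ?thesis .
qed

lemma card_reps: "card reps = 3 * p" and finite_reps: "finite reps"
proof -
  let ?A = "{0, 1 :: int} \<times> {0..<int p} \<times> {0 :: int}" and ?B = "{1 :: int} \<times> {0 :: int} \<times> {1..<int p}"
  have r: "reps = insert (0, 0, 1) (?A \<union> ?B)" by (auto simp: reps_def)
  show "finite reps" by (simp add: r)
  have "card (?A \<union> ?B) = card ?A + card ?B" by (intro card_Un_disjoint) auto
  then show "card reps = 3 * p" using p_gt_2 by (simp add: r card_cartesian_product card_insert_if)
qed

text \<open>Of the 3p representatives, exactly (0, 0, 0) and (1, 0, 0) have trivial \<psi>. So the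
  abelian group gets 2 * 2 braces and the nonabelian one 2 (3p - 2).\<close>

theorem num_skew_braces_Y_cases:
  fixes H :: "'c monoid"
  assumes G: "Y 1 0 \<cong> G" and H: "group H"
  shows "Y 0 0 \<cong> H \<Longrightarrow> num_skew_braces G H = 4"
    and "Y 1 0 \<cong> H \<Longrightarrow> num_skew_braces G H = 6 * p - 4"
    and "(\<And>a b. \<not> Y a b \<cong> H) \<Longrightarrow> num_skew_braces G H = 0"
proof -
  note N = num_skew_braces_Y[OF G]
  have pp: "int p dvd x \<longleftrightarrow> x = 0" if "0 \<le> x" "x < int p" for x
    using that zdvd_not_zless[of x "int p"] by (cases "x = 0") auto
  have zero: "int p dvd a \<and> int p dvd b \<longleftrightarrow> a = 0 \<and> b = 0" if "(m, a, b) \<in> reps" for m a b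
    using that p_gt_2 by (auto simp: reps_def pp)
  have Z: "{(m, a, b) \<in> reps. a = 0 \<and> b = 0} = {(0, 0, 0), (1, 0, 0)}"
    using p_gt_2 by (auto simp: reps_def)
  show "num_skew_braces G H = 4" if "Y 0 0 \<cong> H"
  proof -
    have "{(m, a, b) \<in> reps. Y a b \<cong> H} = {(m, a, b) \<in> reps. a = 0 \<and> b = 0}"
      by (auto simp: Y_iso_iff(1)[OF H that]) (use zero in blast)+
    then show ?thesis unfolding N Z by simp
  qed
  show "num_skew_braces G H = 6 * p - 4" if "Y 1 0 \<cong> H"
  proof -
    have "{(m, a, b) \<in> reps. Y a b \<cong> H} = reps - {(m, a, b) \<in> reps. a = 0 \<and> b = 0}"
      unfolding Y_iso_iff(2)[OF H that] using zero by blast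
    also have "card \<dots> = card reps - card {(m, a, b) \<in> reps. a = 0 \<and> b = 0}"
      using finite_reps by (intro card_Diff_subset) (auto intro: finite_subset)
    finally show ?thesis unfolding N Z card_reps by simp
  qed
  show "num_skew_braces G H = 0" if "\<And>a b. \<not> Y a b \<cong> H"
  proof -
    have "{(m, a, b) \<in> reps. Y a b \<cong> H} = {}" using that by auto
    then show ?thesis unfolding N by (simp only: card.empty mult_0_right)
  qed
qed

end

subsection \<open>The groups of order \<open>p\<^sup>2q\<close>\<close>

lemma cyclic_semidirect_eq_char_product:
  "cyclic_semidirect q u m = char_product q (integer_mod_group m) (\<lambda>s. int u ^ nat s)"
  by (simp add: cyclic_semidirect_def char_product_def)

lemma order_integer_mod_group: "order (integer_mod_group n) = n"
  by (simp add: order_def carrier_integer_mod_group)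

lemma order_cyclic_semidirect: "q > 0 \<Longrightarrow> m > 0 \<Longrightarrow> order (cyclic_semidirect q u m) = q * m"
  by (simp add: order_def cyclic_semidirect_eq_char_product carrier_char_product
      carrier_integer_mod_group card_cartesian_product)

context cyclic_complement
begin

lemma Y_iso_cyclic_semidirect: "Y (int k) \<cong> cyclic_semidirect q (h ^ k) n"
  unfolding cyclic_semidirect_eq_char_product
proof (rule is_isoI[OF char_product_iso[OF iso_set_refl]])
  fix t assume "t \<in> carrier Z"
  then obtain r where "t = int r" by (metis atLeastLessThan_iff carrier_Z nonneg_int_cases)
  then show "[int (h ^ k) ^ nat t = chi (int k) t] (mod int q)"
    using hpow_of_nat[of "k * r"] by (simp add: chi_def power_mult cong_sym)
qed (use q_gt_1 in simp)

text \<open>Chinese remainder theorem, with p \<noteq> q because p < p^2 < q.\<close>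

lemma Y0_iso_cyclic: "Y 0 \<cong> integer_mod_group (n * q)"
proof -
  let ?C = "integer_mod_group (n * q)" and ?f = "\<lambda>x. (x mod int q, x mod int n)"
  have nq: "n * q > 0" using n_pos q_gt_1 by simp
  have hom: "?f \<in> hom ?C (Y 0)"
  proof (rule homI)
    show "?f x \<in> carrier (Y 0)" for x using n_pos q_gt_1 by (simp add: carrier_Y)
    show "?f (x \<otimes>\<^bsub>?C\<^esub> y) = ?f x \<otimes>\<^bsub>Y 0\<^esub> ?f y" for x y
      by (simp add: chi_def mod_simps mod_mod_cancel)
  qed
  have "inj_on ?f (carrier ?C)"
  proof (rule inj_onI)
    fix x y assume xy: "x \<in> carrier ?C" "y \<in> carrier ?C" "?f x = ?f y"
    have "\<not> int p dvd int q"
    proof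
      assume "int p dvd int q"
      then have "p = q" using prime_p prime_q primes_dvd_imp_eq by simp
      moreover have "p < p * p" using p_gt_2 by simp
      ultimately show False using n_less_q n by simp
    qed
    then have "coprime (int n) (int q)" using coprime_n coprime_commute by blast
    moreover have "[x = y] (mod int n)" "[x = y] (mod int q)" using xy(3) by (simp_all add: cong_def)
    ultimately have "[x = y] (mod int n * int q)" by (rule coprime_cong_mult[rotated 2])
    then show "x = y" using xy(1,2) nq by (simp add: carrier_integer_mod_group cong_def split: if_splits)
  qed
  moreover have "card (carrier ?C) = card (carrier (Y 0))"
    using n_pos q_gt_1 by (simp add: carrier_Y carrier_integer_mod_group card_cartesian_product
        nat_mult_distrib)
  moreover have "finite (carrier (Y 0))" by (simp add: carrier_Y)
  moreover have "?f ` carrier ?C \<subseteq> carrier (Y 0)" using hom by (auto simp: hom_def)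
  ultimately have "bij_betw ?f (carrier ?C) (carrier (Y 0))"
    using card_subset_eq[of "carrier (Y 0)" "?f ` carrier ?C"] card_image[of ?f "carrier ?C"]
    unfolding bij_betw_def by simp
  then have "?C \<cong> Y 0" using hom by (intro is_isoI[of ?f]) (simp add: Group.iso_def)
  then show ?thesis by (rule group.iso_sym[OF group_integer_mod_group])
qed

end

context elementary_complement
begin

lemma Y00_iso: "Y 0 0 \<cong> V \<times>\<times> integer_mod_group q"
proof -
  have "prod.swap \<in> iso (Y 0 0) (V \<times>\<times> integer_mod_group q)"
    using q_gt_1
    by (auto simp: Group.iso_def hom_def bij_betw_def inj_on_def carrier_Y carrier_DirProd[of V]
        carrier_integer_mod_group[of q] chi image_iff split: if_splits)
  then show ?thesis by (rule is_isoI)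
qed

lemma Y10_iso: "Y 1 0 \<cong> integer_mod_group p \<times>\<times> cyclic_semidirect q w p"
proof -
  let ?K = "integer_mod_group p \<times>\<times> cyclic_semidirect q w p" and ?f = "\<lambda>(a, x, y). (y, a, x)"
  have cK: "carrier ?K = {0..<int p} \<times> {0..<int q} \<times> {0..<int p}"
    using q_gt_1 n_pos
    by (simp add: cyclic_semidirect_eq_char_product carrier_DirProd carrier_char_product carrier_integer_mod_group)
  have chi_eq: "(a + chi 1 0 (x, y) * b) mod int q = (a + int w ^ nat x * b) mod int q"
    if "0 \<le> x" for a b x y
  proof -
    have "[chi 1 0 (x, y) = int w ^ nat x] (mod int q)"
      using hpow_of_nat[of "nat x"] that by (simp add: chi)
    from cong_add[OF cong_refl cong_scalar_right[OF this]] show ?thesis by (simp add: cong_def)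
  qed
  have "?f \<in> hom (Y 1 0) ?K"
  proof (rule homI)
    show "?f s \<in> carrier ?K" if "s \<in> carrier (Y 1 0)" for s
      using that unfolding cK by (auto simp: carrier_Y carrier_V)
    show "?f (s \<otimes>\<^bsub>Y 1 0\<^esub> t) = ?f s \<otimes>\<^bsub>?K\<^esub> ?f t" if "s \<in> carrier (Y 1 0)" "t \<in> carrier (Y 1 0)" for s t
      using that chi_eq by (auto simp: carrier_Y carrier_V cyclic_semidirect_eq_char_product)
  qed
  moreover have "bij_betw ?f (carrier (Y 1 0)) (carrier ?K)"
    unfolding cK
    by (rule bij_betw_byWitness[where f' = "\<lambda>(y, a, x). (a, x, y)"]) (auto simp: carrier_Y carrier_V)
  ultimately show ?thesis by (intro is_isoI[of ?f]) (simp add: Group.iso_def)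
qed

text \<open>Each \<open>Y a b\<close> is isomorphic to \<open>Y 0 0\<close> or \<open>Y 1 0\<close>,
  both of which are direct products of groups of order p, q or p q.\<close>

lemma exponent_dvd_of_Y_iso:
  fixes H :: "'c monoid"
  assumes "group H" "Y a b \<cong> H" shows "exponent_dvd (p * q) H"
proof -
  have E: "exponent_dvd (p * q) (integer_mod_group p)" "exponent_dvd (p * q) (integer_mod_group q)"
    by (simp_all add: exponent_dvd_of_order order_integer_mod_group)
  have w: "[w ^ p = 1] (mod q)" using ord[of w q] ord_w by simp
  have gK: "group (cyclic_semidirect q w p)"
    using q_gt_1 n_pos w by (intro cyclic_semidirect_group) auto
  have "exponent_dvd (p * q) (cyclic_semidirect q w p)"
    using gK q_gt_1 n_pos by (intro exponent_dvd_of_order) (simp_all add: order_cyclic_semidirect mult.commute)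
  then have K: "exponent_dvd (p * q) (Y 1 0)"
    using iso_invariants(2)[OF group_Y _ Y10_iso] E gK exponent_dvd_DirProd DirProd_group
    by (metis group_integer_mod_group)
  have "exponent_dvd (p * q) (V \<times>\<times> integer_mod_group q)" by (intro exponent_dvd_DirProd E)
  then have EE: "exponent_dvd (p * q) (Y 0 0)"
    using iso_invariants(2)[OF group_Y _ Y00_iso] by (simp add: DirProd_group group_V)
  have "exponent_dvd (p * q) (Y a b)"
    using EE K iso_invariants(2)[OF group_Y group_Y Y_zero_iso] iso_invariants(2)[OF group_Y group_Y Y_nonzero_iso]
    by metis
  then show ?thesis using iso_invariants(2)[OF group_Y assms] by simp
qed

end

theorem mainTheorem7:
  fixes p q h :: nat
  assumes "Factorial_Ring.prime p" and "Factorial_Ring.prime q" and "p > 2" and "[q = 1] (mod p\<^sup>2)"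
    and "ord q h = p\<^sup>2"
  defines "C \<equiv> integer_mod_group (p\<^sup>2 * q)"
    and "Ghp \<equiv> cyclic_semidirect q (h ^ p) (p\<^sup>2)"
    and "Gh \<equiv> cyclic_semidirect q h (p\<^sup>2)"
    and "E \<equiv> (integer_mod_group p \<times>\<times> integer_mod_group p) \<times>\<times> integer_mod_group q"
    and "K \<equiv> integer_mod_group p \<times>\<times> cyclic_semidirect q (h ^ p) p"
  shows
    "(num_skew_braces Ghp C = 2 * p \<and>
     num_skew_braces Ghp Ghp = 2 * p * (p - 1) \<and>
     num_skew_braces Ghp Gh = 2 * p * (p - 1) \<and>
     num_skew_braces Ghp E = 0 \<and>
     num_skew_braces Ghp K = 0) \<and>
     (num_skew_braces Gh C = 2 \<and>
     num_skew_braces Gh Ghp = 2 * (p - 1) \<and>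
     num_skew_braces Gh Gh = 2 * p * (p - 1) \<and>
     num_skew_braces Gh E = 0 \<and>
     num_skew_braces Gh K = 0) \<and>
     (num_skew_braces K C = 0 \<and>
     num_skew_braces K Ghp = 0 \<and>
     num_skew_braces K Gh = 0 \<and>
     num_skew_braces K E = 4 \<and>
     num_skew_braces K K = 6 * p - 4)"
proof -
  have q1: "q > 1" using assms(2) by (rule prime_gt_1_nat)
  \<comment> \<open>The congruence for q is what supplies the bound |P| < q of
    \<open>prime_char\<close>.\<close>
  then have "p * p dvd q - 1" using assms(4) by (simp add: cong_altdef_nat power2_eq_square)
  then have less: "p * p < q" using q1 by (auto dest!: dvd_imp_le)
  have ord_hp: "ord q (h ^ p) = p"
    using ord_power_aux[of q h p] assms(3,5) by (simp add: power2_eq_square)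
  interpret cyc: cyclic_complement p q "p * p" h
    using assms less by unfold_locales (auto simp: power2_eq_square)
  interpret el: elementary_complement p q "h ^ p"
    using assms less ord_hp by unfold_locales
  have iso: "cyc.Y 0 \<cong> C" "cyc.Y 1 \<cong> Gh" "cyc.Y (int p) \<cong> Ghp" "el.Y 0 0 \<cong> E" "el.Y 1 0 \<cong> K"
    using cyc.Y0_iso_cyclic cyc.Y_iso_cyclic_semidirect[of 1] cyc.Y_iso_cyclic_semidirect[of p]
      el.Y00_iso el.Y10_iso
    by (simp_all add: C_def Gh_def Ghp_def E_def K_def power2_eq_square)
  have h: "[h ^ (p * p) = 1] (mod q)" using ord[of h q] assms(5) by (simp add: power2_eq_square)
  have hp: "[(h ^ p) ^ p = 1] (mod q)" using h by (simp add: power_mult)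
  then have hpp: "[(h ^ p) ^ (p * p) = 1] (mod q)"
    using cong_pow[OF hp, of p] by (simp add: power_mult)
  have gr: "group C" "group Gh" "group Ghp" "group E" "group K"
    using q1 assms(3) h hp hpp
    by (auto simp: C_def Gh_def Ghp_def E_def K_def power2_eq_square
        intro!: DirProd_group cyclic_semidirect_group)
  have exp: "exponent_dvd (p * q) E" "exponent_dvd (p * q) K"
    using el.exponent_dvd_of_Y_iso gr iso by blast+
  \<comment> \<open>These three groups contain elements of order p^2, whereas every
    \<open>el.Y a b\<close> has exponent dividing p q. This invariant accounts for all the
    zeros.\<close>
  have "\<not> exponent_dvd (p * q) C" "\<not> exponent_dvd (p * q) Gh" "\<not> exponent_dvd (p * q) Ghp"
    using cyc.Y_iso_iff(4)[of 0] cyc.not_exponent_dvd_Y iso(1-3) gr(1-3)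
      iso_invariants(2)[OF cyc.group_Y] by blast+
  then have no: "\<not> el.Y a b \<cong> C" "\<not> el.Y a b \<cong> Gh" "\<not> el.Y a b \<cong> Ghp" for a b
    using el.exponent_dvd_of_Y_iso gr by blast+
  note P = cyc.num_skew_braces_Yp_cases[OF iso(3)] and U = cyc.num_skew_braces_Y1_cases[OF iso(2)]
    and N = el.num_skew_braces_Y_cases[OF iso(5)]
  show ?thesis
    using P(1)[OF gr(1) iso(1)] P(2)[OF gr(3) iso(3)] P(3)[OF gr(2) iso(2)] P(4)[OF gr(4) exp(1)]
      P(4)[OF gr(5) exp(2)]
      U(1)[OF gr(1) iso(1)] U(2)[OF gr(3) iso(3)] U(3)[OF gr(2) iso(2)] U(4)[OF gr(4) exp(1)]
      U(4)[OF gr(5) exp(2)]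
      N(3)[OF gr(1) no(1)] N(3)[OF gr(3) no(3)] N(3)[OF gr(2) no(2)] N(1)[OF gr(4) iso(4)]
      N(2)[OF gr(5) iso(5)]
    by blast
qed

end
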